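(* Let $(M,L)$ be a globally hyperbolic Lorentz-Finsler manifold with fixed splitting $\tau$. Every pair $(\mu_0,\mu_1)\in\mathcal{P}^+_\tau(M)$ can be approximated in the weak topology by a sequence $\{(\mu_0^n,\mu_1^n)\}_{n\in\mathbb{N}}\subset\mathcal{P}^+_\tau(M)$ such that for every $n$ the dual Kantorovich problem (DKP) for $(\mu_0^n,\mu_1^n)$ admits a solution.
   Context: Setting. $M$ is a smooth manifold with a fixed complete Riemannian metric $h$ (norm $|\cdot|$); $T^0M$ is the zero section of $TM$. $\mathbb{L}\colon TM\to\mathbb{R}$ is continuous, smooth on $TM\setminus T^0M$, positively homogeneous of degree $2$ on fibres, and its second fibre derivative is non-degenerate with index $\dim M-1$ (exactly $\dim M-1$ negative eigenvalues). A causal structure $\mathcal{C}\subset TM$ is a closed set such that each $\mathcal{C}_x=\mathcal{C}\cap T_xM$ is the closure of a connected component of $\{v\in T_xM: \mathbb{L}(v)>0\}$, the choice of component depending continuously on $x$. Fix such a $\mathcal{C}$ and set $L(v)=-\sqrt{\mathbb{L}(v)}$ for $v\in\mathcal{C}$ and $L(v)=\infty$ otherwise. $(M,L)$ is called a Lorentz-Finsler manifold. Causality. An absolutely continuous curve $\gamma\colon I\to M$ is causal if $\dot\gamma(t)\in\mathcal{C}$ for almost all $t$ (constant curves are causal). $J^+(x)$ is the set of $y$ such that a causal curve $\gamma\colon[a,b]\to M$ with $\gamma(a)=x,\gamma(b)=y$ exists; $J^-(y)=\{x: y\in J^+(x)\}$; $J^+=\{(x,y): y\in J^+(x)\}$.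 $(M,L)$ is causal if there is no nonconstant closed causal curve, and globally hyperbolic if it is causal and all $J^+(x)\cap J^-(y)$ are compact. A splitting is a diffeomorphism $M\cong\mathbb{R}\times N$ such that the projection $\tau\colon M\to\mathbb{R}$ to the first factor satisfies $-d\tau(v)\le\min\{L(v),-|v|\}$ for all $v\in\mathcal{C}$; one is fixed. Cost. $\mathcal{A}(\gamma)=\int_a^bL(\dot\gamma)\,dt$ for absolutely continuous $\gamma\colon[a,b]\to M$; $c_L(x,y)=\min\{\mathcal{A}(\gamma):\gamma\text{ connects }x\text{ to }y\}\in\mathbb{R}\cup\{\infty\}$ ($\infty$ iff $(x,y)\notin J^+$; $c_L(x,x)=0$). $\mathcal{P}^+_\tau(M)$ is the set of pairs $(\mu_0,\mu_1)$ of Borel probability measures on $M$ with $\tau\in L^1(\mu_0)\cap L^1(\mu_1)$ admitting a coupling $\pi$ with $\pi(J^+)=1$. An optimal coupling of $(\mu_0,\mu_1)$ is a minimizer of $\int c_L\,d\pi$ among all couplings. Duality. $\psi\colon M\to\mathbb{R}\cup\{\infty\}$, $\psi\not\equiv\infty$, is $c_L$-convex if $\psi(x)=\sup_{y\in M}\{\zeta(y)-c_L(x,y)\}$ for all $x\in M$, for some $\zeta\colon M\to\mathbb{R}\cup\{\pm\infty\}$ (with $\infty-\infty=-\infty$). Its $c_L$-transform is $\psi^{c_L}(y)=\inf_{x\in M}\{\psi(x)+c_L(x,y)\}$. A $c_L$-convex $\psi$ is a solution to the DKP for $(\mu,\nu)$ if $\psi$ is $\mu$-almost surely finite and $\psi^{c_L}(y)-\psi(x)=c_L(x,y)$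 $\pi$-almost surely for every optimal coupling $\pi$ of $\mu$ and $\nu$. *)

theory Defs
  imports "HOL-Probability.Probability"
begin

text \<open>
  Intended for open sets \<open>S\<close> in finite-dimensional spaces, where continuity of
  all directional derivatives up to order \<open>k\<close> is the usual \<open>C\<^sup>k\<close> condition.
\<close>

primrec Ck_on ::
  "nat \<Rightarrow> 'a::real_normed_vector set \<Rightarrow> ('a \<Rightarrow> 'b::real_normed_vector) \<Rightarrow> bool" where
  "Ck_on 0 S f \<longleftrightarrow> continuous_on S f"
| "Ck_on (Suc k) S f \<longleftrightarrow>
     (\<forall>x\<in>S. f differentiable (at x)) \<and> (\<forall>v. Ck_on k S (\<lambda>x. frechet_derivative f (at x) v))"

definition smooth_on ::
  "'a::real_normed_vector set \<Rightarrow> ('a \<Rightarrow> 'b::real_normed_vector) \<Rightarrow> bool" where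
  "smooth_on S f \<longleftrightarrow> (\<forall>k. Ck_on k S f)"

text \<open>
  The underlying space of a manifold is a whole type; Hausdorffness and second countability are
  imposed by its sort. A chart is a domain together with a map that is only relevant on this
  domain. The atlas need not be maximal. Model spaces are finite-dimensional normed spaces (rather
  than members of \<^class>\<open>euclidean_space\<close>) so that dimension 0 is included, as needed for the
  factor \<open>N\<close> of a splitting of a one-dimensional manifold.
\<close>

type_synonym ('m, 'e) chart = "'m set \<times> ('m \<Rightarrow> 'e)"

definition chart_image :: "('m, 'e) chart \<Rightarrow> 'e set" where
  "chart_image c = snd c ` fst c"

definition chart_inv :: "('m, 'e) chart \<Rightarrow> 'e \<Rightarrow> 'm" where
  "chart_inv c = inv_into (fst c) (snd c)"

definition is_chart :: "('m::topological_space, 'e::real_normed_vector) chart \<Rightarrow> bool" where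
  "is_chart c \<longleftrightarrow> open (fst c) \<and> open (chart_image c) \<and>
     homeomorphism (fst c) (chart_image c) (snd c) (chart_inv c)"

definition smooth_manifold ::
  "('m::{second_countable_topology, t2_space}, 'e::real_normed_vector) chart set \<Rightarrow> bool" where
  "smooth_manifold A \<longleftrightarrow>
     (\<exists>B::'e set. finite B \<and> span B = UNIV) \<and>
     (\<forall>c\<in>A. is_chart c) \<and> (\<Union>c\<in>A. fst c) = UNIV \<and>
     (\<forall>c\<in>A. \<forall>d\<in>A. smooth_on (snd c ` (fst c \<inter> fst d)) (snd d \<circ> chart_inv c))"

definition smooth_map ::
  "('m::topological_space, 'e::real_normed_vector) chart set \<Rightarrow>
   ('n::topological_space, 'f::real_normed_vector) chart set \<Rightarrow> ('m \<Rightarrow> 'n) \<Rightarrow> bool" where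
  "smooth_map A B f \<longleftrightarrow> continuous_on UNIV f \<and>
     (\<forall>c\<in>A. \<forall>d\<in>B. smooth_on (snd c ` (fst c \<inter> f -` fst d)) (snd d \<circ> f \<circ> chart_inv c))"

definition diffeomorphism ::
  "('m::topological_space, 'e::real_normed_vector) chart set \<Rightarrow>
   ('n::topological_space, 'f::real_normed_vector) chart set \<Rightarrow> ('m \<Rightarrow> 'n) \<Rightarrow> bool" where
  "diffeomorphism A B f \<longleftrightarrow> bij f \<and> smooth_map A B f \<and> smooth_map B A (inv f)"

definition real_times_atlas :: "('n, 'f) chart set \<Rightarrow> (real \<times> 'n, real \<times> 'f) chart set" where
  "real_times_atlas B = (\<lambda>d. (UNIV \<times> fst d, map_prod id (snd d))) ` B"

text \<open>
  Each point \<open>p\<close> is assigned one fixed chart of the atlas around \<open>p\<close>, and \<open>T\<^sub>pM\<close> is identified with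
  the model space \<open>'e\<close> by means of the differential of that chart. As a set, the tangent bundle is
  thus \<open>'m \<times> 'e\<close>. The choice of charts bears no relation to the topology; the topology and the
  smooth structure of \<open>TM\<close> are \<^emph>\<open>not\<close> those of the product, but are given by the parametrisations
  \<open>tangent_param A c\<close>, which map \<open>(y, w)\<close> to the tangent vector whose components in the
  coordinates \<open>c\<close> are \<open>w\<close>, based at the point with coordinates \<open>y\<close>.
\<close>

definition chart_at :: "('m, 'e) chart set \<Rightarrow> 'm \<Rightarrow> ('m, 'e) chart" where
  "chart_at A p = (SOME c. c \<in> A \<and> p \<in> fst c)"

definition tangent_param ::
  "('m, 'e::real_normed_vector) chart set \<Rightarrow> ('m, 'e) chart \<Rightarrow> 'e \<times> 'e \<Rightarrow> 'm \<times> 'e" where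
  "tangent_param A c = (\<lambda>(y, w).
     (chart_inv c y,
      frechet_derivative (snd (chart_at A (chart_inv c y)) \<circ> chart_inv c) (at y) w))"

definition tangent_open :: "('m, 'e::real_normed_vector) chart set \<Rightarrow> ('m \<times> 'e) set \<Rightarrow> bool" where
  "tangent_open A W \<longleftrightarrow>
     (\<forall>c\<in>A. open {z \<in> chart_image c \<times> UNIV. tangent_param A c z \<in> W})"

definition tangent_topology ::
  "('m::topological_space, 'e::real_normed_vector) chart set \<Rightarrow> ('m \<times> 'e) topology" where
  "tangent_topology A = topology (tangent_open A)"

lemma openin_tangent_topology: "openin (tangent_topology A) W \<longleftrightarrow> tangent_open A W"
proof -
  have Int: "{z \<in> U. f z \<in> S \<inter> T} = {z \<in> U. f z \<in> S} \<inter> {z \<in> U. f z \<in> T}"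
    for U :: "('b \<times> 'b) set" and f :: "'b \<times> 'b \<Rightarrow> 'a \<times> 'b" and S T by auto
  have Un: "{z \<in> U. f z \<in> \<Union>K} = (\<Union>S\<in>K. {z \<in> U. f z \<in> S})"
    for U :: "('b \<times> 'b) set" and f :: "'b \<times> 'b \<Rightarrow> 'a \<times> 'b" and K by auto
  have "istopology (tangent_open A)"
    unfolding istopology_def tangent_open_def Int Un by (auto intro!: open_Int open_UN)
  then show ?thesis
    by (simp add: tangent_topology_def topology_inverse')
qed

lemma topspace_tangent_topology:
  assumes "\<forall>c\<in>A. is_chart c"
  shows "topspace (tangent_topology A) = UNIV"
proof -
  have "tangent_open A UNIV"
    using assms by (auto simp: tangent_open_def is_chart_def intro!: open_Times)
  then show ?thesis
    unfolding topspace_def openin_tangent_topology by auto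
qed

definition differential ::
  "('m, 'e::real_normed_vector) chart set \<Rightarrow> ('m \<Rightarrow> real) \<Rightarrow> 'm \<Rightarrow> 'e \<Rightarrow> real" where
  "differential A f p v =
     frechet_derivative (f \<circ> chart_inv (chart_at A p)) (at (snd (chart_at A p) p)) v"

text \<open>Only meaningful at points of differentiability, that is, almost everywhere on absolutely
  continuous curves.\<close>

definition velocity ::
  "('m, 'e::real_normed_vector) chart set \<Rightarrow> (real \<Rightarrow> 'm) \<Rightarrow> real \<Rightarrow> 'e" where
  "velocity A \<gamma> t = vector_derivative (snd (chart_at A (\<gamma> t)) \<circ> \<gamma>) (at t)"

text \<open>The finite family of non-overlapping intervals \<open>[p, q]\<close> is represented by the set of the
  pairs \<open>(p, q)\<close>.\<close>

definition abs_continuous_on ::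
  "real \<Rightarrow> real \<Rightarrow> (real \<Rightarrow> 'e::real_normed_vector) \<Rightarrow> bool" where
  "abs_continuous_on a b g \<longleftrightarrow>
     (\<forall>\<epsilon>>0. \<exists>\<delta>>0. \<forall>D :: (real \<times> real) set.
        finite D \<longrightarrow> (\<forall>(p, q)\<in>D. a \<le> p \<and> p < q \<and> q \<le> b) \<longrightarrow>
        pairwise (\<lambda>I J. {fst I<..<snd I} \<inter> {fst J<..<snd J} = {}) D \<longrightarrow>
        (\<Sum>(p, q)\<in>D. q - p) < \<delta> \<longrightarrow> (\<Sum>(p, q)\<in>D. norm (g q - g p)) < \<epsilon>)"

definition ac_curve ::
  "('m::topological_space, 'e::real_normed_vector) chart set \<Rightarrow> (real \<Rightarrow> 'm) \<Rightarrow> real \<Rightarrow> real \<Rightarrow> bool"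
  where
  "ac_curve A \<gamma> a b \<longleftrightarrow> a < b \<and> continuous_on {a..b} \<gamma> \<and>
     (\<forall>c\<in>A. \<forall>s t. a \<le> s \<longrightarrow> s < t \<longrightarrow> t \<le> b \<longrightarrow> \<gamma> ` {s..t} \<subseteq> fst c \<longrightarrow>
        abs_continuous_on s t (snd c \<circ> \<gamma>))"

definition riemannian_metric ::
  "('m::{second_countable_topology, t2_space}, 'e::real_normed_vector) chart set \<Rightarrow>
   ('m \<Rightarrow> 'e \<Rightarrow> 'e \<Rightarrow> real) \<Rightarrow> bool" where
  "riemannian_metric A h \<longleftrightarrow>
     (\<forall>p. bilinear (h p) \<and> (\<forall>u v. h p u v = h p v u) \<and> (\<forall>v. v \<noteq> 0 \<longrightarrow> h p v v > 0)) \<and>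
     (\<forall>c\<in>A. \<forall>u v. smooth_on (chart_image c)
        (\<lambda>y. h (chart_inv c y) (snd (tangent_param A c (y, u))) (snd (tangent_param A c (y, v)))))"

definition riemannian_norm :: "('m \<Rightarrow> 'e \<Rightarrow> 'e \<Rightarrow> real) \<Rightarrow> 'm \<Rightarrow> 'e \<Rightarrow> real" where
  "riemannian_norm h p v = sqrt (h p v v)"

definition riemannian_length ::
  "('m, 'e::real_normed_vector) chart set \<Rightarrow> ('m \<Rightarrow> 'e \<Rightarrow> 'e \<Rightarrow> real) \<Rightarrow>
   (real \<Rightarrow> 'm) \<Rightarrow> real \<Rightarrow> real \<Rightarrow> ennreal" where
  "riemannian_length A h \<gamma> a b =
     (\<integral>\<^sup>+ t. ennreal (riemannian_norm h (\<gamma> t) (velocity A \<gamma> t)) \<partial>lebesgue_on {a..b})"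

definition riemannian_distance ::
  "('m::topological_space, 'e::real_normed_vector) chart set \<Rightarrow> ('m \<Rightarrow> 'e \<Rightarrow> 'e \<Rightarrow> real) \<Rightarrow>
   'm \<Rightarrow> 'm \<Rightarrow> ennreal" where
  "riemannian_distance A h x y =
     Inf {riemannian_length A h \<gamma> a b |\<gamma> a b. ac_curve A \<gamma> a b \<and> \<gamma> a = x \<and> \<gamma> b = y}"

definition complete_riemannian_metric ::
  "('m::{second_countable_topology, t2_space}, 'e::real_normed_vector) chart set \<Rightarrow>
   ('m \<Rightarrow> 'e \<Rightarrow> 'e \<Rightarrow> real) \<Rightarrow> bool" where
  "complete_riemannian_metric A h \<longleftrightarrow> riemannian_metric A h \<and>
     (\<forall>X :: nat \<Rightarrow> 'm.
        (\<forall>\<epsilon>>0. \<exists>k. \<forall>i\<ge>k. \<forall>j\<ge>k. riemannian_distance A h (X i) (X j) < \<epsilon>) \<longrightarrow>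
        (\<exists>x. (\<lambda>i. riemannian_distance A h (X i) x) \<longlonglongrightarrow> 0))"

definition second_derivative :: "('e::real_normed_vector \<Rightarrow> real) \<Rightarrow> 'e \<Rightarrow> 'e \<Rightarrow> 'e \<Rightarrow> real" where
  "second_derivative F v u w =
     frechet_derivative (\<lambda>v'. frechet_derivative F (at v') u) (at v) w"

text \<open>The linear operator representing a bilinear form with respect to the inner product of the
  model space; its matrix in the standard basis is the Gram matrix of the form.\<close>

definition form_operator :: "('e::euclidean_space \<Rightarrow> 'e \<Rightarrow> real) \<Rightarrow> 'e \<Rightarrow> 'e" where
  "form_operator B u = (\<Sum>b\<in>Basis. B u b *\<^sub>R b)"

text \<open>The number of negative eigenvalues of a symmetric form, counted with multiplicity.\<close>

definition form_index :: "('e::euclidean_space \<Rightarrow> 'e \<Rightarrow> real) \<Rightarrow> nat" where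
  "form_index B =
     (\<Sum>l | l < 0 \<and> (\<exists>u. u \<noteq> 0 \<and> form_operator B u = l *\<^sub>R u). dim {u. form_operator B u = l *\<^sub>R u})"

definition nondegenerate_form :: "('e::real_vector \<Rightarrow> 'e \<Rightarrow> real) \<Rightarrow> bool" where
  "nondegenerate_form B \<longleftrightarrow> (\<forall>u. (\<forall>w. B u w = 0) \<longrightarrow> u = 0)"

definition lorentz_finsler_function ::
  "('m::{second_countable_topology, t2_space}, 'e::euclidean_space) chart set \<Rightarrow>
   ('m \<Rightarrow> 'e \<Rightarrow> real) \<Rightarrow> bool" where
  "lorentz_finsler_function A F \<longleftrightarrow>
     continuous_map (tangent_topology A) euclideanreal (\<lambda>(p, v). F p v) \<and>
     (\<forall>c\<in>A. smooth_on (chart_image c \<times> (UNIV - {0})) ((\<lambda>(p, v). F p v) \<circ> tangent_param A c)) \<and>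
     (\<forall>p v t. t > 0 \<longrightarrow> F p (t *\<^sub>R v) = t\<^sup>2 * F p v) \<and>
     (\<forall>p v. v \<noteq> 0 \<longrightarrow>
        nondegenerate_form (second_derivative (F p) v) \<and>
        form_index (second_derivative (F p) v) = DIM('e) - 1)"

definition fibre :: "('m \<times> 'e) set \<Rightarrow> 'm \<Rightarrow> 'e set" where
  "fibre C p = {v. (p, v) \<in> C}"

text \<open>
  Continuous dependence of the chosen component \<open>K p\<close> on \<open>p\<close> means that \<open>{(p, v). v \<in> K p}\<close> is
  open in \<open>TM\<close>: a vector field given near \<open>p\<close> by constant components in a chart and lying in \<open>K p\<close>
  at \<open>p\<close> stays in the chosen components near \<open>p\<close>.
\<close>

definition causal_structure ::
  "('m::{second_countable_topology, t2_space}, 'e::euclidean_space) chart set \<Rightarrow>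
   ('m \<Rightarrow> 'e \<Rightarrow> real) \<Rightarrow> ('m \<times> 'e) set \<Rightarrow> bool" where
  "causal_structure A F C \<longleftrightarrow> closedin (tangent_topology A) C \<and>
     (\<exists>K. (\<forall>p. K p \<in> components {v. F p v > 0} \<and> fibre C p = closure (K p)) \<and>
        openin (tangent_topology A) {(p, v). v \<in> K p})"

definition lorentz_finsler_manifold ::
  "('m::{second_countable_topology, t2_space}, 'e::euclidean_space) chart set \<Rightarrow>
   ('m \<Rightarrow> 'e \<Rightarrow> 'e \<Rightarrow> real) \<Rightarrow> ('m \<Rightarrow> 'e \<Rightarrow> real) \<Rightarrow> ('m \<times> 'e) set \<Rightarrow> bool" where
  "lorentz_finsler_manifold A h F C \<longleftrightarrow>
     smooth_manifold A \<and> complete_riemannian_metric A h \<and>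
     lorentz_finsler_function A F \<and> causal_structure A F C"

definition lagrangian :: "('m \<Rightarrow> 'e \<Rightarrow> real) \<Rightarrow> ('m \<times> 'e) set \<Rightarrow> 'm \<Rightarrow> 'e \<Rightarrow> ereal" where
  "lagrangian F C p v = (if v \<in> fibre C p then ereal (- sqrt (F p v)) else \<infinity>)"

definition causal_curve ::
  "('m::topological_space, 'e::real_normed_vector) chart set \<Rightarrow> ('m \<times> 'e) set \<Rightarrow>
   (real \<Rightarrow> 'm) \<Rightarrow> real \<Rightarrow> real \<Rightarrow> bool" where
  "causal_curve A C \<gamma> a b \<longleftrightarrow> ac_curve A \<gamma> a b \<and>
     (AE t in lebesgue_on {a..b}. velocity A \<gamma> t \<in> fibre C (\<gamma> t))"

definition J_plus ::
  "('m::topological_space, 'e::real_normed_vector) chart set \<Rightarrow> ('m \<times> 'e) set \<Rightarrow> ('m \<times> 'm) set"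
  where
  "J_plus A C = {(x, y). \<exists>\<gamma> a b. causal_curve A C \<gamma> a b \<and> \<gamma> a = x \<and> \<gamma> b = y}"

definition globally_hyperbolic ::
  "('m::topological_space, 'e::real_normed_vector) chart set \<Rightarrow> ('m \<times> 'e) set \<Rightarrow> bool" where
  "globally_hyperbolic A C \<longleftrightarrow>
     \<not> (\<exists>\<gamma> a b. causal_curve A C \<gamma> a b \<and> \<gamma> a = \<gamma> b \<and> (\<exists>t\<in>{a..b}. \<gamma> t \<noteq> \<gamma> a)) \<and>
     (\<forall>x y. compact {z. (x, z) \<in> J_plus A C \<and> (z, y) \<in> J_plus A C})"

text \<open>A diffeomorphism \<open>\<Phi>\<close> from \<open>M\<close> to \<open>\<real> \<times> N\<close> is a splitting if its first component \<open>\<tau>\<close> satisfies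
  the stated steepness condition.\<close>

definition splitting ::
  "('m::{second_countable_topology, t2_space}, 'e::euclidean_space) chart set \<Rightarrow>
   ('m \<Rightarrow> 'e \<Rightarrow> 'e \<Rightarrow> real) \<Rightarrow> ('m \<Rightarrow> 'e \<Rightarrow> real) \<Rightarrow> ('m \<times> 'e) set \<Rightarrow>
   ('n::{second_countable_topology, t2_space}, 'f::real_normed_vector) chart set \<Rightarrow>
   ('m \<Rightarrow> real \<times> 'n) \<Rightarrow> bool" where
  "splitting A h F C B \<Phi> \<longleftrightarrow>
     smooth_manifold B \<and> diffeomorphism A (real_times_atlas B) \<Phi> \<and>
     (\<forall>p. \<forall>v\<in>fibre C p. ereal (- differential A (fst \<circ> \<Phi>) p v)
        \<le> min (lagrangian F C p v) (ereal (- riemannian_norm h p v)))"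

text \<open>Integral of an extended real function as the difference of the integrals of its positive and
  negative parts (\<^const>\<open>e2ennreal\<close> sends negative arguments to 0). If both are infinite, the value
  is \<open>\<infinity>\<close>.\<close>

definition ereal_integral :: "'a measure \<Rightarrow> ('a \<Rightarrow> ereal) \<Rightarrow> ereal" where
  "ereal_integral M f =
     enn2ereal (\<integral>\<^sup>+ x. e2ennreal (f x) \<partial>M) - enn2ereal (\<integral>\<^sup>+ x. e2ennreal (- f x) \<partial>M)"

definition action ::
  "('m, 'e::real_normed_vector) chart set \<Rightarrow> ('m \<Rightarrow> 'e \<Rightarrow> real) \<Rightarrow> ('m \<times> 'e) set \<Rightarrow>
   (real \<Rightarrow> 'm) \<Rightarrow> real \<Rightarrow> real \<Rightarrow> ereal" where
  "action A F C \<gamma> a b =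
     ereal_integral (lebesgue_on {a..b}) (\<lambda>t. lagrangian F C (\<gamma> t) (velocity A \<gamma> t))"

text \<open>On globally hyperbolic manifolds the infimum is attained whenever \<open>x\<close> and \<open>y\<close> can be
  connected by a curve at all.\<close>

definition lorentz_cost ::
  "('m::topological_space, 'e::real_normed_vector) chart set \<Rightarrow> ('m \<Rightarrow> 'e \<Rightarrow> real) \<Rightarrow>
   ('m \<times> 'e) set \<Rightarrow> 'm \<Rightarrow> 'm \<Rightarrow> ereal" where
  "lorentz_cost A F C x y =
     Inf {action A F C \<gamma> a b |\<gamma> a b. ac_curve A \<gamma> a b \<and> \<gamma> a = x \<and> \<gamma> b = y}"

definition borel_prob :: "'a::topological_space measure \<Rightarrow> bool" where
  "borel_prob \<mu> \<longleftrightarrow> prob_space \<mu> \<and> sets \<mu> = sets borel"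

definition coupling ::
  "'a::topological_space measure \<Rightarrow> 'a measure \<Rightarrow> ('a \<times> 'a) measure \<Rightarrow> bool" where
  "coupling \<mu> \<nu> \<pi> \<longleftrightarrow> borel_prob \<pi> \<and> distr \<pi> borel fst = \<mu> \<and> distr \<pi> borel snd = \<nu>"

definition causal_pairs ::
  "('m::{second_countable_topology, t2_space}, 'e::real_normed_vector) chart set \<Rightarrow>
   ('m \<times> 'e) set \<Rightarrow> ('m \<Rightarrow> real) \<Rightarrow> ('m measure \<times> 'm measure) set" where
  "causal_pairs A C \<tau> = {(\<mu>, \<nu>). borel_prob \<mu> \<and> borel_prob \<nu> \<and>
     integrable \<mu> \<tau> \<and> integrable \<nu> \<tau> \<and>
     (\<exists>\<pi>. coupling \<mu> \<nu> \<pi> \<and> emeasure \<pi> (J_plus A C) = 1)}"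

definition optimal_coupling ::
  "('a::topological_space \<Rightarrow> 'a \<Rightarrow> ereal) \<Rightarrow> 'a measure \<Rightarrow> 'a measure \<Rightarrow> ('a \<times> 'a) measure \<Rightarrow> bool"
  where
  "optimal_coupling c \<mu> \<nu> \<pi> \<longleftrightarrow> coupling \<mu> \<nu> \<pi> \<and>
     (\<forall>\<pi>'. coupling \<mu> \<nu> \<pi>' \<longrightarrow>
        ereal_integral \<pi> (\<lambda>(x, y). c x y) \<le> ereal_integral \<pi>' (\<lambda>(x, y). c x y))"

definition weakly_converges ::
  "(nat \<Rightarrow> 'a::topological_space measure) \<Rightarrow> 'a measure \<Rightarrow> bool" where
  "weakly_converges \<mu> \<nu> \<longleftrightarrow>
     (\<forall>f :: 'a \<Rightarrow> real. continuous_on UNIV f \<longrightarrow> bounded (range f) \<longrightarrow>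
        (\<lambda>n. integral\<^sup>L (\<mu> n) f) \<longlonglongrightarrow> integral\<^sup>L \<nu> f)"

text \<open>Subtraction with \<open>\<infinity> - \<infinity> = -\<infinity>\<close>; on \<^typ>\<open>ereal\<close> the library has \<open>\<infinity> - \<infinity> = \<infinity>\<close>.\<close>

definition lower_diff :: "ereal \<Rightarrow> ereal \<Rightarrow> ereal" where
  "lower_diff a b = (if a = \<infinity> \<and> b = \<infinity> then -\<infinity> else a - b)"

definition c_convex :: "('a \<Rightarrow> 'a \<Rightarrow> ereal) \<Rightarrow> ('a \<Rightarrow> ereal) \<Rightarrow> bool" where
  "c_convex c \<psi> \<longleftrightarrow> (\<forall>x. \<psi> x \<noteq> -\<infinity>) \<and> (\<exists>x. \<psi> x \<noteq> \<infinity>) \<and>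
     (\<exists>\<zeta>. \<forall>x. \<psi> x = (SUP y. lower_diff (\<zeta> y) (c x y)))"

definition c_transform :: "('a \<Rightarrow> 'a \<Rightarrow> ereal) \<Rightarrow> ('a \<Rightarrow> ereal) \<Rightarrow> 'a \<Rightarrow> ereal" where
  "c_transform c \<psi> y = (INF x. \<psi> x + c x y)"

definition dkp_solution ::
  "('a::topological_space \<Rightarrow> 'a \<Rightarrow> ereal) \<Rightarrow> 'a measure \<Rightarrow> 'a measure \<Rightarrow> ('a \<Rightarrow> ereal) \<Rightarrow> bool" where
  "dkp_solution c \<mu> \<nu> \<psi> \<longleftrightarrow> c_convex c \<psi> \<and> (AE x in \<mu>. \<bar>\<psi> x\<bar> \<noteq> \<infinity>) \<and>
     (\<forall>\<pi>. optimal_coupling c \<mu> \<nu> \<pi> \<longrightarrow>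
        (AE (x, y) in \<pi>. c_transform c \<psi> y - \<psi> x = c x y))"

end

theory Submission
  imports Defs
begin

text \<open>
  The approximating measures are finitely supported. Let \<open>\<pi>\<close> be a coupling of \<open>\<mu>0\<close> and \<open>\<mu>1\<close>
  concentrated on \<open>J\<^sup>+\<close>. The first \<open>n\<close> members of a countable base of \<open>M \<times> M\<close> cut the space into
  finitely many Borel cells; sending every point of a cell that meets \<open>J\<^sup>+\<close> to one chosen point of
  \<open>J\<^sup>+\<close> in the same cell defines Borel maps \<open>T\<^sub>n\<close> with finite range in \<open>J\<^sup>+\<close> that converge to the
  identity pointwise on \<open>J\<^sup>+\<close> (\<open>discretisation_maps\<close>). The images of \<open>\<pi>\<close> under \<open>T\<^sub>n\<close> are causal
  couplings with finite support, and their marginals converge weakly by dominated convergence.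

  Between finitely supported measures, Kantorovich duality is combinatorial and rests on three
  facts about the cost \<open>c\<close>: it is never \<open>-\<infinity>\<close>, it is finite on the diagonal, and some coupling
  charges only pairs of finite cost (\<open>finite_dkp_solution\<close>). Rerouting a little mass along a cycle of
  pairs charged by an optimal coupling cannot lower the cost, so that every such cycle has
  nonnegative weight (\<open>optimal_coupling_cyclic\<close>); shortest paths then give a real function \<open>u\<close>
  on the finitely many sources (\<open>rockafellar_potential\<close>). Put \<open>\<zeta> y = min\<^sub>x (u x + c x y)\<close>, the
  minimum being over the sources, and let \<open>\<psi>\<close> be the transform of \<open>\<zeta>\<close>. The function \<open>\<zeta>\<close> is real
  at the points that some source can reach and \<open>\<infinity>\<close> elsewhere. It is nowhere \<open>-\<infinity>\<close>, and neither is \<open>\<psi>\<close>, by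
  \<open>\<psi> x \<ge> \<zeta> x - c x x\<close>. Equality on the support of every other optimal coupling follows since all
  optimal couplings have the same finite cost and the same marginals.

  Of the three facts on the cost, the last two hold as \<open>L \<le> 0\<close> on causal curves, among them the
  constant ones. The first one is the bound \<open>c x y \<ge> -\<bar>\<tau> y - \<tau> x\<bar>\<close> (\<open>lorentz_cost_lower_bound\<close>),
  where the splitting enters: for an absolutely continuous curve, \<open>-L\<close> is at most the derivative of \<open>\<tau>\<close>
  along the curve wherever the velocity is in the cone, and \<open>\<infinity>\<close> is the value of \<open>L\<close> wherever \<open>\<tau>\<close>
  decreases. This rests on two classical theorems on absolutely continuous functions: they are
  differentiable almost everywhere (\<open>abs_continuous_differentiable\<close>), and they are recovered from the
  derivative by integration (\<open>abs_continuous_ftc\<close>).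
\<close>

section \<open>Lebesgue differentiation of monotone functions\<close>

text \<open>
  On the line, closed balls are the closed intervals, and the point that a ball of a Vitali cover has to
  contain need not be its centre. Intervals with an endpoint at the given point are therefore allowed.
\<close>

lemma vitali_interval_cover:
  fixes S :: "real set" and P :: "real \<Rightarrow> real \<Rightarrow> bool"
  assumes "\<And>x d. x \<in> S \<Longrightarrow> 0 < d \<Longrightarrow> \<exists>u v. u \<le> x \<and> x \<le> v \<and> u < v \<and> v - u < d \<and> P u v"
  obtains \<C> where "countable \<C>" "\<And>u v. (u, v) \<in> \<C> \<Longrightarrow> u < v \<and> P u v"
    "disjoint_family_on (\<lambda>(u, v). {u..v}) \<C>" "negligible (S - (\<Union>(u, v)\<in>\<C>. {u..v}))"
proof -
  let ?K = "{(u, v). u < v \<and> P u v}"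
  let ?a = "\<lambda>(u, v). (u + v) / 2 :: real" and ?r = "\<lambda>(u, v). (v - u) / 2 :: real"
  have cb: "cball (?a z) (?r z) = (case z of (u, v) \<Rightarrow> {u..v})" for z
    by (cases z) (simp add: cball_eq_atLeastAtMost field_simps)
  have cov: "\<exists>i. i \<in> ?K \<and> x \<in> cball (?a i) (?r i) \<and> ?r i < d" if x: "x \<in> S" "0 < d" for x d
  proof -
    obtain u v where "u \<le> x" "x \<le> v" "u < v" "v - u < d" "P u v"
      using assms x by blast
    then show ?thesis
      using \<open>0 < d\<close> unfolding cb by (intro exI[of _ "(u, v)"]) auto
  qed
  have pos: "0 < ?r i" if "i \<in> ?K" for i
    using that by auto
  obtain \<C> where "countable \<C>" "\<C> \<subseteq> ?K"
     "pairwise (\<lambda>i j. disjnt (cball (?a i) (?r i)) (cball (?a j) (?r j))) \<C>"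
     "negligible (S - (\<Union>i \<in> \<C>. cball (?a i) (?r i)))"
    by (rule Vitali_covering_theorem_cballs[of ?K ?r S ?a, OF pos cov]) (assumption | rule that)+
  then show thesis
    unfolding cb by (intro that[of \<C>]) (auto simp: disjoint_family_on_def pairwise_def disjnt_def)
qed

text \<open>
  A monotone function may collapse or stretch intervals, but it keeps the open intervals spanned by the
  endpoint values of disjoint intervals disjoint. Increments of \<open>g\<close> thus add up as lengths, even
  across jumps.
\<close>

lemma emeasure_disjoint_intervals:
  fixes g :: "real \<Rightarrow> real"
  assumes "mono g" "countable \<C>" "\<And>u v. (u, v) \<in> \<C> \<Longrightarrow> u < v"
    and disj: "disjoint_family_on (\<lambda>(u, v). {u..v}) \<C>"
  shows "emeasure lborel (\<Union>(u, v)\<in>\<C>. {u..v}) = (\<integral>\<^sup>+(u, v). ennreal (v - u) \<partial>count_space \<C>)"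
    and "emeasure lborel (\<Union>(u, v)\<in>\<C>. {g u<..<g v}) = (\<integral>\<^sup>+(u, v). ennreal (g v - g u) \<partial>count_space \<C>)"
proof -
  show "emeasure lborel (\<Union>(u, v)\<in>\<C>. {u..v}) = (\<integral>\<^sup>+(u, v). ennreal (v - u) \<partial>count_space \<C>)"
    using assms(2,3) by (subst emeasure_UN_countable[OF _ _ disj])
      (auto intro!: nn_integral_cong simp: less_imp_le)
  have "disjoint_family_on (\<lambda>(u, v). {g u<..<g v}) \<C>"
    unfolding disjoint_family_on_def
  proof (intro ballI impI)
    fix I J assume IJ: "I \<in> \<C>" "J \<in> \<C>" "I \<noteq> J"
    obtain u v u' v' where e: "I = (u, v)" "J = (u', v')" by fastforce
    have "{u..v} \<inter> {u'..v'} = {}"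
      using disj IJ unfolding disjoint_family_on_def e by fastforce
    moreover have "u < v" "u' < v'" using assms(3) IJ e by auto
    ultimately have "v < u' \<or> v' < u"
      by (cases "u \<le> u'") auto
    then have "g v \<le> g u' \<or> g v' \<le> g u"
      using \<open>mono g\<close> by (auto dest: monoD[of g] less_imp_le)
    then show "(case I of (u, v) \<Rightarrow> {g u<..<g v}) \<inter> (case J of (u, v) \<Rightarrow> {g u<..<g v}) = {}"
      unfolding e by auto
  qed
  then show "emeasure lborel (\<Union>(u, v)\<in>\<C>. {g u<..<g v})
      = (\<integral>\<^sup>+(u, v). ennreal (g v - g u) \<partial>count_space \<C>)"
    using assms by (subst emeasure_UN_countable)
      (auto intro!: nn_integral_cong simp: less_imp_le monoD)
qed

text \<open>
  Slopes over all short intervals \<^emph>\<open>around\<close> a point, rather than over intervals that start there, treat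
  the four Dini derivatives at once.
\<close>

definition slopes_near :: "(real \<Rightarrow> real) \<Rightarrow> (real \<Rightarrow> bool) \<Rightarrow> real set" where
  "slopes_near g P = {x. \<forall>d>0. \<exists>u v. u \<le> x \<and> x \<le> v \<and> u < v \<and> v - u < d \<and> P ((g v - g u) / (v - u))}"

lemma vitali_slopes:
  fixes g :: "real \<Rightarrow> real"
  assumes "S \<subseteq> slopes_near g P" "S \<subseteq> U" "open U"
  obtains \<C> where "countable \<C>"
    "\<And>u v. (u, v) \<in> \<C> \<Longrightarrow> u < v \<and> {u..v} \<subseteq> U \<and> P ((g v - g u) / (v - u))"
    "disjoint_family_on (\<lambda>(u, v). {u..v}) \<C>" "negligible (S - (\<Union>(u, v)\<in>\<C>. {u..v}))"
proof -
  have "\<exists>u v. u \<le> x \<and> x \<le> v \<and> u < v \<and> v - u < d \<and> {u..v} \<subseteq> U \<and> P ((g v - g u) / (v - u))"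
    if x: "x \<in> S" "0 < d" for x d
  proof -
    obtain e where e: "e > 0" "ball x e \<subseteq> U"
    using x assms(2,3) openE by blast
  obtain u v where uv: "u \<le> x" "x \<le> v" "u < v" "v - u < min d e" "P ((g v - g u) / (v - u))"
    using assms(1) x e(1) unfolding slopes_near_def by (smt (verit) mem_Collect_eq subsetD)
  moreover have "{u..v} \<subseteq> ball x e"
    using uv by (auto simp: dist_real_def)
  ultimately show ?thesis
    using e(2) by (intro exI[of _ u] exI[of _ v]) auto
  qed
  then show thesis
    by (rule vitali_interval_cover[of S "\<lambda>u v. {u..v} \<subseteq> U \<and> P ((g v - g u) / (v - u))"])
      (assumption | rule that)+
qed


text \<open>
  A Vitali family of intervals on which \<open>g\<close> grows faster than \<open>r\<close> is chosen inside the given open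
  intervals. Its total length times \<open>r\<close> is at most the total increment of \<open>g\<close> over the family, which
  is controlled by the increments over the surrounding intervals.
\<close>

lemma steep_slopes_measure:
  fixes g :: "real \<Rightarrow> real"
  assumes g: "mono g" and "r > 0" and E: "E \<subseteq> slopes_near g (\<lambda>q. q > r)"
    and "E \<subseteq> (\<Union>(u, v)\<in>\<C>. {u<..<v})" 
  obtains T where "T \<in> sets lborel" "T \<subseteq> (\<Union>(u, v)\<in>\<C>. {u<..<v})" "negligible (E - T)"
    "ennreal r * emeasure lborel T \<le> emeasure lborel (\<Union>(u, v)\<in>\<C>. {g u<..<g v})"
proof -
  let ?U = "\<Union>(u, v)\<in>\<C>. {u<..<v}"
  define P where "P u v \<longleftrightarrow> (\<exists>(u', v')\<in>\<C>. u' < u \<and> v < v') \<and> (g v - g u) / (v - u) > r" for u v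
  have "\<exists>u v. u \<le> x \<and> x \<le> v \<and> u < v \<and> v - u < d \<and> P u v" if x: "x \<in> E" "0 < d" for x d
  proof -
    obtain u' v' where uv': "(u', v') \<in> \<C>" "u' < x" "x < v'"
      using x assms(4) by auto
    define e where "e = min d (min (x - u') (v' - x))"
    have "e > 0" using uv' x by (auto simp: e_def)
    obtain u v where uv: "u \<le> x" "x \<le> v" "u < v" "v - u < e" "(g v - g u) / (v - u) > r"
      using E x \<open>e > 0\<close> unfolding slopes_near_def by blast
    have "P u v" unfolding P_def using uv' uv by (auto simp: e_def intro!: bexI[of _ "(u', v')"])
    then show ?thesis
      using uv by (auto simp: e_def)
  qed
  then obtain \<D> where D: "countable \<D>" "\<And>u v. (u, v) \<in> \<D> \<Longrightarrow> u < v \<and> P u v"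
    "disjoint_family_on (\<lambda>(u, v). {u..v}) \<D>" "negligible (E - (\<Union>(u, v)\<in>\<D>. {u..v}))"
    by (rule vitali_interval_cover[of E P]) (assumption | rule that)+
  let ?T = "\<Union>(u, v)\<in>\<D>. {u..v}"
  have "ennreal r * emeasure lborel ?T = (\<integral>\<^sup>+z. ennreal r * (case z of (u, v) \<Rightarrow> ennreal (v - u)) \<partial>count_space \<D>)"
    using D by (subst emeasure_disjoint_intervals[OF g]) (auto simp: nn_integral_cmult)
  also have "\<dots> \<le> (\<integral>\<^sup>+(u, v). ennreal (g v - g u) \<partial>count_space \<D>)"
  proof (intro nn_integral_mono, safe)
    fix u v assume "(u, v) \<in> space (count_space \<D>)"
    then have "u < v" "(g v - g u) / (v - u) > r" using D(2) by (auto simp: P_def)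
    then have "r * (v - u) \<le> g v - g u" by (simp add: field_simps)
    then show "ennreal r * ennreal (v - u) \<le> ennreal (g v - g u)"
      using \<open>r > 0\<close> \<open>u < v\<close> by (simp add: ennreal_mult[symmetric] ennreal_leI)
  qed
  also have "\<dots> = emeasure lborel (\<Union>(u, v)\<in>\<D>. {g u<..<g v})"
    using D by (subst emeasure_disjoint_intervals[OF g]) auto
  also have "\<dots> \<le> emeasure lborel (\<Union>(u, v)\<in>\<C>. {g u<..<g v})"
  proof (rule emeasure_mono)
    show "(\<Union>(u, v)\<in>\<D>. {g u<..<g v}) \<subseteq> (\<Union>(u, v)\<in>\<C>. {g u<..<g v})"
    proof safe
      fix x u v assume "(u, v) \<in> \<D>" "x \<in> {g u<..<g v}"
      moreover then obtain u' v' where "(u', v') \<in> \<C>" "u' < u" "v < v'"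
        using D(2) unfolding P_def by blast
      moreover then have "g u' \<le> g u" "g v \<le> g v'" using g by (auto simp: monoD)
      ultimately show "x \<in> (\<Union>(u, v)\<in>\<C>. {g u<..<g v})"
        by (intro UN_I[of "(u', v')"]) auto
    qed
    have "open (\<Union>(u, v)\<in>\<C>. {g u<..<g v})" by (intro open_UN) auto
    then show "(\<Union>(u, v)\<in>\<C>. {g u<..<g v}) \<in> sets lborel" by simp
  qed
  finally have le: "ennreal r * emeasure lborel ?T \<le> emeasure lborel (\<Union>(u, v)\<in>\<C>. {g u<..<g v})" .
  have "?T \<subseteq> ?U"
  proof safe
    fix x u v assume "(u, v) \<in> \<D>" "x \<in> {u..v}"
    moreover then obtain u' v' where "(u', v') \<in> \<C>" "u' < u" "v < v'"
      using D(2) unfolding P_def by blast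
    ultimately show "x \<in> ?U" by (intro UN_I[of "(u', v')"]) auto
  qed
  moreover have "?T \<in> sets lborel"
    using D(1) by (intro sets.countable_UN') auto
  ultimately show thesis using that le D(4) by blast
qed

lemma measure_Un_negligible_Diff:
  assumes "T \<in> lmeasurable" "negligible (E - T)"
  shows "T \<union> E \<in> lmeasurable" "measure lebesgue (T \<union> E) = measure lebesgue T"
proof -
  have e: "T \<union> E = T \<union> (E - T)" by auto
  show "T \<union> E \<in> lmeasurable"
    unfolding e using assms negligible_imp_measurable by (intro fmeasurable.Un) auto
  show "measure lebesgue (T \<union> E) = measure lebesgue T"
    unfolding e using assms by (intro measure_Un_null_set) (auto simp: negligible_iff_null_sets)
qed

text \<open>
  The increment of \<open>g\<close> over \<open>{-M..M}\<close> is fixed, whereas slopes beyond \<open>n\<close> on a set of measure \<open>m\<close>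
  cost at least \<open>n * m\<close>.
\<close>

lemma negligible_infinite_slopes:
  assumes g: "mono g" 
  shows "negligible ((\<Inter>n::nat. slopes_near g (\<lambda>q. q > real n)) \<inter> {-M<..<M})" (is "negligible ?E")
proof (cases "M > 0")
  case True
  show ?thesis
  proof (rule negligible_outer_le[THEN iffD2], intro allI impI)
    fix e :: real assume "e > 0"
    let ?d = "g M - g (-M)"
    have d: "?d \<ge> 0" using monoD[OF g, of "-M" M] True by simp
    obtain n :: nat where "real n > max 1 (?d / e)"
      using reals_Archimedean2 by blast
    then have n: "real n > ?d / e" "n > 0" by auto
    have "?E \<subseteq> slopes_near g (\<lambda>q. q > real n)" "?E \<subseteq> (\<Union>(u, v)\<in>{(-M, M)}. {u<..<v})"
      by auto
    then obtain T where T: "T \<in> sets lborel" "T \<subseteq> {-M<..<M}" "negligible (?E - T)"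
      "ennreal (real n) * emeasure lborel T \<le> emeasure lborel {g (-M)<..<g M}"
      using steep_slopes_measure[OF g, of "real n" ?E "{(-M, M)}" thesis] n by simp
    have fin: "T \<in> lmeasurable"
      by (rule bounded_set_imp_lmeasurable) (use T in \<open>auto intro: bounded_subset[OF _ T(2)]\<close>)
    have "emeasure lborel T = ennreal (measure lebesgue T)"
      using fin T(1) emeasure_eq_measure2[OF fin] emeasure_completion[of T lborel]
      by (simp add: main_part_sets)
    then have "ennreal (real n) * ennreal (measure lebesgue T) \<le> ennreal ?d"
      using T(4) d by (simp)
    then have le_d: "real n * measure lebesgue T \<le> ?d"
      using d by (simp add: ennreal_mult[symmetric])
    have "measure lebesgue T \<le> e"
    proof -
      have "?d \<le> e * real n" using n \<open>e > 0\<close> by (simp add: field_simps)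
      then have "real n * measure lebesgue T \<le> real n * e"
        using le_d by (simp add: mult.commute)
      then show ?thesis using n by simp
    qed
    then show "\<exists>T. ?E \<subseteq> T \<and> T \<in> lmeasurable \<and> measure lebesgue T \<le> e"
      using measure_Un_negligible_Diff[OF fin T(3)] by (intro exI[of _ "T \<union> ?E"]) auto
  qed
qed auto

text \<open>
  Cover the set by short intervals of slope below \<open>s\<close>, and inside them cover it again by intervals of
  slope above \<open>r\<close>. Comparing increments of \<open>g\<close> shows that any set containing the given one can be
  replaced, up to arbitrarily small errors, by one whose measure is smaller by the factor \<open>s / r\<close>. The
  infimum of these measures, which is the outer measure of the given set, is thus zero.
\<close>

lemma negligible_gap_slopes:
  assumes g: "mono g" and "s < r"
  shows "negligible (slopes_near g (\<lambda>q. q < s) \<inter> slopes_near g (\<lambda>q. q > r) \<inter> {-M<..<M})" (is "negligible ?E")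
proof (cases "s > 0")
  case False
  have "slopes_near g (\<lambda>q. q < s) = {}"
  proof (rule equals0I)
    fix x assume "x \<in> slopes_near g (\<lambda>q. q < s)"
    then obtain u v where "u < v" "(g v - g u) / (v - u) < s"
      unfolding slopes_near_def using zero_less_one by blast
    moreover then have "(g v - g u) / (v - u) \<ge> 0" using monoD[OF g, of u v] by simp
    ultimately show False using False by simp
  qed
  then show ?thesis by simp
next
  case s: True
  then have r: "r > 0" using \<open>s < r\<close> by simp
  have step: "\<exists>H'. H' \<in> lmeasurable \<and> ?E \<subseteq> H' \<and> measure lebesgue H' \<le> s / r * (measure lebesgue H + e)"
    if H: "H \<in> lmeasurable" "?E \<subseteq> H" and "e > 0" for H e
  proof -
    obtain G0 where G0: "open G0" "H \<subseteq> G0" "G0 - H \<in> lmeasurable" "emeasure lebesgue (G0 - H) < ennreal e"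
      using sets_lebesgue_outer_open[of H e] H \<open>e > 0\<close> by (metis fmeasurableD)
    define G where "G = G0 \<inter> {-M<..<M}"
    have G: "open G" "?E \<subseteq> G" "G \<in> lmeasurable"
      using G0 H(2) by (auto simp: G_def intro!: lmeasurable_open)
    have "H \<union> (G0 - H) \<in> lmeasurable"
      using G0(3) H(1) by (rule fmeasurable.Un[rotated])
    then have "measure lebesgue G \<le> measure lebesgue (H \<union> (G0 - H))"
      using G(3) by (intro measure_mono_fmeasurable) (auto simp: G_def)
    also have "\<dots> \<le> measure lebesgue H + measure lebesgue (G0 - H)"
      using G0 H by (intro measure_Un_le) auto
    also have "measure lebesgue (G0 - H) < e"
      using G0(4) \<open>e > 0\<close> unfolding emeasure_eq_measure2[OF G0(3)] by (simp add: ennreal_less_iff)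
    finally have mG: "measure lebesgue G < measure lebesgue H + e" by simp
    obtain \<C> where C: "countable \<C>"
      "\<And>u v. (u, v) \<in> \<C> \<Longrightarrow> u < v \<and> {u..v} \<subseteq> G \<and> (g v - g u) / (v - u) < s"
      "disjoint_family_on (\<lambda>(u, v). {u..v}) \<C>" "negligible (?E - (\<Union>(u, v)\<in>\<C>. {u..v}))"
      by (rule vitali_slopes[of ?E g "\<lambda>q. q < s" G]) (use G in auto)
    let ?O = "\<Union>(u, v)\<in>\<C>. {u<..<v}"
    have "negligible ((\<Union>(u, v)\<in>\<C>. {u..v}) - ?O)"
    proof (rule negligible_subset)
      show "negligible (\<Union>(u, v)\<in>\<C>. {u, v})"
        unfolding negligible_iff_null_sets using C(1)
        by (intro null_sets_completionI countable_imp_null_set_lborel countable_UN) auto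
      show "(\<Union>(u, v)\<in>\<C>. {u..v}) - ?O \<subseteq> (\<Union>(u, v)\<in>\<C>. {u, v})"
        by fastforce
    qed
    then have nO: "negligible (?E - ?O)"
      using C(4) by (rule negligible_subset[OF negligible_Un]) auto
    have "?E \<inter> ?O \<subseteq> slopes_near g (\<lambda>q. q > r)" "?E \<inter> ?O \<subseteq> ?O" by auto
    then obtain T where T: "T \<in> sets lborel" "T \<subseteq> ?O" "negligible (?E \<inter> ?O - T)"
      "ennreal r * emeasure lborel T \<le> emeasure lborel (\<Union>(u, v)\<in>\<C>. {g u<..<g v})"
      using steep_slopes_measure[OF g r, of "?E \<inter> ?O" \<C>] by metis
    have nT: "negligible (?E - T)"
      using nO T(3) by (rule negligible_subset[OF negligible_Un]) auto
    have OG: "?O \<subseteq> G" "(\<Union>(u, v)\<in>\<C>. {u..v}) \<subseteq> G"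
      using C(2) by fastforce+
    have fT: "T \<in> lmeasurable"
      using T(1,2) OG by (intro fmeasurableI2[OF G(3)]) auto
    have eT: "emeasure lborel T = ennreal (measure lebesgue T)"
      using fT T(1) emeasure_eq_measure2[OF fT] emeasure_completion[of T lborel]
      by (simp add: main_part_sets)
    have eG: "emeasure lborel G = ennreal (measure lebesgue G)"
      using G emeasure_eq_measure2[OF G(3)] emeasure_completion[of G lborel]
      by (simp add: main_part_sets)
    note T(4)
    also have "emeasure lborel (\<Union>(u, v)\<in>\<C>. {g u<..<g v}) = (\<integral>\<^sup>+(u, v). ennreal (g v - g u) \<partial>count_space \<C>)"
      using C by (subst emeasure_disjoint_intervals[OF g]) auto
    also have "\<dots> \<le> (\<integral>\<^sup>+z. ennreal s * (case z of (u, v) \<Rightarrow> ennreal (v - u)) \<partial>count_space \<C>)"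
    proof (intro nn_integral_mono, safe)
      fix u v assume "(u, v) \<in> space (count_space \<C>)"
      then have "u < v" "(g v - g u) / (v - u) < s" using C(2) by auto
      then have "g v - g u \<le> s * (v - u)" by (simp add: field_simps)
      then show "ennreal (g v - g u) \<le> ennreal s * ennreal (v - u)"
        using s \<open>u < v\<close> by (simp add: ennreal_mult[symmetric] ennreal_leI)
    qed
    also have "\<dots> = ennreal s * emeasure lborel (\<Union>(u, v)\<in>\<C>. {u..v})"
      using C by (subst emeasure_disjoint_intervals[OF g]) (auto simp: nn_integral_cmult)
    also have "\<dots> \<le> ennreal s * emeasure lborel G"
      using OG G by (intro mult_left_mono emeasure_mono) auto
    finally have "r * measure lebesgue T \<le> s * measure lebesgue G"
      unfolding eT eG using r s by (simp add: ennreal_mult[symmetric])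
    also have "\<dots> \<le> s * (measure lebesgue H + e)" using mG s by simp
    finally have "measure lebesgue T \<le> s / r * (measure lebesgue H + e)"
      using r by (simp add: field_simps)
    then show ?thesis
      using measure_Un_negligible_Diff[OF fT nT] by (intro exI[of _ "T \<union> ?E"]) auto
  qed
  define X where "X = measure lebesgue ` {H. H \<in> lmeasurable \<and> ?E \<subseteq> H}"
  have "{-M<..<M} \<in> lmeasurable" by (simp add: lmeasurable_open)
  then have X0: "X \<noteq> {}" unfolding X_def by auto
  have bdd: "bdd_below X" unfolding X_def by (rule bdd_belowI[of _ 0]) auto
  have "Inf X \<ge> 0" using X0 by (intro cInf_greatest) (auto simp: X_def)
  have "Inf X \<le> 0"
  proof (rule ccontr)
    assume "\<not> Inf X \<le> 0"
    then have I: "Inf X > 0" by simp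
    \<comment> \<open>so small that the factor \<open>s / r\<close> still brings \<open>Inf X + 2 * e\<close> below \<open>Inf X\<close>\<close>
    define e where "e = (r - s) * Inf X / (4 * s)"
    have "e > 0" using I s \<open>s < r\<close> by (simp add: e_def)
    then obtain H where H: "H \<in> lmeasurable" "?E \<subseteq> H" "measure lebesgue H < Inf X + e"
      using cInf_lessD[OF X0, of "Inf X + e"] by (auto simp: X_def)
    obtain H' where H': "H' \<in> lmeasurable" "?E \<subseteq> H'" "measure lebesgue H' \<le> s / r * (measure lebesgue H + e)"
      using step[OF H(1,2) \<open>e > 0\<close>] by blast
    have "Inf X \<le> measure lebesgue H'"
      using H' by (intro cInf_lower[OF _ bdd]) (auto simp: X_def)
    also have "\<dots> \<le> s / r * (Inf X + 2 * e)"
      using H(3) s r by (intro order_trans[OF H'(3)] mult_left_mono) auto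
    finally have "r * Inf X \<le> s * Inf X + 2 * (s * e)"
      using r by (simp add: field_simps)
    also have "s * e = (r - s) * Inf X / 4" using s by (simp add: e_def)
    finally have "(r - s) * Inf X \<le> (r - s) * Inf X / 2"
      using left_diff_distrib[of r s "Inf X"] by linarith
    moreover have "(r - s) * Inf X > 0" using I \<open>s < r\<close> by simp
    ultimately show False by linarith
  qed
  show ?thesis
  proof (rule negligible_outer[THEN iffD2], intro allI impI)
    fix e :: real assume "e > 0"
    then have "Inf X < e" using \<open>Inf X \<le> 0\<close> by simp
    from cInf_lessD[OF X0 this]
    show "\<exists>T. ?E \<subseteq> T \<and> T \<in> lmeasurable \<and> measure lebesgue T < e"
      by (auto simp: X_def)
  qed
qed

text \<open>
  The derivative is the upper limit \<open>D\<close> of the slopes. If slopes below \<open>D - e\<close> occurred near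
  \<open>x\<close>, two rationals between \<open>D - e\<close> and \<open>D\<close> would be separated by the slopes.
\<close>

lemma differentiable_if_slopes_converge:
  assumes g: "mono g"
    and fin: "\<exists>n::nat. x \<notin> slopes_near g (\<lambda>q. q > real n)"
    and gap: "\<And>s r. s \<in> \<rat> \<Longrightarrow> r \<in> \<rat> \<Longrightarrow> s < r \<Longrightarrow>
      x \<notin> slopes_near g (\<lambda>q. q < s) \<inter> slopes_near g (\<lambda>q. q > r)"
  shows "g differentiable (at x)"
proof -
  define ev where "ev P \<longleftrightarrow> (\<exists>d>0. \<forall>u v. u \<le> x \<longrightarrow> x \<le> v \<longrightarrow> u < v \<longrightarrow> v - u < d \<longrightarrow> P ((g v - g u) / (v - u)))" for P
  have near: "x \<notin> slopes_near g P \<longleftrightarrow> ev (\<lambda>q. \<not> P q)" for P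
    unfolding slopes_near_def ev_def by blast
  define R where "R = {r. ev (\<lambda>q. q \<le> r)}"
  have R0: "R \<noteq> {}" using fin unfolding near R_def by (auto simp: not_less)
  have bdd: "bdd_below R"
  proof (rule bdd_belowI[of _ 0])
    fix r assume "r \<in> R"
    then obtain d where d: "d > 0" "\<And>u v. u \<le> x \<Longrightarrow> x \<le> v \<Longrightarrow> u < v \<Longrightarrow> v - u < d \<Longrightarrow> (g v - g u) / (v - u) \<le> r"
      unfolding R_def ev_def by blast
    have "0 \<le> (g (x + d / 2) - g x) / (x + d / 2 - x)"
      using d(1) monoD[OF g, of x "x + d / 2"] by simp
    also have "\<dots> \<le> r" using d(1) by (intro d(2)) auto
    finally show "0 \<le> r" .
  qed
  define D where "D = Inf R"
  have lim: "\<exists>d>0. \<forall>u v. u \<le> x \<longrightarrow> x \<le> v \<longrightarrow> u < v \<longrightarrow> v - u < d \<longrightarrow> \<bar>(g v - g u) / (v - u) - D\<bar> < e"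
    if e: "e > 0" for e
  proof -
    have "Inf R < D + e" using e by (simp add: D_def)
    from cInf_lessD[OF R0 this] obtain r where r: "r \<in> R" "r < D + e" by blast
    obtain s where s: "s \<in> \<rat>" "D - e < s" "s < D" using Rats_dense_in_real[of "D - e" D] e by auto
    obtain r' where r': "r' \<in> \<rat>" "s < r'" "r' < D" using Rats_dense_in_real[of s D] s by auto
    have "r' \<notin> R" using r' cInf_lower[OF _ bdd, of r'] by (auto simp: D_def)
    then have "x \<in> slopes_near g (\<lambda>q. q > r')" using near[of "\<lambda>q. q > r'"] by (auto simp: R_def not_less)
    then have "ev (\<lambda>q. \<not> q < s)" using gap[OF s(1) r'(1) r'(2)] near by auto
    then obtain d1 where d1: "d1 > 0" "\<And>u v. u \<le> x \<Longrightarrow> x \<le> v \<Longrightarrow> u < v \<Longrightarrow> v - u < d1 \<Longrightarrow> \<not> (g v - g u) / (v - u) < s"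
      unfolding ev_def by blast
    obtain d2 where d2: "d2 > 0" "\<And>u v. u \<le> x \<Longrightarrow> x \<le> v \<Longrightarrow> u < v \<Longrightarrow> v - u < d2 \<Longrightarrow> (g v - g u) / (v - u) \<le> r"
      using r(1) unfolding R_def ev_def by blast
    have "\<bar>(g v - g u) / (v - u) - D\<bar> < e" if "u \<le> x" "x \<le> v" "u < v" "v - u < min d1 d2" for u v
      using d1(2)[of u v] d2(2)[of u v] that s r by auto
    then show ?thesis using d1(1) d2(1) by (intro exI[of _ "min d1 d2"]) auto
  qed
  have "(g has_real_derivative D) (at x)"
    unfolding DERIV_def
  proof (rule LIM_I)
    fix e :: real assume "e > 0"
    from lim[OF this] obtain d where d: "d > 0"
      "\<And>u v. u \<le> x \<Longrightarrow> x \<le> v \<Longrightarrow> u < v \<Longrightarrow> v - u < d \<Longrightarrow> \<bar>(g v - g u) / (v - u) - D\<bar> < e" by blast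
    have "\<bar>(g (x + h) - g x) / h - D\<bar> < e" if "h \<noteq> 0" "\<bar>h\<bar> < d" for h
    proof (cases "h > 0")
      case True then show ?thesis using d(2)[of x "x + h"] that by simp
    next
      case False
      then have "(g (x + h) - g x) / h = (g x - g (x + h)) / (x - (x + h))"
        using that by (simp add: divide_simps)
      then show ?thesis using d(2)[of "x + h" x] that False by simp
    qed
    then show "\<exists>s>0. \<forall>h. h \<noteq> 0 \<and> norm (h - 0) < s \<longrightarrow> norm ((g (x + h) - g x) / h - D) < e"
      using d(1) by auto
  qed
  then show ?thesis using real_differentiable_def by blast
qed

theorem lebesgue_differentiation_mono:
  fixes g :: "real \<Rightarrow> real"
  assumes "mono g"
  shows "negligible {x. \<not> g differentiable (at x)}"
proof -
  define N where "N = (\<Union>m::nat. ((\<Inter>n::nat. slopes_near g (\<lambda>q. q > real n)) \<inter> {-real m<..<real m})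
    \<union> (\<Union>(s, r)\<in>{(s, r). s \<in> \<rat> \<and> r \<in> \<rat> \<and> s < r}.
        slopes_near g (\<lambda>q. q < s) \<inter> slopes_near g (\<lambda>q. q > r) \<inter> {-real m<..<real m}))"
  have "countable {(s, r). s \<in> \<rat> \<and> r \<in> \<rat> \<and> s < (r::real)}"
    by (rule countable_subset[of _ "\<rat> \<times> \<rat>"]) (auto intro: countable_rat)
  then have "negligible N"
    unfolding N_def using assms
    by (intro negligible_countable_Union countable_image negligible_Un negligible_infinite_slopes)
       (auto intro!: negligible_infinite_slopes negligible_countable_Union negligible_gap_slopes negligible_Un)
  moreover have "{x. \<not> g differentiable (at x)} \<subseteq> N"
  proof
    fix x assume x: "x \<in> {x. \<not> g differentiable (at x)}"
    obtain m :: nat where "\<bar>x\<bar> < real m" using reals_Archimedean2 by blast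
    then have m: "x \<in> {-real m<..<real m}" by auto
    from x differentiable_if_slopes_converge[OF assms, of x]
    consider "x \<in> (\<Inter>n::nat. slopes_near g (\<lambda>q. q > real n))"
      | s r where "s \<in> \<rat>" "r \<in> \<rat>" "s < r" "x \<in> slopes_near g (\<lambda>q. q < s) \<inter> slopes_near g (\<lambda>q. q > r)"
      by auto
    then show "x \<in> N"
      unfolding N_def using m by cases (auto intro!: exI[of _ m])
  qed
  ultimately show ?thesis by (rule negligible_subset)
qed

lemma lebesgue_differentiation_mono_on:
  fixes g :: "real \<Rightarrow> real"
  assumes "mono_on {a..b} g"
  shows "negligible {x \<in> {a..b}. \<not> g differentiable (at x)}"
proof (cases "a \<le> b")
  case True
  define G where "G x = g (max a (min b x))" for x
  have "mono G" unfolding G_def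
    using True by (intro monoI mono_onD[OF assms]) auto
  have "g differentiable (at x)" if x: "a < x" "x < b" "G differentiable (at x)" for x
  proof -
    obtain D where "(G has_derivative D) (at x)" using x(3) by (auto simp: differentiable_def)
    then have "(g has_derivative D) (at x)"
      by (rule has_derivative_transform_within_open[of _ _ _ _ "{a<..<b}"])
        (use x in \<open>auto simp: G_def max_def min_def\<close>)
    then show ?thesis by (auto simp: differentiable_def)
  qed
  then have "{x \<in> {a..b}. \<not> g differentiable (at x)} \<subseteq> {x. \<not> G differentiable (at x)} \<union> {a, b}"
    by force
  moreover have "negligible ({x. \<not> G differentiable (at x)} \<union> {a, b})"
    using lebesgue_differentiation_mono[OF \<open>mono G\<close>] by (intro negligible_Un) auto
  ultimately show ?thesis by (rule negligible_subset[rotated])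
qed auto

section \<open>Absolutely continuous functions\<close>

definition nonoverlapping :: "real \<Rightarrow> real \<Rightarrow> (real \<times> real) set \<Rightarrow> bool" where
  "nonoverlapping a b D \<longleftrightarrow> finite D \<and> (\<forall>(p, q)\<in>D. a \<le> p \<and> p < q \<and> q \<le> b) \<and>
     pairwise (\<lambda>I J. {fst I<..<snd I} \<inter> {fst J<..<snd J} = {}) D"

lemma abs_continuous_on_alt:
  "abs_continuous_on a b g \<longleftrightarrow> (\<forall>\<epsilon>>0. \<exists>\<delta>>0. \<forall>D. nonoverlapping a b D \<longrightarrow>
     (\<Sum>(p, q)\<in>D. q - p) < \<delta> \<longrightarrow> (\<Sum>(p, q)\<in>D. norm (g q - g p)) < \<epsilon>)"
  unfolding abs_continuous_on_def nonoverlapping_def by meson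

lemma nonoverlapping_mono:
  "nonoverlapping a b D \<Longrightarrow> a' \<le> a \<Longrightarrow> b \<le> b' \<Longrightarrow> nonoverlapping a' b' D"
  unfolding nonoverlapping_def by fastforce

lemma abs_continuous_on_dominated:
  assumes g: "abs_continuous_on a b g"
    and f: "\<And>s t. a \<le> s \<Longrightarrow> s < t \<Longrightarrow> t \<le> b \<Longrightarrow> norm (f t - f s) \<le> K * norm (g t - g s)"
  shows "abs_continuous_on a b f"
  unfolding abs_continuous_on_alt
proof (intro allI impI)
  fix e :: real assume "e > 0"
  define K' where "K' = max K 1"
  have K': "K' > 0" "K \<le> K'" by (auto simp: K'_def)
  have "e / K' > 0" using \<open>e > 0\<close> K' by simp
  then obtain d where d: "d > 0" "\<And>D. nonoverlapping a b D \<Longrightarrow> (\<Sum>(p, q)\<in>D. q - p) < d \<Longrightarrow>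
      (\<Sum>(p, q)\<in>D. norm (g q - g p)) < e / K'"
    using g unfolding abs_continuous_on_alt by blast
  have "(\<Sum>(p, q)\<in>D. norm (f q - f p)) < e" if D: "nonoverlapping a b D" "(\<Sum>(p, q)\<in>D. q - p) < d" for D
  proof -
    have "(\<Sum>(p, q)\<in>D. norm (f q - f p)) \<le> (\<Sum>z\<in>D. K' * (case z of (p, q) \<Rightarrow> norm (g q - g p)))"
    proof (intro sum_mono, clarsimp)
      fix p q assume "(p, q) \<in> D"
      then have "norm (f q - f p) \<le> K * norm (g q - g p)"
        using D(1) unfolding nonoverlapping_def by (intro f) auto
      also have "\<dots> \<le> K' * norm (g q - g p)" using K' by (intro mult_right_mono) auto
      finally show "norm (f q - f p) \<le> K' * norm (g q - g p)" .
    qed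
    also have "\<dots> = K' * (\<Sum>(p, q)\<in>D. norm (g q - g p))" by (simp add: sum_distrib_left)
    also have "\<dots> < K' * (e / K')" using d(2)[OF D] K' by (intro mult_strict_left_mono)
    also have "\<dots> = e" using K' by simp
    finally show ?thesis .
  qed
  then show "\<exists>d>0. \<forall>D. nonoverlapping a b D \<longrightarrow> (\<Sum>(p, q)\<in>D. q - p) < d \<longrightarrow>
      (\<Sum>(p, q)\<in>D. norm (f q - f p)) < e" using d(1) by blast
qed

lemma nonoverlapping_length:
  assumes "nonoverlapping a b D" "a \<le> b"
  shows "(\<Sum>(p, q)\<in>D. q - p) \<le> b - a"
proof -
  have fin: "finite D" and pq: "\<And>p q. (p, q) \<in> D \<Longrightarrow> a \<le> p \<and> p < q \<and> q \<le> b"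
    and pw: "pairwise (\<lambda>I J. {fst I<..<snd I} \<inter> {fst J<..<snd J} = {}) D"
    using assms(1) by (auto simp: nonoverlapping_def)
  have "(\<Sum>(p, q)\<in>D. q - p) = (\<Sum>I\<in>D. measure lborel {fst I<..<snd I})"
    using pq by (intro sum.cong) (auto simp: less_imp_le)
  also have "\<dots> = measure lborel (\<Union>I\<in>D. {fst I<..<snd I})"
    using pw fin by (intro measure_finite_Union[symmetric])
      (use pq in \<open>auto simp: disjoint_family_on_def pairwise_def emeasure_lborel_Ioo less_imp_le\<close>)
  also have "\<dots> \<le> measure lborel {a..b}"
  proof (rule measure_mono_fmeasurable)
    show "(\<Union>I\<in>D. {fst I<..<snd I}) \<in> sets lborel"
      using fin by (intro sets.finite_UN) auto
    show "{a..b} \<in> fmeasurable lborel" using assms(2) by (intro fmeasurableI) auto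
  qed (use pq in fastforce)
  also have "\<dots> = b - a" using assms(2) by simp
  finally show ?thesis .
qed

text \<open>
  With \<open>V\<close> the variation from \<open>a\<close>, the function \<open>f\<close> is half the difference of the monotone functions
  \<open>V + f\<close> and \<open>V - f\<close>.
\<close>

lemma abs_continuous_differentiable_short:
  fixes f :: "real \<Rightarrow> real"
  assumes short: "\<And>D. nonoverlapping a b D \<Longrightarrow> (\<Sum>(p, q)\<in>D. \<bar>f q - f p\<bar>) \<le> 1" 
  shows "negligible {x \<in> {a..b}. \<not> f differentiable (at x)}"
proof -
  let ?s = "\<lambda>D. (\<Sum>(p, q)\<in>D. \<bar>f q - f p\<bar>)"
  define V where "V x = Sup (?s ` {D. nonoverlapping a x D})" for x
  have bdd: "bdd_above (?s ` {D. nonoverlapping a x D})" if "x \<le> b" for x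
    using that by (intro bdd_aboveI[of _ 1]) (auto intro!: short dest: nonoverlapping_mono)
  have ne: "?s ` {D. nonoverlapping a x D} \<noteq> {}" for x
    by (auto simp: nonoverlapping_def intro!: exI[of _ "{}"])
  have V: "V x + \<bar>f y - f x\<bar> \<le> V y" if xy: "a \<le> x" "x < y" "y \<le> b" for x y
  proof -
    have "V x \<le> V y - \<bar>f y - f x\<bar>"
      unfolding V_def[of x]
    proof (rule cSup_least[OF ne], safe)
      fix D assume D: "nonoverlapping a x D"
      have nD: "(x, y) \<notin> D" using D xy by (auto simp: nonoverlapping_def)
      have "nonoverlapping a y (insert (x, y) D)"
        using D xy unfolding nonoverlapping_def pairwise_insert by fastforce
      then have "?s (insert (x, y) D) \<le> V y"
        unfolding V_def using bdd[OF xy(3)] by (intro cSup_upper) auto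
      then show "?s D \<le> V y - \<bar>f y - f x\<bar>"
        using nD D by (simp add: nonoverlapping_def)
    qed
    then show ?thesis by simp
  qed
  have "mono_on {a..b} (\<lambda>x. V x + f x)" "mono_on {a..b} (\<lambda>x. V x - f x)"
  proof -
    have "V x + f x \<le> V y + f y \<and> V x - f x \<le> V y - f y"
      if "x \<in> {a..b}" "y \<in> {a..b}" "x \<le> y" for x y
      using V[of x y] that by (cases "x = y") auto
    then show "mono_on {a..b} (\<lambda>x. V x + f x)" "mono_on {a..b} (\<lambda>x. V x - f x)"
      by (auto intro: mono_onI)
  qed
  note N = this[THEN lebesgue_differentiation_mono_on]
  have "f differentiable (at x)"
    if "(\<lambda>x. V x + f x) differentiable (at x)" "(\<lambda>x. V x - f x) differentiable (at x)" for x
  proof -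
    have "(\<lambda>x. ((V x + f x) - (V x - f x)) / 2) differentiable (at x)"
      using differentiable_divide[OF differentiable_diff[OF that] differentiable_const, of 2] by simp
    then show ?thesis by simp
  qed
  then have "{x \<in> {a..b}. \<not> f differentiable (at x)} \<subseteq>
    {x \<in> {a..b}. \<not> (\<lambda>x. V x + f x) differentiable (at x)} \<union> {x \<in> {a..b}. \<not> (\<lambda>x. V x - f x) differentiable (at x)}"
    by blast
  then show ?thesis using negligible_subset negligible_Un[OF N] by blast
qed

text \<open>
  Absolute continuity bounds the variation by \<open>1\<close> on all sufficiently short intervals; bisection
  (Bolzano) passes to the whole interval.
\<close>

lemma abs_continuous_differentiable_real:
  fixes f :: "real \<Rightarrow> real"
  assumes f: "abs_continuous_on a b f"
  shows "negligible {x \<in> {a..b}. \<not> f differentiable (at x)}"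
proof (cases "a \<le> b")
  case True
  obtain d where d: "d > 0" "\<And>D. nonoverlapping a b D \<Longrightarrow> (\<Sum>(p, q)\<in>D. q - p) < d \<Longrightarrow>
      (\<Sum>(p, q)\<in>D. norm (f q - f p)) < 1"
    using f zero_less_one unfolding abs_continuous_on_alt by blast
  have loc: "negligible {x \<in> {p..q}. \<not> f differentiable (at x)}" if "a \<le> p" "q \<le> b" "q - p < d" for p q
  proof (cases "p \<le> q")
    case True
    show ?thesis
    proof (rule abs_continuous_differentiable_short)
      fix D assume D: "nonoverlapping p q D"
      then have "(\<Sum>(p, q)\<in>D. q - p) < d"
        using nonoverlapping_length[OF D True] that by simp
      then show "(\<Sum>(p, q)\<in>D. \<bar>f q - f p\<bar>) \<le> 1"
        using d(2)[of D] nonoverlapping_mono[OF D that(1,2)] by simp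
    qed
  qed auto
  have "a \<le> a \<longrightarrow> b \<le> b \<longrightarrow> negligible {x \<in> {a..b}. \<not> f differentiable (at x)}"
  proof (rule Bolzano[OF True, of "\<lambda>p q. a \<le> p \<longrightarrow> q \<le> b \<longrightarrow> negligible {x \<in> {p..q}. \<not> f differentiable (at x)}"])
    fix p q r :: real
    assume h: "a \<le> p \<longrightarrow> q \<le> b \<longrightarrow> negligible {x \<in> {p..q}. \<not> f differentiable (at x)}"
      "a \<le> q \<longrightarrow> r \<le> b \<longrightarrow> negligible {x \<in> {q..r}. \<not> f differentiable (at x)}" "p \<le> q" "q \<le> r"
    have e: "{x \<in> {p..r}. \<not> f differentiable (at x)} =
        {x \<in> {p..q}. \<not> f differentiable (at x)} \<union> {x \<in> {q..r}. \<not> f differentiable (at x)}"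
      using h(3,4) by auto
    show "a \<le> p \<longrightarrow> r \<le> b \<longrightarrow> negligible {x \<in> {p..r}. \<not> f differentiable (at x)}"
      unfolding e using h by auto
  qed (use loc d in blast)
  then show ?thesis by simp
qed auto

theorem abs_continuous_differentiable:
  fixes f :: "real \<Rightarrow> 'e::euclidean_space"
  assumes f: "abs_continuous_on a b f"
  shows "negligible {x \<in> {a..b}. \<not> f differentiable (at x)}"
proof -
  have "negligible {x \<in> {a..b}. \<not> (\<lambda>x. f x \<bullet> i) differentiable (at x)}" if "i \<in> Basis" for i
    using that by (intro abs_continuous_differentiable_real abs_continuous_on_dominated[OF f, of _ 1])
      (auto simp: inner_diff_left[symmetric] Basis_le_norm)
  then have "negligible (\<Union>i\<in>Basis. {x \<in> {a..b}. \<not> (\<lambda>x. f x \<bullet> i) differentiable (at x)})"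
    by (intro negligible_Union) auto
  moreover have "{x \<in> {a..b}. \<not> f differentiable (at x)} \<subseteq>
      (\<Union>i\<in>Basis. {x \<in> {a..b}. \<not> (\<lambda>x. f x \<bullet> i) differentiable (at x)})"
    using differentiable_componentwise_within[of f _ UNIV] by auto
  ultimately show ?thesis by (rule negligible_subset)
qed

text \<open>
  The integral is taken in the sense of Henstock and Kurzweil, which reduces the claim to Riemann sums
  over fine tagged divisions. At tags outside \<open>N\<close> the gauge makes the increment of \<open>f\<close> close to
  \<open>f'\<close> times the length. At tags in \<open>N\<close> it forces the intervals into an open set of small measure, where
  absolute continuity makes the increments of \<open>f\<close> small in total.
\<close>

theorem abs_continuous_ftc:
  fixes f f' :: "real \<Rightarrow> real"
  assumes f: "abs_continuous_on a b f" and "a \<le> b" and N: "negligible N"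
    and deriv: "\<And>x. x \<in> {a..b} - N \<Longrightarrow> (f has_real_derivative f' x) (at x)"
  shows "(f' has_integral (f b - f a)) {a..b}"
proof -
  define F where "F x = (if x \<in> N then 0 else f' x)" for x
  have "(F has_integral (f b - f a)) {a..b}"
    unfolding has_integral_real
  proof (intro allI impI)
    fix e :: real assume "e > 0"
    define e1 where "e1 = e / (3 * (b - a + 1))"
    have e1: "e1 > 0"
      using \<open>e > 0\<close> \<open>a \<le> b\<close> by (simp add: e1_def)
    have "e1 * (b - a) \<le> e1 * (b - a + 1)" using e1 by simp
    also have "\<dots> = e / 3" using \<open>a \<le> b\<close> by (simp add: e1_def field_simps)
    also have "\<dots> < e / 2" using \<open>e > 0\<close> by simp
    finally have e1_len: "e1 * (b - a) < e / 2" .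
    obtain d where d: "d > 0" "\<And>D. nonoverlapping a b D \<Longrightarrow> (\<Sum>(p, q)\<in>D. q - p) < d \<Longrightarrow>
        (\<Sum>(p, q)\<in>D. norm (f q - f p)) < e / 2"
      using f \<open>e > 0\<close> unfolding abs_continuous_on_alt by (meson half_gt_zero)
    obtain U where U: "open U" "N \<subseteq> U" "U - N \<in> lmeasurable" "emeasure lebesgue (U - N) < ennreal d"
      using sets_lebesgue_outer_open[of N d] N d(1) by (metis negligible_imp_sets)
    have UN: "U = U - N \<union> N" using U(2) by auto
    have fU: "U \<in> lmeasurable" 
      using fmeasurable.Un[OF U(3) negligible_imp_measurable[OF N]] UN by simp
    have "measure lebesgue U = measure lebesgue (U - N)"
      using measure_Un_negligible_Diff(2)[of "U - N" N] U(3) N UN by (auto intro: negligible_diff)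
    then have mU: "measure lebesgue U < d"
      using U(4) d(1) unfolding emeasure_eq_measure2[OF U(3)] by (simp add: ennreal_less_iff)
    have "\<exists>r>0. (x \<in> N \<longrightarrow> ball x r \<subseteq> U) \<and> (x \<in> {a..b} - N \<longrightarrow>
        (\<forall>y. \<bar>y - x\<bar> < r \<longrightarrow> \<bar>f y - f x - f' x * (y - x)\<bar> \<le> e1 * \<bar>y - x\<bar>))" for x
    proof -
      consider "x \<in> N" | "x \<in> {a..b} - N" | "x \<notin> N" "x \<notin> {a..b}" by blast
      then show ?thesis
      proof cases
        case 1 then show ?thesis using U(1,2) open_contains_ball by blast
      next
        case 2
        from deriv[OF this] have "(f has_derivative (\<lambda>h. h * f' x)) (at x)"
          by (simp add: has_field_derivative_def mult_commute_abs)
        then show ?thesis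
          unfolding has_derivative_at_alt using e1 2 by (force simp: mult.commute)
      qed (auto intro: exI[of _ 1])
    qed
    then obtain r where r: "\<And>x. r x > 0" "\<And>x. x \<in> N \<Longrightarrow> ball x (r x) \<subseteq> U"
      "\<And>x y. x \<in> {a..b} - N \<Longrightarrow> \<bar>y - x\<bar> < r x \<Longrightarrow> \<bar>f y - f x - f' x * (y - x)\<bar> \<le> e1 * \<bar>y - x\<bar>"
      by metis
    have "norm ((\<Sum>(x, K)\<in>\<D>. measure lborel K *\<^sub>R F x) - (f b - f a)) < e"
      if D: "\<D> tagged_division_of {a..b}" "(\<lambda>x. ball x (r x)) fine \<D>" for \<D>
    proof -
      have fin: "finite \<D>" using D(1) by auto
      have K: "\<exists>u v. K = {u..v} \<and> a \<le> u \<and> u \<le> x \<and> x \<le> v \<and> v \<le> b \<and> {u..v} \<subseteq> ball x (r x)"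
        if "(x, K) \<in> \<D>" for x K
      proof -
        have "x \<in> K" "K \<subseteq> {a..b}" "\<exists>u v. K = cbox u v" using tagged_division_ofD(2,3,4)[OF D(1) that] by auto
        moreover have "K \<subseteq> ball x (r x)" using D(2) that by (auto simp: fine_def)
        ultimately show ?thesis by (auto simp: subset_iff)
      qed
      have tel: "(\<Sum>(x, K)\<in>\<D>. f (Sup K) - f (Inf K)) = f b - f a"
        and tel1: "(\<Sum>(x, K)\<in>\<D>. Sup K - Inf K) = b - a"
        using additive_tagged_division_1[OF \<open>a \<le> b\<close> D(1), of f]
          additive_tagged_division_1[OF \<open>a \<le> b\<close> D(1), of "\<lambda>x. x"] by auto
      define DN where "DN = {z \<in> \<D>. fst z \<in> N}"
      let ?t = "\<lambda>(x, K). \<bar>measure lborel K *\<^sub>R F x - (f (Sup K) - f (Inf K))\<bar>"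
      have good: "?t z \<le> e1 * (case z of (x, K) \<Rightarrow> Sup K - Inf K)" if z: "z \<in> \<D> - DN" for z
      proof -
        obtain x u v where z': "z = (x, {u..v})" "a \<le> u" "u \<le> x" "x \<le> v" "v \<le> b" "{u..v} \<subseteq> ball x (r x)"
          using K z by (metis DiffD1 surj_pair)
        have xN: "x \<in> {a..b} - N" using z z' by (auto simp: DN_def)
        have "u \<in> ball x (r x)" "v \<in> ball x (r x)"
          using z'(3,4) by (auto intro!: subsetD[OF z'(6)] simp del: mem_ball)
        then have "\<bar>f v - f x - f' x * (v - x)\<bar> \<le> e1 * \<bar>v - x\<bar>" "\<bar>f u - f x - f' x * (u - x)\<bar> \<le> e1 * \<bar>u - x\<bar>"
          by (auto intro!: r(3)[OF xN] simp: dist_real_def abs_minus_commute)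
        moreover have "e1 * \<bar>v - x\<bar> + e1 * \<bar>u - x\<bar> = e1 * (v - u)"
          using z'(3,4) by (simp add: algebra_simps)
        moreover have "measure lborel {u..v} *\<^sub>R F x - (f v - f u) =
            (f u - f x - f' x * (u - x)) - (f v - f x - f' x * (v - x))"
          using xN z'(3,4) by (simp add: F_def algebra_simps)
        ultimately have "\<bar>measure lborel {u..v} *\<^sub>R F x - (f v - f u)\<bar> \<le> e1 * (v - u)" by linarith
        then show ?thesis using z'(1,3,4) by simp
      qed
      have bad: "(\<Sum>z\<in>DN. ?t z) < e / 2"
      proof -
        \<comment> \<open>degenerate intervals contribute nothing; without them, endpoints determine the tagged interval\<close>
        define D' where "D' = (\<lambda>(x, K). (Inf K, Sup K)) ` {z \<in> DN. Inf (snd z) < Sup (snd z)}"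
        have K': "\<exists>u v. K = {u..v} \<and> a \<le> u \<and> u \<le> x \<and> x \<le> v \<and> v \<le> b \<and> {u..v} \<subseteq> U \<and> x \<in> N"
          if "(x, K) \<in> DN" for x K
          using K[of x K] that r(2)[of x] unfolding DN_def by fastforce
        have inter: "interior K1 \<inter> interior K2 = {}" if "(x1, K1) \<in> DN" "(x2, K2) \<in> DN" "(x1, K1) \<noteq> (x2, K2)"
          for x1 x2 K1 K2
          using D(1) that unfolding DN_def by (auto dest: tagged_division_ofD(5))
        have io: "interior K = {Inf K<..<Sup K}" if "(x, K) \<in> DN" for x K
          using K'[OF that] by auto
        have inj: "inj_on (\<lambda>(x, K). (Inf K, Sup K)) {z \<in> DN. Inf (snd z) < Sup (snd z)}"
        proof (rule inj_onI)
          fix z1 z2 assume h: "z1 \<in> {z \<in> DN. Inf (snd z) < Sup (snd z)}" "z2 \<in> {z \<in> DN. Inf (snd z) < Sup (snd z)}"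
            "(case z1 of (x, K) \<Rightarrow> (Inf K, Sup K)) = (case z2 of (x, K) \<Rightarrow> (Inf K, Sup K))"
          show "z1 = z2"
          proof (rule ccontr)
            assume "z1 \<noteq> z2"
            then have "interior (snd z1) \<inter> interior (snd z2) = {}"
              using inter h by (metis (no_types, lifting) mem_Collect_eq prod.collapse)
            moreover have "interior (snd z1) = {Inf (snd z1)<..<Sup (snd z1)}" "interior (snd z2) = {Inf (snd z1)<..<Sup (snd z1)}"
              using io h by (cases z1; cases z2; auto)+
            ultimately show False using h(1) dense[of "Inf (snd z1)" "Sup (snd z1)"] by auto
          qed
        qed
        have no: "nonoverlapping a b D'" and sub: "\<And>p q. (p, q) \<in> D' \<Longrightarrow> {p<..<q} \<subseteq> U \<and> p < q"
        proof -
          have "finite D'" using fin by (simp add: D'_def DN_def)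
          moreover have "a \<le> p \<and> p < q \<and> q \<le> b \<and> {p<..<q} \<subseteq> U" if pq: "(p, q) \<in> D'" for p q
          proof -
            obtain x K where xK: "(x, K) \<in> DN" "p = Inf K" "q = Sup K" "p < q"
              using pq by (auto simp: D'_def)
            with K'[OF xK(1)] show ?thesis by auto
          qed
          moreover have "pairwise (\<lambda>I J. {fst I<..<snd I} \<inter> {fst J<..<snd J} = {}) D'"
          proof (rule pairwiseI)
            fix I J assume "I \<in> D'" "J \<in> D'" "I \<noteq> J"
            then obtain x1 K1 x2 K2 where "(x1, K1) \<in> DN" "(x2, K2) \<in> DN"
              "I = (Inf K1, Sup K1)" "J = (Inf K2, Sup K2)"
              by (auto simp: D'_def)
            with \<open>I \<noteq> J\<close> inter[of x1 K1 x2 K2] io[of x1 K1] io[of x2 K2]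
            show "{fst I<..<snd I} \<inter> {fst J<..<snd J} = {}" by auto
          qed
          ultimately show "nonoverlapping a b D'" "\<And>p q. (p, q) \<in> D' \<Longrightarrow> {p<..<q} \<subseteq> U \<and> p < q"
            by (auto simp: nonoverlapping_def)
        qed
        have "(\<Sum>(p, q)\<in>D'. q - p) = (\<Sum>I\<in>D'. measure lebesgue {fst I<..<snd I})"
          using sub by (intro sum.cong) (auto simp: less_imp_le)
        also have "\<dots> = measure lebesgue (\<Union>I\<in>D'. {fst I<..<snd I})"
          using no unfolding nonoverlapping_def
          by (intro measure_finite_Union[symmetric]) (auto simp: disjoint_family_on_def pairwise_def)
        also have "\<dots> \<le> measure lebesgue U"
        proof (rule measure_mono_fmeasurable)
          have "{fst I<..<snd I} \<subseteq> U" if I: "I \<in> D'" for I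
            using sub[of "fst I" "snd I"] I by simp
          then show "(\<Union>I\<in>D'. {fst I<..<snd I}) \<subseteq> U" by blast
          show "(\<Union>I\<in>D'. {fst I<..<snd I}) \<in> sets lebesgue"
            using no by (intro sets.finite_UN) (auto simp: nonoverlapping_def)
        qed (rule fU)
        also have "\<dots> < d" by (rule mU)
        finally have "(\<Sum>(p, q)\<in>D'. norm (f q - f p)) < e / 2" by (rule d(2)[OF no])
        also have "(\<Sum>(p, q)\<in>D'. norm (f q - f p)) = (\<Sum>(x, K)\<in>{z \<in> DN. Inf (snd z) < Sup (snd z)}. \<bar>f (Sup K) - f (Inf K)\<bar>)"
          unfolding D'_def by (subst sum.reindex[OF inj]) (auto intro!: sum.cong)
        also have "\<dots> = (\<Sum>z\<in>DN. ?t z)"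
        proof (rule sum.mono_neutral_cong_left)
          show "finite DN" using fin by (simp add: DN_def)
          show "\<forall>i\<in>DN - {z \<in> DN. Inf (snd z) < Sup (snd z)}. ?t i = 0"
          proof
            fix z assume z: "z \<in> DN - {z \<in> DN. Inf (snd z) < Sup (snd z)}"
            obtain x K where "z = (x, K)" by fastforce
            with z K'[of x K] obtain u v where "z = (x, {u..v})" "u \<le> v" "\<not> u < v" "x \<in> N" by auto
            then show "?t z = 0" by (simp add: F_def)
          qed
        qed (auto simp: F_def DN_def abs_minus_commute)
        finally show ?thesis .
      qed
      have "\<bar>(\<Sum>(x, K)\<in>\<D>. measure lborel K *\<^sub>R F x) - (f b - f a)\<bar> = \<bar>\<Sum>(x, K)\<in>\<D>. measure lborel K *\<^sub>R F x - (f (Sup K) - f (Inf K))\<bar>"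
        unfolding tel[symmetric] by (simp add: sum_subtractf case_prod_unfold)
      also have "\<dots> \<le> (\<Sum>z\<in>\<D>. ?t z)"
        by (rule order_trans[OF sum_abs]) (auto simp: case_prod_unfold)
      also have "\<dots> = (\<Sum>z\<in>\<D> - DN. ?t z) + (\<Sum>z\<in>DN. ?t z)"
        using fin by (intro sum.subset_diff) (auto simp: DN_def)
      also have "(\<Sum>z\<in>\<D> - DN. ?t z) \<le> (\<Sum>z\<in>\<D> - DN. e1 * (case z of (x, K) \<Rightarrow> Sup K - Inf K))"
        by (intro sum_mono good)
      also have "\<dots> \<le> (\<Sum>z\<in>\<D>. e1 * (case z of (x, K) \<Rightarrow> Sup K - Inf K))"
        using fin e1 K by (intro sum_mono2) (fastforce intro!: mult_nonneg_nonneg)+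
      also have "\<dots> = e1 * (b - a)" unfolding tel1[symmetric] by (simp add: sum_distrib_left)
      also have "\<dots> < e / 2" by (rule e1_len)
      finally show ?thesis using bad by simp
    qed
    then show "\<exists>\<gamma>. gauge \<gamma> \<and> (\<forall>\<D>. \<D> tagged_division_of {a..b} \<and> \<gamma> fine \<D> \<longrightarrow>
        norm ((\<Sum>(x, k)\<in>\<D>. measure lborel k *\<^sub>R F x) - (f b - f a)) < e)"
      using r(1) by (intro exI[of _ "\<lambda>x. ball x (r x)"]) (auto intro: gauge_ball_dependent)
  qed
  then show ?thesis
    by (rule has_integral_spike[OF N, rotated]) (auto simp: F_def)
qed

section \<open>Charts\<close>

lemma chart_at:
  assumes "smooth_manifold A"
  shows "chart_at A p \<in> A" "p \<in> fst (chart_at A p)" "is_chart (chart_at A p)"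
proof -
  have "\<exists>c. c \<in> A \<and> p \<in> fst c" using assms unfolding smooth_manifold_def by blast
  then have "chart_at A p \<in> A \<and> p \<in> fst (chart_at A p)"
    unfolding chart_at_def by (rule someI_ex)
  then show "chart_at A p \<in> A" "p \<in> fst (chart_at A p)" "is_chart (chart_at A p)"
    using assms by (auto simp: smooth_manifold_def)
qed

lemma is_chartD:
  assumes "is_chart c"
  shows "open (fst c)" "open (chart_image c)" "continuous_on (fst c) (snd c)"
    "continuous_on (chart_image c) (chart_inv c)"
    "\<And>p. p \<in> fst c \<Longrightarrow> chart_inv c (snd c p) = p" "\<And>p. p \<in> fst c \<Longrightarrow> snd c p \<in> chart_image c"
    "\<And>y. y \<in> chart_image c \<Longrightarrow> snd c (chart_inv c y) = y" "\<And>y. y \<in> chart_image c \<Longrightarrow> chart_inv c y \<in> fst c"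
proof -
  have h: "open (fst c)" "open (chart_image c)" "homeomorphism (fst c) (chart_image c) (snd c) (chart_inv c)"
    using assms by (simp_all add: is_chart_def)
  show "open (fst c)" "open (chart_image c)" by (fact h)+
  show "continuous_on (fst c) (snd c)" "continuous_on (chart_image c) (chart_inv c)"
    using h(3) by (simp_all add: homeomorphism_def)
  show "chart_inv c (snd c p) = p" "snd c p \<in> chart_image c" if "p \<in> fst c" for p
    using h(3) that by (simp_all add: homeomorphism_apply1 chart_image_def)
  show "snd c (chart_inv c y) = y" "chart_inv c y \<in> fst c" if "y \<in> chart_image c" for y
    using h(3) that homeomorphism_image2[OF h(3)] by (auto simp: homeomorphism_apply2)
qed

lemma chart_image_Int:
  assumes "is_chart c"
  shows "snd c ` (fst c \<inter> S) = {y \<in> chart_image c. chart_inv c y \<in> S}"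
proof safe
  fix p assume "p \<in> fst c" "p \<in> S"
  then show "snd c p \<in> chart_image c" "chart_inv c (snd c p) \<in> S"
    using is_chartD(5,6)[OF assms, of p] by simp_all
next
  fix y assume "y \<in> chart_image c" "chart_inv c y \<in> S"
  then show "y \<in> snd c ` (fst c \<inter> S)"
    using is_chartD(7,8)[OF assms, of y] by (intro image_eqI[of _ _ "chart_inv c y"]) auto
qed

lemma open_chart_image_Int:
  assumes "is_chart c" "open S"
  shows "open (snd c ` (fst c \<inter> S))"
proof -
  have "open (chart_image c \<inter> chart_inv c -` S)"
    using is_chartD(2,4)[OF assms(1)] assms(2) by (intro continuous_open_preimage) auto
  then show ?thesis
    unfolding chart_image_Int[OF assms(1)] by (simp add: vimage_def Int_def)
qed

text \<open>
  In the chart that was used to identify the tangent space at \<open>p\<close> with the model space, components of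
  vectors at \<open>p\<close> are the vectors themselves.
\<close>

lemma tangent_param_chart_at:
  assumes "smooth_manifold A"
  shows "tangent_param A (chart_at A p) (snd (chart_at A p) p, w) = (p, w)"
proof -
  let ?c = "chart_at A p"
  note c = chart_at[OF assms, of p]
  have "((\<lambda>y. y) has_derivative (\<lambda>y. y)) (at (snd ?c p))" by simp
  then have "(snd ?c \<circ> chart_inv ?c has_derivative (\<lambda>y. y)) (at (snd ?c p))"
    by (rule has_derivative_transform_within_open[of _ _ _ _ "chart_image ?c"])
      (use is_chartD[OF c(3)] c in auto)
  from frechet_derivative_at[OF this, symmetric] show ?thesis
    using is_chartD(5)[OF c(3) c(2)] by (simp add: tangent_param_def)
qed

section \<open>Causal cones\<close>

lemma lorentz_function_zero:
  assumes "lorentz_finsler_function A F"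
  shows "F p 0 = 0"
proof -
  have "F p (2 *\<^sub>R 0) = 2\<^sup>2 * F p 0"
    using assms unfolding lorentz_finsler_function_def by (metis zero_less_numeral)
  then show ?thesis by simp
qed

lemma lorentz_function_isCont:
  assumes "smooth_manifold A" "lorentz_finsler_function A F" "v \<noteq> 0"
  shows "isCont (F p) v"
proof -
  let ?c = "chart_at A p"
  have "smooth_on (chart_image ?c \<times> (UNIV - {0})) ((\<lambda>(p, v). F p v) \<circ> tangent_param A ?c)"
    using assms chart_at[OF assms(1), of p] by (auto simp: lorentz_finsler_function_def)
  then have "Ck_on 0 (chart_image ?c \<times> (UNIV - {0})) ((\<lambda>(p, v). F p v) \<circ> tangent_param A ?c)"
    unfolding smooth_on_def by blast
  then have "continuous_on (chart_image ?c \<times> (UNIV - {0})) ((\<lambda>(p, v). F p v) \<circ> tangent_param A ?c)"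
    by simp
  then have "continuous_on (UNIV - {0}) (\<lambda>w. ((\<lambda>(p, v). F p v) \<circ> tangent_param A ?c) (snd ?c p, w))"
    by (rule continuous_on_compose2)
      (use is_chartD(6)[OF chart_at(3,2)[OF assms(1)], of p] in \<open>auto intro!: continuous_intros\<close>)
  then have "continuous_on (UNIV - {0}) (F p)"
    by (simp add: o_def tangent_param_chart_at[OF assms(1)])
  then show ?thesis
    using assms(3) by (simp add: continuous_on_eq_continuous_at open_Diff)
qed

lemma causal_structureE:
  assumes "causal_structure A F C"
  obtains K where "K \<in> components {v. F p v > 0}" "fibre C p = closure K"
  using assms unfolding causal_structure_def by blast

text \<open>
  On the closure of a component of \<open>{F p > 0}\<close> the function is nonnegative by continuity, except at the
  origin, where smoothness gives nothing and homogeneity is used instead.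
\<close>

lemma fibre_nonneg:
  assumes "smooth_manifold A" "lorentz_finsler_function A F" "causal_structure A F C"
    and v: "v \<in> fibre C p"
  shows "F p v \<ge> 0"
proof (cases "v = 0")
  case True then show ?thesis using lorentz_function_zero[OF assms(2)] by simp
next
  case False
  obtain K where K: "K \<in> components {v. F p v > 0}" "fibre C p = closure K"
    using causal_structureE[OF assms(3)] .
  obtain X where X: "\<And>n. X n \<in> K" "X \<longlonglongrightarrow> v"
    using v unfolding K(2) closure_sequential by blast
  have "F p (X n) \<ge> 0" for n
    using X(1)[of n] in_components_subset[OF K(1)] by (auto intro: less_imp_le)
  moreover have "(\<lambda>n. F p (X n)) \<longlonglongrightarrow> F p v"
    using isCont_tendsto_compose[OF lorentz_function_isCont[OF assms(1,2) False] X(2)] .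
  ultimately show ?thesis by (intro LIMSEQ_le_const) auto
qed

text \<open>
  By homogeneity a component of \<open>{F p > 0}\<close> contains the open ray through each of its points, and the
  ray accumulates at the origin.
\<close>

lemma zero_in_fibre:
  assumes "lorentz_finsler_function A F" "causal_structure A F C"
  shows "0 \<in> fibre C p"
proof -
  obtain K where K: "K \<in> components {v. F p v > 0}" "fibre C p = closure K"
    using causal_structureE[OF assms(2)] .
  obtain v where v: "v \<in> K" using in_components_nonempty[OF K(1)] by blast
  then have Fv: "F p v > 0" using in_components_subset[OF K(1)] by auto
  let ?R = "(\<lambda>t. t *\<^sub>R v) ` {0<..}"
  have "connected ?R"
    by (intro connected_continuous_image continuous_intros) simp
  moreover have "?R \<subseteq> {v. F p v > 0}"
    using assms(1) Fv by (auto simp: lorentz_finsler_function_def)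
  moreover have "K \<inter> ?R \<noteq> {}"
    using v by (auto intro!: image_eqI[of _ _ 1])
  ultimately have R: "?R \<subseteq> K" using components_maximal[OF K(1)] by blast
  let ?X = "\<lambda>n. (1 / real (Suc n)) *\<^sub>R v"
  have "?X \<longlonglongrightarrow> 0 *\<^sub>R v"
    by (intro tendsto_scaleR tendsto_const LIMSEQ_Suc[OF lim_1_over_n])
  then have "?X \<longlonglongrightarrow> 0" by simp
  moreover have "\<forall>n. ?X n \<in> K"
    using R by (intro allI subsetD[OF R] imageI) simp
  ultimately show ?thesis
    unfolding K(2) closure_sequential by (intro exI[of _ ?X] conjI)
qed

lemma J_plus_refl:
  assumes "lorentz_finsler_function A F" "causal_structure A F C"
  shows "(x, x) \<in> J_plus A C"
proof -
  have "velocity A (\<lambda>_. x) t = 0" for t :: real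
    unfolding velocity_def o_def by (rule vector_derivative_at) (rule has_vector_derivative_const)
  then have "causal_curve A C (\<lambda>_. x) 0 1"
    using zero_in_fibre[OF assms, of x]
    by (auto simp: causal_curve_def ac_curve_def abs_continuous_on_def intro!: exI[of _ 1])
  then show ?thesis unfolding J_plus_def by blast
qed

text \<open>
  The Lagrangian is nonpositive on the cone, so the positive part of the action of a causal curve vanishes.
\<close>

lemma lorentz_cost_J_plus:
  assumes "smooth_manifold A" "lorentz_finsler_function A F" "causal_structure A F C"
    and xy: "(x, y) \<in> J_plus A C"
  shows "lorentz_cost A F C x y \<le> 0"
proof -
  obtain \<gamma> a b where g: "causal_curve A C \<gamma> a b" "\<gamma> a = x" "\<gamma> b = y"
    using xy unfolding J_plus_def by blast
  have "AE t in lebesgue_on {a..b}. e2ennreal (lagrangian F C (\<gamma> t) (velocity A \<gamma> t)) \<le> 0"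
  proof (rule eventually_mono)
    show "AE t in lebesgue_on {a..b}. velocity A \<gamma> t \<in> fibre C (\<gamma> t)"
      using g(1) by (simp add: causal_curve_def)
    fix t assume v: "velocity A \<gamma> t \<in> fibre C (\<gamma> t)"
    then have "F (\<gamma> t) (velocity A \<gamma> t) \<ge> 0" by (rule fibre_nonneg[OF assms(1-3)])
    then show "e2ennreal (lagrangian F C (\<gamma> t) (velocity A \<gamma> t)) \<le> 0"
      using v by (simp add: lagrangian_def ennreal_neg)
  qed
  then have "(\<integral>\<^sup>+t. e2ennreal (lagrangian F C (\<gamma> t) (velocity A \<gamma> t)) \<partial>lebesgue_on {a..b}) \<le> (\<integral>\<^sup>+t. 0 \<partial>lebesgue_on {a..b})"
    by (rule nn_integral_mono_AE)
  then have "action A F C \<gamma> a b \<le> 0"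
    unfolding action_def ereal_integral_def by (simp add: zero_ennreal.rep_eq)
  moreover have "lorentz_cost A F C x y \<le> action A F C \<gamma> a b"
    unfolding lorentz_cost_def using g by (intro Inf_lower) (auto simp: causal_curve_def)
  ultimately show ?thesis by (rule order_trans[rotated])
qed

section \<open>The time function along curves\<close>

definition C1_on :: "'a::real_normed_vector set \<Rightarrow> ('a \<Rightarrow> 'b::real_normed_vector) \<Rightarrow> bool" where
  "C1_on W f \<longleftrightarrow> (\<forall>y\<in>W. f differentiable (at y)) \<and>
     (\<forall>v. continuous_on W (\<lambda>y. frechet_derivative f (at y) v))"

lemma smooth_on_imp_C1_on: "smooth_on W f \<Longrightarrow> C1_on W f"
proof -
  assume "smooth_on W f"
  then have "Ck_on (Suc 0) W f" unfolding smooth_on_def by blast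
  then show ?thesis by (simp add: C1_on_def)
qed

lemma C1_on_fst:
  assumes "C1_on W f"
  shows "C1_on W (\<lambda>y. fst (f y))"
proof -
  have d: "((\<lambda>y. fst (f y)) has_derivative (\<lambda>v. fst (frechet_derivative f (at y) v))) (at y)" if "y \<in> W" for y
    using assms that unfolding C1_on_def
    by (auto intro!: has_derivative_fst simp: frechet_derivative_works[symmetric])
  have "continuous_on W (\<lambda>y. frechet_derivative (\<lambda>y. fst (f y)) (at y) v)" for v
  proof (rule continuous_on_eq)
    show "continuous_on W (\<lambda>y. fst (frechet_derivative f (at y) v))"
      using assms by (auto simp: C1_on_def intro!: continuous_on_fst)
  qed (simp add: frechet_derivative_at[OF d, symmetric])
  then show ?thesis using d by (auto simp: C1_on_def differentiable_def)
qed

text \<open>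
  On a compact ball the finitely many partial derivatives are bounded, which bounds the operator norm
  of the derivative.
\<close>

lemma C1_on_locally_lipschitz:
  fixes f :: "'e::euclidean_space \<Rightarrow> 'b::real_normed_vector"
  assumes f: "C1_on W f" and W: "open W" "y0 \<in> W"
  obtains r K where "r > 0" "\<forall>x\<in>ball y0 r. \<forall>y\<in>ball y0 r. norm (f x - f y) \<le> K * norm (x - y)"
proof -
  obtain r where r: "r > 0" "cball y0 r \<subseteq> W" using W open_contains_cball by blast
  let ?D = "\<lambda>y. frechet_derivative f (at y)"
  have "\<exists>M. \<forall>y\<in>cball y0 r. norm (?D y b) \<le> M" for b
  proof -
    have "continuous_on (cball y0 r) (\<lambda>y. ?D y b)"
      using f r(2) unfolding C1_on_def by (blast intro: continuous_on_subset)
    then have "compact ((\<lambda>y. ?D y b) ` cball y0 r)" by (intro compact_continuous_image) auto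
    then obtain M where "\<forall>z\<in>(\<lambda>y. ?D y b) ` cball y0 r. norm z \<le> M"
      using compact_imp_bounded bounded_iff by metis
    then show ?thesis by blast
  qed
  then obtain M where M: "\<And>b y. y \<in> cball y0 r \<Longrightarrow> norm (?D y b) \<le> M b" by metis
  have der: "(f has_derivative ?D y) (at y)" if "y \<in> cball y0 r" for y
    using f r(2) that unfolding C1_on_def by (auto simp: frechet_derivative_works[symmetric])
  have on: "onorm (?D y) \<le> (\<Sum>b\<in>Basis. M b)" if y: "y \<in> cball y0 r" for y
  proof (rule onorm_le)
    fix v :: 'e
    interpret linear "?D y" using der[OF y] has_derivative_linear by blast
    have "norm (?D y v) = norm (\<Sum>b\<in>Basis. (v \<bullet> b) *\<^sub>R ?D y b)"
      by (subst (1) euclidean_representation[of v, symmetric]) (simp add: sum scale)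
    also have "\<dots> \<le> (\<Sum>b\<in>Basis. norm v * M b)"
      using M[OF y] by (intro sum_norm_le) (auto intro!: mult_mono simp: Basis_le_norm)
    also have "\<dots> = (\<Sum>b\<in>Basis. M b) * norm v" by (simp add: sum_distrib_left mult.commute)
    finally show "norm (?D y v) \<le> (\<Sum>b\<in>Basis. M b) * norm v" .
  qed
  have "norm (f x - f y) \<le> (\<Sum>b\<in>Basis. M b) * norm (x - y)" if "x \<in> ball y0 r" "y \<in> ball y0 r" for x y
    by (rule differentiable_bound[of "ball y0 r" f ?D])
      (use der on that in \<open>auto intro: has_derivative_at_withinI\<close>)
  then show thesis using that r(1) by blast
qed

text \<open>
  The time function is the first component of the local expression of \<open>\<Phi>\<close> with respect to the given
  chart and a chart of the factor \<open>N\<close>.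
\<close>

lemma time_coordinate_C1:
  assumes A: "smooth_manifold A" and S: "splitting A h F C B \<Phi>" and c: "c \<in> A" and y0: "y0 \<in> chart_image c"
  obtains W where "open W" "y0 \<in> W" "C1_on W (fst \<circ> \<Phi> \<circ> chart_inv c)"
proof -
  have ch: "is_chart c" using A c by (auto simp: smooth_manifold_def)
  have B: "smooth_manifold B" and sm: "smooth_map A (real_times_atlas B) \<Phi>"
    using S by (auto simp: splitting_def diffeomorphism_def)
  let ?d = "chart_at B (snd (\<Phi> (chart_inv c y0)))"
  note d = chart_at[OF B, of "snd (\<Phi> (chart_inv c y0))"]
  let ?D = "((UNIV :: real set) \<times> fst ?d, map_prod (id :: real \<Rightarrow> real) (snd ?d))"
  have D: "?D \<in> real_times_atlas B" using d by (auto simp: real_times_atlas_def)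
  let ?W = "snd c ` (fst c \<inter> \<Phi> -` fst ?D)"
  have "smooth_on ?W (snd ?D \<circ> \<Phi> \<circ> chart_inv c)"
    using sm D c unfolding smooth_map_def by blast
  then have "C1_on ?W (\<lambda>y. fst ((snd ?D \<circ> \<Phi> \<circ> chart_inv c) y))"
    by (intro C1_on_fst smooth_on_imp_C1_on)
  moreover have "(\<lambda>y. fst ((snd ?D \<circ> \<Phi> \<circ> chart_inv c) y)) = fst \<circ> \<Phi> \<circ> chart_inv c"
    by (simp add: fun_eq_iff)
  moreover have "open (\<Phi> -` fst ?D)"
    using sm is_chartD(1)[OF d(3)] by (intro open_vimage) (auto simp: smooth_map_def open_Times)
  then have "open ?W" by (rule open_chart_image_Int[OF ch])
  moreover have "y0 \<in> ?W"
    unfolding chart_image_Int[OF ch] using y0 d by (auto simp: mem_Times_iff)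
  ultimately show thesis using that by metis
qed

lemma curve_near:
  fixes \<gamma> :: "real \<Rightarrow> 'm::topological_space"
  assumes "continuous_on {a..b} \<gamma>" "t \<in> {a..b}" "open U" "\<gamma> t \<in> U"
  obtains d where "d > 0" "\<And>s. s \<in> {a..b} \<Longrightarrow> \<bar>s - t\<bar> < d \<Longrightarrow> \<gamma> s \<in> U"
proof -
  have "\<exists>V. open V \<and> V \<inter> {a..b} = \<gamma> -` U \<inter> {a..b}"
    using assms(1,3) unfolding continuous_on_open_invariant by simp
  then obtain V where V: "open V" "V \<inter> {a..b} = \<gamma> -` U \<inter> {a..b}" by blast
  have "t \<in> V" using V(2) assms(2,4) by blast
  then obtain d where d: "d > 0" "ball t d \<subseteq> V" using V(1) open_contains_ball by blast
  have "\<gamma> s \<in> U" if "s \<in> {a..b}" "\<bar>s - t\<bar> < d" for s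
  proof -
    have "s \<in> ball t d" using that by (simp add: dist_real_def)
    then show ?thesis using d(2) V(2) that(1) by blast
  qed
  then show thesis using that d(1) by blast
qed

text \<open>
  Since \<open>vector_derivative\<close> has an arbitrary value at points of non-differentiability, velocities carry
  information only if such points form a null set. The chart \<open>chart_at A (\<gamma> t)\<close> varies wildly with
  \<open>t\<close>. Therefore one chart is chosen for each of the countably many rational intervals that \<open>\<gamma>\<close> maps into
  a single chart domain, and smooth transition maps lead from these charts to the prescribed ones.
\<close>

lemma ac_curve_coordinates_differentiable:
  fixes A :: "('m::{second_countable_topology, t2_space}, 'e::euclidean_space) chart set"
  assumes A: "smooth_manifold A" and g: "ac_curve A \<gamma> a b"
  obtains N where "negligible N" "a \<in> N" "b \<in> N"
    "\<forall>t\<in>{a..b} - N. (snd (chart_at A (\<gamma> t)) \<circ> \<gamma>) differentiable (at t)"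
proof -
  have cont: "continuous_on {a..b} \<gamma>" using g by (simp add: ac_curve_def)
  define I where "I = {(p, q). p \<in> \<rat> \<and> q \<in> \<rat> \<and> a \<le> p \<and> p < q \<and> q \<le> b \<and> (\<exists>c\<in>A. \<gamma> ` {p..q} \<subseteq> fst c)}"
  have "\<forall>z\<in>I. \<exists>c\<in>A. \<gamma> ` {fst z..snd z} \<subseteq> fst c" by (auto simp: I_def)
  then obtain ch where ch: "\<And>z. z \<in> I \<Longrightarrow> ch z \<in> A \<and> \<gamma> ` {fst z..snd z} \<subseteq> fst (ch z)" by metis
  define N where "N = (\<Union>z\<in>I. {t \<in> {fst z..snd z}. \<not> (snd (ch z) \<circ> \<gamma>) differentiable (at t)}) \<union> {a, b}"
  have "countable I"
    by (rule countable_subset[of _ "\<rat> \<times> \<rat>"]) (auto simp: I_def intro: countable_rat)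
  moreover have "negligible {t \<in> {fst z..snd z}. \<not> (snd (ch z) \<circ> \<gamma>) differentiable (at t)}" if "z \<in> I" for z
    using ch[OF that] g that
    by (intro abs_continuous_differentiable) (auto simp: ac_curve_def I_def)
  ultimately have "negligible N"
    unfolding N_def by (intro negligible_Un negligible_countable_Union) auto
  moreover have "(snd (chart_at A (\<gamma> t)) \<circ> \<gamma>) differentiable (at t)" if t: "t \<in> {a..b} - N" for t
  proof -
    let ?c = "chart_at A (\<gamma> t)"
    note c = chart_at[OF A, of "\<gamma> t"]
    have ab: "a < t" "t < b" using t by (auto simp: N_def less_le)
    obtain d where d: "d > 0" "\<And>s. s \<in> {a..b} \<Longrightarrow> \<bar>s - t\<bar> < d \<Longrightarrow> \<gamma> s \<in> fst ?c"
      using curve_near[OF cont _ is_chartD(1)[OF c(3)] c(2)] ab by (metis atLeastAtMost_iff less_imp_le)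
    obtain p where p: "p \<in> \<rat>" "max a (t - d) < p" "p < t"
      using Rats_dense_in_real[of "max a (t - d)" t] ab d by auto
    obtain q where q: "q \<in> \<rat>" "t < q" "q < min b (t + d)"
      using Rats_dense_in_real[of t "min b (t + d)"] ab d by auto
    have "\<gamma> ` {p..q} \<subseteq> fst ?c" using p q by (auto intro!: d(2))
    then have z: "(p, q) \<in> I" using p q c(1) by (auto simp: I_def)
    let ?d = "ch (p, q)"
    have dA: "?d \<in> A" "\<gamma> ` {p..q} \<subseteq> fst ?d" using ch[OF z] by auto
    then have dch: "is_chart ?d" using A by (auto simp: smooth_manifold_def)
    have diff: "(snd ?d \<circ> \<gamma>) differentiable (at t)"
      using t z p q by (fastforce simp: N_def)
    have "smooth_on (snd ?d ` (fst ?d \<inter> fst ?c)) (snd ?c \<circ> chart_inv ?d)"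
      using A dA(1) c(1) by (auto simp: smooth_manifold_def)
    moreover have "(snd ?d \<circ> \<gamma>) t \<in> snd ?d ` (fst ?d \<inter> fst ?c)"
    proof -
      have "\<gamma> t \<in> fst ?d" using p q by (intro subsetD[OF dA(2)] imageI) auto
      then show ?thesis using c(2) by simp
    qed
    ultimately have "(snd ?c \<circ> chart_inv ?d) differentiable (at ((snd ?d \<circ> \<gamma>) t))"
      using smooth_on_imp_C1_on unfolding C1_on_def by blast
    from differentiable_chain_at[OF diff this]
    obtain D where "((snd ?c \<circ> chart_inv ?d) \<circ> (snd ?d \<circ> \<gamma>) has_derivative D) (at t)"
      unfolding differentiable_def by blast
    then have "(snd ?c \<circ> \<gamma> has_derivative D) (at t)"
      by (rule has_derivative_transform_within_open[of _ _ _ _ "{p<..<q}"])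
        (use p q dA(2) is_chartD(5)[OF dch] in \<open>auto simp: image_subset_iff\<close>)
    then show ?thesis by (auto simp: differentiable_def)
  qed
  ultimately show thesis using that[of N] by (auto simp: N_def)
qed

lemma time_derivative_along_curve:
  assumes A: "smooth_manifold A" and S: "splitting A h F C B \<Phi>" and cont: "continuous_on {a..b} \<gamma>"
    and t: "a < t" "t < b" and diff: "(snd (chart_at A (\<gamma> t)) \<circ> \<gamma>) differentiable (at t)"
  shows "((fst \<circ> \<Phi> \<circ> \<gamma>) has_real_derivative differential A (fst \<circ> \<Phi>) (\<gamma> t) (velocity A \<gamma> t)) (at t)"
proof -
  let ?c = "chart_at A (\<gamma> t)"
  note c = chart_at[OF A, of "\<gamma> t"]
  let ?f = "fst \<circ> \<Phi> \<circ> chart_inv ?c"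
  obtain W where "open W" "snd ?c (\<gamma> t) \<in> W" "C1_on W ?f"
    using time_coordinate_C1[OF A S c(1)] is_chartD(6)[OF c(3) c(2)] .
  then have f_deriv: "(?f has_derivative frechet_derivative ?f (at (snd ?c (\<gamma> t)))) (at ((snd ?c \<circ> \<gamma>) t))"
    by (auto simp: C1_on_def frechet_derivative_works[symmetric])
  moreover have v: "(snd ?c \<circ> \<gamma> has_vector_derivative velocity A \<gamma> t) (at t)"
    unfolding velocity_def using diff by (simp add: vector_derivative_works)
  ultimately have "(?f \<circ> (snd ?c \<circ> \<gamma>) has_derivative
      frechet_derivative ?f (at (snd ?c (\<gamma> t))) \<circ> (\<lambda>x. x *\<^sub>R velocity A \<gamma> t)) (at t)"
    unfolding has_vector_derivative_def by (intro diff_chain_at)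
  moreover have "linear (frechet_derivative ?f (at (snd ?c (\<gamma> t))))"
    using f_deriv by (rule has_derivative_linear)
  ultimately have d: "(?f \<circ> (snd ?c \<circ> \<gamma>) has_vector_derivative differential A (fst \<circ> \<Phi>) (\<gamma> t) (velocity A \<gamma> t)) (at t)"
    unfolding differential_def has_vector_derivative_def by (simp add: o_def linear_scale)
  obtain e where e: "e > 0" "\<And>s. s \<in> {a..b} \<Longrightarrow> \<bar>s - t\<bar> < e \<Longrightarrow> \<gamma> s \<in> fst ?c"
    using curve_near[OF cont _ is_chartD(1)[OF c(3)] c(2)] t by (metis atLeastAtMost_iff less_imp_le)
  have "((fst \<circ> \<Phi> \<circ> \<gamma>) has_vector_derivative differential A (fst \<circ> \<Phi>) (\<gamma> t) (velocity A \<gamma> t)) (at t)"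
    by (rule has_vector_derivative_transform_within_open[OF d, of "{a<..<b} \<inter> ball t e"])
      (use e t is_chartD(5)[OF c(3)] in \<open>auto simp: dist_real_def abs_minus_commute\<close>)
  then show ?thesis unfolding has_real_derivative_iff_has_vector_derivative .
qed

text \<open>
  The fundamental theorem applies on short intervals, where the curve stays in a region in which the
  time function is Lipschitz in coordinates and hence absolutely continuous along the curve; bisection
  glues the pieces.
\<close>

lemma time_has_integral:
  fixes A :: "('m::{second_countable_topology, t2_space}, 'e::euclidean_space) chart set"
  assumes A: "smooth_manifold A" and S: "splitting A h F C B \<Phi>" and g: "ac_curve A \<gamma> a b"
  shows "((\<lambda>t. differential A (fst \<circ> \<Phi>) (\<gamma> t) (velocity A \<gamma> t)) has_integral
    (fst (\<Phi> (\<gamma> b)) - fst (\<Phi> (\<gamma> a)))) {a..b}"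
proof -
  have "a < b" and cont: "continuous_on {a..b} \<gamma>" using g by (auto simp: ac_curve_def)
  let ?D = "\<lambda>t. differential A (fst \<circ> \<Phi>) (\<gamma> t) (velocity A \<gamma> t)"
  let ?f = "fst \<circ> \<Phi> \<circ> \<gamma>"
  obtain N where N: "negligible N" "a \<in> N" "b \<in> N"
    "\<forall>t\<in>{a..b} - N. (snd (chart_at A (\<gamma> t)) \<circ> \<gamma>) differentiable (at t)"
    using ac_curve_coordinates_differentiable[OF A g] .
  have deriv: "(?f has_real_derivative ?D t) (at t)" if "t \<in> {a..b} - N" for t
    using that N by (intro time_derivative_along_curve[OF A S cont]) (auto simp: less_le)
  have "a \<le> a \<longrightarrow> b \<le> b \<longrightarrow> (?D has_integral (?f b - ?f a)) {a..b}"
  proof (rule Bolzano[of a b "\<lambda>p q. a \<le> p \<longrightarrow> q \<le> b \<longrightarrow> (?D has_integral (?f q - ?f p)) {p..q}"])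
    fix p q r :: real
    assume "a \<le> p \<longrightarrow> q \<le> b \<longrightarrow> (?D has_integral (?f q - ?f p)) {p..q}"
      "a \<le> q \<longrightarrow> r \<le> b \<longrightarrow> (?D has_integral (?f r - ?f q)) {q..r}" "p \<le> q" "q \<le> r"
    then show "a \<le> p \<longrightarrow> r \<le> b \<longrightarrow> (?D has_integral (?f r - ?f p)) {p..r}"
      using has_integral_combine[of p q r ?D "?f q - ?f p" "?f r - ?f q"] by auto
  next
    fix x assume x: "a \<le> x" "x \<le> b"
    let ?c = "chart_at A (\<gamma> x)"
    note c = chart_at[OF A, of "\<gamma> x"]
    let ?F = "fst \<circ> \<Phi> \<circ> chart_inv ?c"
    obtain W where W: "open W" "snd ?c (\<gamma> x) \<in> W" "C1_on W ?F"
      using time_coordinate_C1[OF A S c(1)] is_chartD(6)[OF c(3) c(2)] .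
    obtain r K where r: "r > 0" "\<forall>u\<in>ball (snd ?c (\<gamma> x)) r. \<forall>v\<in>ball (snd ?c (\<gamma> x)) r.
        norm (?F u - ?F v) \<le> K * norm (u - v)"
      using C1_on_locally_lipschitz[OF W(3,1,2)] .
    let ?U = "fst ?c \<inter> snd ?c -` ball (snd ?c (\<gamma> x)) r"
    have "open ?U" using is_chartD(1,3)[OF c(3)] by (intro continuous_open_preimage) auto
    moreover have "\<gamma> x \<in> ?U" using c(2) r(1) by auto
    ultimately obtain d where d: "d > 0" "\<And>s. s \<in> {a..b} \<Longrightarrow> \<bar>s - x\<bar> < d \<Longrightarrow> \<gamma> s \<in> ?U"
      using curve_near[OF cont, of x ?U] x by auto
    have "(?D has_integral (?f q - ?f p)) {p..q}" if pq: "p \<le> x" "x \<le> q" "q - p < d" "a \<le> p" "q \<le> b" for p q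
    proof (cases "p = q")
      case True then show ?thesis using has_integral_refl(2)[of ?D p] by simp
    next
      case False
      have U: "\<gamma> s \<in> ?U" if "s \<in> {p..q}" for s using pq that by (intro d(2)) auto
      then have "abs_continuous_on p q (snd ?c \<circ> \<gamma>)"
        using g c(1) pq False by (auto simp: ac_curve_def image_subset_iff)
      then have "abs_continuous_on p q ?f"
      proof (rule abs_continuous_on_dominated)
        fix s t assume st: "p \<le> s" "s < t" "t \<le> q"
        have "?f u = ?F ((snd ?c \<circ> \<gamma>) u)" if "u \<in> {p..q}" for u
          using U[OF that] is_chartD(5)[OF c(3)] by auto
        then show "norm (?f t - ?f s) \<le> K * norm ((snd ?c \<circ> \<gamma>) t - (snd ?c \<circ> \<gamma>) s)"
          using U[of s] U[of t] st r(2) by simp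
      qed
      then show ?thesis
        by (rule abs_continuous_ftc[OF _ _ N(1)]) (use pq in simp, rule deriv, use pq in simp)
    qed
    then show "\<exists>d>0. \<forall>p q. p \<le> x \<and> x \<le> q \<and> q - p < d \<longrightarrow> a \<le> p \<longrightarrow> q \<le> b \<longrightarrow> (?D has_integral (?f q - ?f p)) {p..q}"
      using d(1) by blast
  qed (use \<open>a < b\<close> in auto)
  then show ?thesis by simp
qed

lemma time_differential_nonneg:
  assumes "riemannian_metric A h" "splitting A h F C B \<Phi>" "v \<in> fibre C p"
  shows "differential A (fst \<circ> \<Phi>) p v \<ge> 0" "- lagrangian F C p v \<le> ereal (differential A (fst \<circ> \<Phi>) p v)"
proof -
  have s: "ereal (- differential A (fst \<circ> \<Phi>) p v) \<le> min (lagrangian F C p v) (ereal (- riemannian_norm h p v))"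
    using assms(2,3) by (auto simp: splitting_def)
  have "h p v v \<ge> 0"
  proof (cases "v = 0")
    case True
    have "bilinear (h p)" using assms(1) by (auto simp: riemannian_metric_def)
    then show ?thesis using True bilinear_lzero by fastforce
  next
    case False then show ?thesis using assms(1) by (auto simp: riemannian_metric_def intro: less_imp_le)
  qed
  then have "riemannian_norm h p v \<ge> 0" by (simp add: riemannian_norm_def)
  with s show "differential A (fst \<circ> \<Phi>) p v \<ge> 0" by simp
  from s have "- ereal (differential A (fst \<circ> \<Phi>) p v) \<le> lagrangian F C p v" by simp
  then show "- lagrangian F C p v \<le> ereal (differential A (fst \<circ> \<Phi>) p v)"
    by (subst ereal_uminus_le_reorder)
qed

text \<open>
  Let \<open>Z\<close> be the set of times at which \<open>\<tau>\<close> decreases along the curve, a measurable set since the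
  derivative of \<open>\<tau>\<close> is integrable. The velocity is outside the cone on \<open>Z\<close>, so \<open>L = \<infinity>\<close> there and the
  action is infinite if \<open>Z\<close> is not null. Otherwise the negative part of \<open>L\<close> is dominated by the
  derivative of \<open>\<tau>\<close>, whose integral is the increment of \<open>\<tau>\<close>. The function \<open>L\<close> itself, whose
  measurability along the curve is not known, enters through the monotonicity of \<open>nn_integral\<close>.
\<close>

lemma action_lower_bound:
  fixes A :: "('m::{second_countable_topology, t2_space}, 'e::euclidean_space) chart set"
  assumes A: "smooth_manifold A" and h: "riemannian_metric A h" and S: "splitting A h F C B \<Phi>"
    and g: "ac_curve A \<gamma> a b"
  shows "action A F C \<gamma> a b \<ge> - ereal \<bar>fst (\<Phi> (\<gamma> b)) - fst (\<Phi> (\<gamma> a))\<bar>"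
proof -
  let ?D = "\<lambda>t. differential A (fst \<circ> \<Phi>) (\<gamma> t) (velocity A \<gamma> t)"
  let ?L = "\<lambda>t. lagrangian F C (\<gamma> t) (velocity A \<gamma> t)"
  let ?M = "lebesgue_on {a..b}"
  let ?T = "fst (\<Phi> (\<gamma> b)) - fst (\<Phi> (\<gamma> a))"
  note int = time_has_integral[OF A S g]
  define Z where "Z = {t \<in> {a..b}. ?D t < 0}"
  have meas: "?D \<in> borel_measurable ?M"
    using int by (intro integrable_imp_measurable) auto
  have Z: "Z \<in> sets ?M"
  proof -
    have "{t \<in> space ?M. ?D t < 0} \<in> sets ?M" using meas by measurable
    then show ?thesis by (simp add: Z_def)
  qed
  show ?thesis
  proof (cases "emeasure ?M Z = 0")
    case False
    have "\<infinity> * emeasure ?M Z = (\<integral>\<^sup>+t. \<infinity> * indicator Z t \<partial>?M)"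
      using Z by (simp add: nn_integral_cmult_indicator)
    also have "\<dots> \<le> (\<integral>\<^sup>+t. e2ennreal (?L t) \<partial>?M)"
    proof (intro nn_integral_mono)
      fix t
      have "velocity A \<gamma> t \<notin> fibre C (\<gamma> t)" if "t \<in> Z"
        using time_differential_nonneg(1)[OF h S, of "velocity A \<gamma> t" "\<gamma> t"] that by (auto simp: Z_def)
      then show "\<infinity> * indicator Z t \<le> e2ennreal (?L t)"
        by (auto simp: indicator_def lagrangian_def)
    qed
    finally have "(\<integral>\<^sup>+t. e2ennreal (?L t) \<partial>?M) = \<infinity>"
      using False by (simp add: ennreal_top_mult top_unique)
    then show ?thesis by (simp add: action_def ereal_integral_def)
  next
    case True
    then have "negligible Z"
      using Z by (simp add: negligible_iff_null_sets null_sets_def emeasure_restrict_space sets_restrict_space_iff)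
    then have int0: "((\<lambda>t. max 0 (?D t)) has_integral ?T) {a..b}"
      by (rule has_integral_spike[OF _ _ int]) (auto simp: Z_def)
    have "(\<integral>\<^sup>+t. e2ennreal (- ?L t) \<partial>?M) \<le> (\<integral>\<^sup>+t. ennreal (max 0 (?D t)) \<partial>?M)"
    proof (intro nn_integral_mono)
      fix t
      show "e2ennreal (- ?L t) \<le> ennreal (max 0 (?D t))"
      proof (cases "velocity A \<gamma> t \<in> fibre C (\<gamma> t)")
        case True
        from e2ennreal_mono[OF time_differential_nonneg(2)[OF h S True]]
        show ?thesis using time_differential_nonneg(1)[OF h S True]
          by (simp add: max_def)
      qed (simp add: lagrangian_def e2ennreal_neg)
    qed
    also have "\<dots> = (\<integral>\<^sup>+t. ennreal (max 0 (?D t)) * indicator {a..b} t \<partial>lborel)"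
      by (simp add: nn_integral_restrict_space nn_integral_completion)
    also have "\<dots> = ennreal ?T"
      by (rule nn_integral_has_integral_lebesgue'[OF _ int0]) simp
    also have "\<dots> \<le> ennreal \<bar>?T\<bar>" by (intro ennreal_leI) simp
    finally have "enn2ereal (\<integral>\<^sup>+t. e2ennreal (- ?L t) \<partial>?M) \<le> ereal \<bar>?T\<bar>"
      by (metis abs_ge_zero enn2ereal_ennreal less_eq_ennreal.rep_eq)
    then have "- ereal \<bar>?T\<bar> \<le> - enn2ereal (\<integral>\<^sup>+t. e2ennreal (- ?L t) \<partial>?M)"
      by (simp only: ereal_minus_le_minus)
    also have "\<dots> = 0 - enn2ereal (\<integral>\<^sup>+t. e2ennreal (- ?L t) \<partial>?M)" by simp
    also have "\<dots> \<le> action A F C \<gamma> a b"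
      unfolding action_def ereal_integral_def by (intro ereal_minus_mono) auto
    finally show ?thesis .
  qed
qed

lemma lorentz_cost_lower_bound:
  fixes A :: "('m::{second_countable_topology, t2_space}, 'e::euclidean_space) chart set"
  assumes "smooth_manifold A" "riemannian_metric A h" "splitting A h F C B \<Phi>"
  shows "lorentz_cost A F C x y \<ge> - ereal \<bar>fst (\<Phi> y) - fst (\<Phi> x)\<bar>"
  unfolding lorentz_cost_def using action_lower_bound[OF assms] by (intro Inf_greatest) auto

section \<open>Sums along chains and potentials\<close>

fun path_sum :: "('v \<Rightarrow> 'v \<Rightarrow> 'a::comm_monoid_add) \<Rightarrow> 'v list \<Rightarrow> 'a" where
  "path_sum w (x # y # zs) = w x y + path_sum w (y # zs)"
| "path_sum w _ = 0"

lemma path_sum_append: "path_sum w (xs @ y # zs) = path_sum w (xs @ [y]) + path_sum w (y # zs)"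
proof (induction xs)
  case (Cons x xs)
  then show ?case by (cases xs) (auto simp: add.assoc)
qed simp

lemma path_sum_cmult: "path_sum (\<lambda>x y. k * f x y) xs = (k :: 'a::semiring_0) * path_sum f xs"
  by (induction "f" xs rule: path_sum.induct) (auto simp: algebra_simps)

lemma path_sum_sum: "(\<Sum>z\<in>S. path_sum (f z) xs) = path_sum (\<lambda>x y. \<Sum>z\<in>S. f z x y) xs"
  by (induction "\<lambda>x y. \<Sum>z\<in>S. f z x y" xs rule: path_sum.induct) (auto simp: sum.distrib)

text \<open>
  Along a closed chain the sum vanishes. Applied to test functions of one coordinate only, this
  is why rerouting mass along a cycle preserves the marginals.
\<close>

lemma path_sum_telescope:
  "path_sum (\<lambda>x y. F y - F x) (x # xs) = (F (last (x # xs)) - F x :: 'a::ab_group_add)"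
  by (induction xs arbitrary: x) auto

lemma path_sum_source: "path_sum (\<lambda>x y. f x) (xs @ [z]) = sum_list (map f xs)"
proof (induction xs)
  case (Cons x xs)
  then show ?case by (cases xs) auto
qed simp

lemma path_sum_nonneg:
  "(\<And>x y. (0::'a::ordered_comm_monoid_add) \<le> w x y) \<Longrightarrow> 0 \<le> path_sum w xs"
  by (induction w xs rule: path_sum.induct) auto

lemma path_sum_cong:
  "(\<And>x y. (x, y) \<in> set (zip xs (tl xs)) \<Longrightarrow> f x y = g x y) \<Longrightarrow> path_sum f xs = path_sum g xs"
  by (induction f xs rule: path_sum.induct) auto

lemma path_sum_diff:
  "path_sum (\<lambda>x y. f x y - g x y) xs = (path_sum f xs - path_sum g xs :: 'a::ab_group_add)"
  by (induction f xs rule: path_sum.induct) (auto simp: algebra_simps)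

lemma path_sum_0: "path_sum (\<lambda>x y. 0) xs = 0"
  by (induction xs rule: induct_list012) auto

lemma path_sum_ereal_not_MInf:
  assumes "\<And>x y. x \<in> set xs \<Longrightarrow> y \<in> set xs \<Longrightarrow> w x y \<noteq> (-\<infinity>::ereal)"
  shows "path_sum w xs \<noteq> -\<infinity>"
  using assms by (induction w xs rule: path_sum.induct) auto

lemma path_sum_ereal_finite:
  assumes "\<And>x y. x \<in> set xs \<Longrightarrow> y \<in> set xs \<Longrightarrow> w x y \<noteq> (-\<infinity>::ereal)" "path_sum w xs \<noteq> \<infinity>"
  shows "path_sum w xs = ereal (path_sum (\<lambda>x y. real_of_ereal (w x y)) xs)"
    and "\<forall>(x, y)\<in>set (zip xs (tl xs)). w x y \<noteq> \<infinity>"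
proof -
  have "path_sum w xs = ereal (path_sum (\<lambda>x y. real_of_ereal (w x y)) xs) \<and>
    (\<forall>(x, y)\<in>set (zip xs (tl xs)). w x y \<noteq> \<infinity>)"
    using assms
  proof (induction w xs rule: path_sum.induct)
    case (1 w x y zs)
    have "path_sum w (y # zs) \<noteq> -\<infinity>"
      using 1(2) by (intro path_sum_ereal_not_MInf) auto
    then have fin: "w x y \<noteq> \<infinity>" "path_sum w (y # zs) \<noteq> \<infinity>" using 1(3) 1(2)[of x y] by auto
    then have "path_sum w (y # zs) = ereal (path_sum (\<lambda>x y. real_of_ereal (w x y)) (y # zs)) \<and>
      (\<forall>(x, y)\<in>set (zip (y # zs) (tl (y # zs))). w x y \<noteq> \<infinity>)"
      using 1(2) by (intro 1(1)) auto
    moreover have "w x y = ereal (real_of_ereal (w x y))"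
      using fin(1) 1(2)[of x y] by (cases "w x y") auto
    then obtain r where "w x y = ereal r" by metis
    ultimately show ?case by simp
  qed auto
  then show "path_sum w xs = ereal (path_sum (\<lambda>x y. real_of_ereal (w x y)) xs)"
    "\<forall>(x, y)\<in>set (zip xs (tl xs)). w x y \<noteq> \<infinity>" by auto
qed

text \<open>
  The potential at \<open>b\<close> is the least weight of a simple path ending at \<open>b\<close>, from any starting point.
  Allowing the trivial path \<open>[b]\<close> makes it finite even at vertices that no edge of finite weight enters.
  Extending an optimal simple path to \<open>a\<close> by the edge to \<open>b\<close> either gives a simple path or closes a
  cycle, which can be cut off as its weight is nonnegative.
\<close>

lemma potential_of_nonneg_cycles:
  fixes w :: "'v \<Rightarrow> 'v \<Rightarrow> ereal"
  assumes fin: "finite V" and w: "\<And>x y. x \<in> V \<Longrightarrow> y \<in> V \<Longrightarrow> w x y \<noteq> -\<infinity>"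
    and cyc: "\<And>x xs. distinct (x # xs) \<Longrightarrow> set (x # xs) \<subseteq> V \<Longrightarrow> path_sum w (x # xs @ [x]) \<ge> 0"
  obtains \<phi> :: "'v \<Rightarrow> real" where "\<forall>x\<in>V. \<forall>y\<in>V. ereal (\<phi> y) \<le> ereal (\<phi> x) + w x y"
proof -
  define P where "P b = {xs. set xs \<subseteq> V \<and> distinct xs \<and> xs \<noteq> [] \<and> last xs = b}" for b
  have finP: "finite (P b)" for b
    by (rule finite_subset[OF _ finite_subset_distinct[OF fin]]) (auto simp: P_def)
  define \<phi> where "\<phi> b = Min (path_sum w ` P b)" for b
  have single: "[b] \<in> P b" if "b \<in> V" for b using that by (auto simp: P_def)
  have le: "\<phi> b \<le> path_sum w xs" if "xs \<in> P b" for b xs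
    unfolding \<phi>_def using finP that by (intro Min_le) auto
  have att: "\<exists>xs\<in>P b. \<phi> b = path_sum w xs" if "b \<in> V" for b
    unfolding \<phi>_def using Min_in[of "path_sum w ` P b"] finP single[OF that] by fastforce
  have step: "\<phi> b \<le> \<phi> a + w a b" if a: "a \<in> V" and b: "b \<in> V" for a b
  proof -
    obtain xs where xs: "xs \<in> P a" "\<phi> a = path_sum w xs" using att[OF a] by blast
    then obtain ys where ys: "xs = ys @ [a]"
      by (cases xs rule: rev_cases) (auto simp: P_def)
    have sum: "path_sum w (xs @ [b]) = \<phi> a + w a b"
      using path_sum_append[of w ys a "[b]"] by (simp add: ys xs(2))
    show ?thesis
    proof (cases "b \<in> set xs")
      case False
      then have "xs @ [b] \<in> P b" using xs b by (auto simp: P_def)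
      from le[OF this] show ?thesis by (simp add: sum)
    next
      case True
      then obtain us vs where uv: "xs = us @ b # vs" by (meson split_list)
      have "\<phi> b \<le> path_sum w (us @ [b])"
        using xs(1) uv by (intro le) (auto simp: P_def)
      also have "\<dots> \<le> path_sum w (us @ [b]) + path_sum w (b # vs @ [b])"
      proof -
        have "0 \<le> path_sum w (b # vs @ [b])"
          using xs(1) uv by (intro cyc) (auto simp: P_def)
        then show ?thesis using add_left_mono[of 0 _ "path_sum w (us @ [b])"] by simp
      qed
      also have "\<dots> = \<phi> a + w a b"
        using path_sum_append[of w us b "vs @ [b]"] by (simp add: uv sum[symmetric])
      finally show ?thesis .
    qed
  qed
  have "\<bar>\<phi> b\<bar> \<noteq> \<infinity>" if b: "b \<in> V" for b
  proof -
    have "\<phi> b \<le> 0" using le[OF single[OF b]] by simp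
    moreover obtain xs where xs: "xs \<in> P b" "\<phi> b = path_sum w xs" using att[OF b] by blast
    have "path_sum w xs \<noteq> -\<infinity>"
      using xs(1) w by (intro path_sum_ereal_not_MInf) (auto simp: P_def)
    ultimately show ?thesis using xs by auto
  qed
  then have "ereal (real_of_ereal (\<phi> b)) = \<phi> b" if "b \<in> V" for b
    using that by (simp add: ereal_real)
  then have "\<forall>x\<in>V. \<forall>y\<in>V. ereal (real_of_ereal (\<phi> y)) \<le> ereal (real_of_ereal (\<phi> x)) + w x y"
    using step by simp
  then show thesis by (rule that)
qed

text \<open>
  The change of cost caused by serving the target of \<open>e\<close> from the source of \<open>e'\<close> instead of its own.
\<close>

definition shift_cost :: "('a \<Rightarrow> 'b \<Rightarrow> ereal) \<Rightarrow> 'a \<times> 'b \<Rightarrow> 'a \<times> 'b \<Rightarrow> ereal" where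
  "shift_cost c e e' = c (fst e') (snd e) - c (fst e) (snd e)"

text \<open>
  The vertices of the weighted graph are the pairs in \<open>\<Gamma>\<close>. Pairs with the same source are joined by
  edges of weight zero in both directions, so that the negative of the potential descends to a
  function of the source.
\<close>

lemma rockafellar_potential:
  fixes c :: "'a \<Rightarrow> 'b \<Rightarrow> ereal"
  assumes fin: "finite \<Gamma>" and c: "\<And>x y. c x y \<noteq> -\<infinity>" and c\<Gamma>: "\<And>x y. (x, y) \<in> \<Gamma> \<Longrightarrow> c x y \<noteq> \<infinity>"
    and cyc: "\<And>e es. distinct (e # es) \<Longrightarrow> set (e # es) \<subseteq> \<Gamma> \<Longrightarrow> path_sum (shift_cost c) (e # es @ [e]) \<ge> 0"
  obtains u :: "'a \<Rightarrow> real"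
  where "\<forall>(x, y)\<in>\<Gamma>. \<forall>x'\<in>fst ` \<Gamma>. ereal (u x) + c x y \<le> ereal (u x') + c x' y"
proof -
  have w: "shift_cost c e e' \<noteq> -\<infinity>" if "e \<in> \<Gamma>" "e' \<in> \<Gamma>" for e e'
    using c[of "fst e'" "snd e"] c\<Gamma>[of "fst e" "snd e"] c[of "fst e" "snd e"] that
    by (cases "c (fst e') (snd e)"; cases "c (fst e) (snd e)") (auto simp: shift_cost_def)
  obtain \<phi> :: "'a \<times> 'b \<Rightarrow> real" where \<phi>: "\<forall>e\<in>\<Gamma>. \<forall>e'\<in>\<Gamma>. ereal (\<phi> e') \<le> ereal (\<phi> e) + shift_cost c e e'"
    using potential_of_nonneg_cycles[OF fin w cyc] .
  have le: "\<phi> e' \<le> \<phi> e" if e: "e \<in> \<Gamma>" "e' \<in> \<Gamma>" "fst e = fst e'" for e e'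
  proof -
    have "shift_cost c e e' = 0"
      using c\<Gamma>[of "fst e" "snd e"] c[of "fst e" "snd e"] e(1)
      by (cases "c (fst e) (snd e)") (auto simp: shift_cost_def e(3)[symmetric])
    then show ?thesis using \<phi> e by fastforce
  qed
  define u where "u x = - \<phi> (SOME e. e \<in> \<Gamma> \<and> fst e = x)" for x
  have u: "u (fst e) = - \<phi> e" if "e \<in> \<Gamma>" for e
  proof -
    have "(SOME e'. e' \<in> \<Gamma> \<and> fst e' = fst e) \<in> \<Gamma> \<and> fst (SOME e'. e' \<in> \<Gamma> \<and> fst e' = fst e) = fst e"
      using that by (intro someI_ex[where P="\<lambda>e'. e' \<in> \<Gamma> \<and> fst e' = fst e"]) blast
    then show ?thesis unfolding u_def using le that by (metis order_antisym)
  qed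
  have "ereal (u x) + c x y \<le> ereal (u x') + c x' y" if e: "(x, y) \<in> \<Gamma>" and x': "x' \<in> fst ` \<Gamma>" for x y x'
  proof -
    obtain e' where e': "e' \<in> \<Gamma>" "x' = fst e'" using x' by blast
    have "ereal (\<phi> e') \<le> ereal (\<phi> (x, y)) + shift_cost c (x, y) e'" using \<phi> e e' by blast
    moreover have "u x = - \<phi> (x, y)" "u x' = - \<phi> e'" using u[OF e] u[OF e'(1)] e' by auto
    ultimately show ?thesis
      using c\<Gamma>[OF e] c[of x y] c[of x' y] e'
      by (cases "c x y"; cases "c x' y") (auto simp: shift_cost_def)
  qed
  then show thesis using that by blast
qed

text \<open>
  Any real function \<open>u\<close> on a finite set of sources yields a \<open>c\<close>-convex function whose transform is
  \<open>\<zeta>\<close>. The optimality inequality for \<open>(x, y)\<close> in the last claim says that the minimum defining \<open>\<zeta> y\<close>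
  is attained at \<open>x\<close>.
\<close>

lemma c_convex_from_finite:
  fixes c :: "'a \<Rightarrow> 'a \<Rightarrow> ereal" and u :: "'a \<Rightarrow> real"
  assumes fin: "finite X" "X \<noteq> {}" and c: "\<And>x y. c x y \<noteq> -\<infinity>" and c_refl: "\<And>x. c x x \<noteq> \<infinity>"
  defines "\<zeta> \<equiv> (\<lambda>y. INF x\<in>X. ereal (u x) + c x y)"
  defines "\<psi> \<equiv> (\<lambda>x. SUP y. lower_diff (\<zeta> y) (c x y))"
  shows "c_convex c \<psi>" "\<And>x. x \<in> X \<Longrightarrow> \<psi> x \<le> ereal (u x)" "\<And>x. \<psi> x \<noteq> -\<infinity>" "c_transform c \<psi> = \<zeta>"
    "\<And>x y. x \<in> X \<Longrightarrow> c x y \<noteq> \<infinity> \<Longrightarrow> (\<forall>x'\<in>X. ereal (u x) + c x y \<le> ereal (u x') + c x' y) \<Longrightarrow>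
      \<psi> x = ereal (u x) \<and> \<zeta> y = ereal (u x) + c x y"
proof -
  have \<zeta>_le: "\<zeta> y \<le> ereal (u x) + c x y" if "x \<in> X" for x y
    unfolding \<zeta>_def using that by (intro INF_lower)
  have \<zeta>_MInf: "\<zeta> y \<noteq> -\<infinity>" for y
  proof -
    have "\<zeta> y \<in> (\<lambda>x. ereal (u x) + c x y) ` X"
      unfolding \<zeta>_def using fin by (subst Min_Inf[symmetric]) (auto intro!: Min_in)
    then show ?thesis using c by auto
  qed
  have diff_le: "lower_diff (\<zeta> y) (c x y) \<le> \<psi> x" for x y
    unfolding \<psi>_def by (intro SUP_upper) simp
  show \<psi>_le: "\<psi> x \<le> ereal (u x)" if x: "x \<in> X" for x
    unfolding \<psi>_def
  proof (rule SUP_least)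
    fix y
    show "lower_diff (\<zeta> y) (c x y) \<le> ereal (u x)"
      using \<zeta>_le[OF x, of y] \<zeta>_MInf[of y] c[of x y]
      by (cases "\<zeta> y"; cases "c x y") (auto simp: lower_diff_def)
  qed
  show \<psi>_MInf: "\<psi> x \<noteq> -\<infinity>" for x
    using diff_le[of x x] \<zeta>_MInf[of x] c[of x x] c_refl[of x]
    by (cases "\<zeta> x"; cases "c x x") (auto simp: lower_diff_def)
  show "c_convex c \<psi>"
    unfolding c_convex_def
  proof (intro conjI allI)
    obtain x where "x \<in> X" using fin by blast
    then have "\<psi> x \<noteq> \<infinity>" using \<psi>_le[of x] by auto
    then show "\<exists>x. \<psi> x \<noteq> \<infinity>" by blast
    show "\<exists>\<zeta>. \<forall>x. \<psi> x = (SUP y. lower_diff (\<zeta> y) (c x y))"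
      by (rule exI[of _ \<zeta>]) (simp add: \<psi>_def)
  qed (rule \<psi>_MInf)
  show "c_transform c \<psi> = \<zeta>"
  proof (rule ext, rule antisym)
    fix y
    show "c_transform c \<psi> y \<le> \<zeta> y"
      unfolding c_transform_def \<zeta>_def using \<psi>_le by (intro INF_mono) (auto intro: add_right_mono)
    show "\<zeta> y \<le> c_transform c \<psi> y"
      unfolding c_transform_def
    proof (rule INF_greatest)
      fix x
      show "\<zeta> y \<le> \<psi> x + c x y"
        using diff_le[of y x] \<psi>_MInf[of x] c[of x y]
        by (cases "\<zeta> y"; cases "c x y"; cases "\<psi> x") (auto simp: lower_diff_def algebra_simps)
    qed
  qed
  show "\<psi> x = ereal (u x) \<and> \<zeta> y = ereal (u x) + c x y"
    if x: "x \<in> X" and fc: "c x y \<noteq> \<infinity>" and le: "\<forall>x'\<in>X. ereal (u x) + c x y \<le> ereal (u x') + c x' y" for x y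
  proof -
    have \<zeta>: "\<zeta> y = ereal (u x) + c x y"
    proof (rule antisym)
      show "ereal (u x) + c x y \<le> \<zeta> y"
        unfolding \<zeta>_def using le by (intro INF_greatest) blast
    qed (rule \<zeta>_le[OF x])
    then have "lower_diff (\<zeta> y) (c x y) = ereal (u x)"
      using fc c[of x y] by (cases "c x y") (auto simp: lower_diff_def)
    then have "\<psi> x = ereal (u x)" using diff_le[of y x] \<psi>_le[OF x] by auto
    then show ?thesis using \<zeta> by simp
  qed
qed

section \<open>Measures with finite support\<close>

text \<open>
  The integrand is arbitrary: on a finite set of points that are measurable singletons, every function
  is a simple function. This applies to costs not known to be Borel measurable.
\<close>

lemma nn_integral_finite_support:
  fixes M :: "'b::t1_space measure"
  assumes "sets M = sets borel" "finite S" "AE z in M. z \<in> S"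
  shows "(\<integral>\<^sup>+z. f z \<partial>M) = (\<Sum>z\<in>S. f z * emeasure M {z})"
proof -
  have "(\<integral>\<^sup>+z. f z \<partial>M) = (\<integral>\<^sup>+z. f z * indicator S z \<partial>M)"
    using assms(3) by (intro nn_integral_cong_AE) (auto elim!: eventually_mono)
  also have "\<dots> = (\<Sum>z\<in>S. f z * emeasure M {z})"
    using assms by (intro nn_integral_indicator_finite) auto
  finally show ?thesis .
qed

lemma emeasure_finite_support:
  fixes M :: "'b::t1_space measure"
  assumes "sets M = sets borel" "finite S" "AE z in M. z \<in> S" "B \<in> sets borel"
  shows "emeasure M B = (\<Sum>z\<in>S. indicator B z * emeasure M {z})"
  using nn_integral_finite_support[OF assms(1-3), of "indicator B"] assms(1,4) by simp

lemma measure_finite_support: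
  fixes M :: "'b::t1_space measure"
  assumes "prob_space M" "sets M = sets borel" "finite S" "AE z in M. z \<in> S" "B \<in> sets borel"
  shows "measure M B = (\<Sum>z\<in>S. indicator B z * measure M {z})"
proof -
  interpret prob_space M by fact
  have "emeasure M B = (\<Sum>z\<in>S. ennreal (indicator B z * measure M {z}))"
    unfolding emeasure_finite_support[OF assms(2-5)]
    by (intro sum.cong) (auto simp: emeasure_eq_measure indicator_def)
  also have "\<dots> = ennreal (\<Sum>z\<in>S. indicator B z * measure M {z})"
    by (intro sum_ennreal) auto
  finally show ?thesis by (simp add: emeasure_eq_measure sum_nonneg)
qed

lemma AE_finite_support:
  fixes M :: "'b::t1_space measure"
  assumes "prob_space M" "sets M = sets borel" "finite S" "AE z in M. z \<in> S"
  shows "(AE z in M. P z) \<longleftrightarrow> (\<forall>z\<in>S. measure M {z} > 0 \<longrightarrow> P z)"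
proof
  interpret prob_space M by fact
  assume P: "AE z in M. P z"
  show "\<forall>z\<in>S. measure M {z} > 0 \<longrightarrow> P z"
  proof (intro ballI impI, rule ccontr)
    fix z assume "measure M {z} > 0" "\<not> P z"
    have "AE x in M. x \<noteq> z" using P by eventually_elim (use \<open>\<not> P z\<close> in auto)
    then have "emeasure M {x \<in> space M. \<not> x \<noteq> z} = 0"
      using assms(2) by (subst (asm) AE_iff_measurable[OF _ refl])
         (auto simp: sets_eq_imp_space_eq[OF assms(2)])
    then show False
      using \<open>measure M {z} > 0\<close> by (simp add: sets_eq_imp_space_eq[OF assms(2)] measure_def)
  qed
next
  interpret prob_space M by fact
  assume P: "\<forall>z\<in>S. measure M {z} > 0 \<longrightarrow> P z"
  have "AE x in M. \<forall>z\<in>{z\<in>S. measure M {z} = 0}. x \<noteq> z"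
  proof (rule AE_finite_allI)
    fix z assume "z \<in> {z\<in>S. measure M {z} = 0}"
    then have "{z} \<in> null_sets M" using assms(2) by (simp add: null_sets_def emeasure_eq_measure)
    from AE_not_in[OF this] show "AE x in M. x \<noteq> z" by eventually_elim simp
  qed (use assms(3) in simp)
  with assms(4) show "AE z in M. P z"
    by eventually_elim (use P in \<open>auto simp: zero_less_measure_iff\<close>)
qed

lemma ereal_integral_finite_support:
  fixes M :: "'b::t1_space measure"
  assumes M: "prob_space M" "sets M = sets borel" "finite S" "AE z in M. z \<in> S"
    and f: "\<And>z. z \<in> S \<Longrightarrow> measure M {z} > 0 \<Longrightarrow> \<bar>f z\<bar> \<noteq> \<infinity>"
  shows "ereal_integral M f = ereal (\<Sum>z\<in>S. real_of_ereal (f z) * measure M {z})"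
proof -
  interpret prob_space M by fact
  have one: "(\<integral>\<^sup>+z. e2ennreal (g z) \<partial>M) = ennreal (\<Sum>z\<in>S. max 0 (real_of_ereal (g z)) * measure M {z})"
    if g: "\<And>z. z \<in> S \<Longrightarrow> measure M {z} > 0 \<Longrightarrow> \<bar>g z\<bar> \<noteq> \<infinity>" for g
  proof -
    have "(\<integral>\<^sup>+z. e2ennreal (g z) \<partial>M) = (\<Sum>z\<in>S. e2ennreal (g z) * emeasure M {z})"
      by (rule nn_integral_finite_support[OF M(2-4)])
    also have "\<dots> = (\<Sum>z\<in>S. ennreal (max 0 (real_of_ereal (g z)) * measure M {z}))"
    proof (rule sum.cong)
      fix z assume z: "z \<in> S"
      show "e2ennreal (g z) * emeasure M {z} = ennreal (max 0 (real_of_ereal (g z)) * measure M {z})"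
      proof (cases "measure M {z} > 0")
        case True
        then obtain r where "g z = ereal r" using g[OF z] by (cases "g z") auto
        then show ?thesis
          by (cases "r \<ge> 0") (auto simp: emeasure_eq_measure ennreal_mult max_def ennreal_neg)
      next
        case False
        then have "measure M {z} = 0" by (simp add: zero_less_measure_iff)
        then show ?thesis by (simp add: emeasure_eq_measure)
      qed
    qed simp
    also have "\<dots> = ennreal (\<Sum>z\<in>S. max 0 (real_of_ereal (g z)) * measure M {z})"
      by (intro sum_ennreal) auto
    finally show ?thesis .
  qed
  have "ereal_integral M f =
      ereal (\<Sum>z\<in>S. max 0 (real_of_ereal (f z)) * measure M {z}) -
      ereal (\<Sum>z\<in>S. max 0 (real_of_ereal (- f z)) * measure M {z})"
    unfolding ereal_integral_def using f
    by (subst (1 2) one) (auto simp: enn2ereal_ennreal sum_nonneg)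
  also have "\<dots> = ereal (\<Sum>z\<in>S. max 0 (real_of_ereal (f z)) * measure M {z} -
      max 0 (real_of_ereal (- f z)) * measure M {z})"
    by (simp add: sum_subtractf)
  also have "\<dots> = ereal (\<Sum>z\<in>S. real_of_ereal (f z) * measure M {z})"
  proof (intro arg_cong[of _ _ ereal] sum.cong)
    fix z assume z: "z \<in> S"
    show "max 0 (real_of_ereal (f z)) * measure M {z} - max 0 (real_of_ereal (- f z)) * measure M {z} =
      real_of_ereal (f z) * measure M {z}"
    proof (cases "measure M {z} > 0")
      case True
      then obtain r where "f z = ereal r" using f[OF z] by (cases "f z") auto
      then show ?thesis by (simp add: max_def)
    qed (simp add: zero_less_measure_iff)
  qed simp
  finally show ?thesis .
qed

lemma ereal_integral_eq_PInf:
  fixes M :: "'b::t1_space measure"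
  assumes M: "sets M = sets borel" and z: "emeasure M {z} \<noteq> 0" "f z = \<infinity>"
  shows "ereal_integral M f = \<infinity>"
proof -
  have "\<infinity> * emeasure M {z} = (\<integral>\<^sup>+x. \<infinity> * indicator {z} x \<partial>M)"
    using M by (simp add: nn_integral_cmult_indicator)
  also have "\<dots> \<le> (\<integral>\<^sup>+x. e2ennreal (f x) \<partial>M)"
    using z by (intro nn_integral_mono) (auto simp: indicator_def)
  finally have "(\<integral>\<^sup>+x. e2ennreal (f x) \<partial>M) = \<infinity>"
    using z by (simp add: ennreal_top_mult top_unique)
  then show ?thesis by (simp add: ereal_integral_def)
qed

text \<open>
  The image under the identity replaces the discrete \<open>\<sigma>\<close>-algebra of \<open>point_measure\<close> on \<open>S\<close> by the Borel
  \<open>\<sigma>\<close>-algebra of the whole space.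
\<close>

definition weight_measure :: "'b set \<Rightarrow> ('b \<Rightarrow> real) \<Rightarrow> 'b::topological_space measure" where
  "weight_measure S q = distr (point_measure S (\<lambda>z. ennreal (q z))) borel (\<lambda>z. z)"

lemma emeasure_weight_measure:
  assumes "finite S" "B \<in> sets borel" "\<And>z. z \<in> S \<Longrightarrow> q z \<ge> 0"
  shows "emeasure (weight_measure S q) B = ennreal (\<Sum>z\<in>S. indicator B z * q z)"
proof -
  have "emeasure (weight_measure S q) B = emeasure (point_measure S (\<lambda>z. ennreal (q z))) (B \<inter> S)"
    unfolding weight_measure_def using assms(2)
    by (subst emeasure_distr) (auto simp: space_point_measure measurable_def sets_point_measure vimage_def)
  also have "\<dots> = (\<Sum>z\<in>B \<inter> S. ennreal (q z))"
    using assms(1) by (intro emeasure_point_measure_finite) auto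
  also have "\<dots> = ennreal (\<Sum>z\<in>B \<inter> S. q z)"
    using assms(3) by (intro sum_ennreal) auto
  also have "(\<Sum>z\<in>B \<inter> S. q z) = (\<Sum>z\<in>S. indicator B z * q z)"
    using assms(1) by (intro sum.mono_neutral_cong_left) (auto simp: indicator_def)
  finally show ?thesis .
qed

lemma weight_measure_props:
  fixes q :: "'b::t1_space \<Rightarrow> real"
  assumes "finite S" "\<And>z. z \<in> S \<Longrightarrow> q z \<ge> 0" "(\<Sum>z\<in>S. q z) = 1"
  shows "borel_prob (weight_measure S q)" "\<And>z. z \<in> S \<Longrightarrow> measure (weight_measure S q) {z} = q z"
    "AE z in weight_measure S q. z \<in> S"
proof -
  have sets: "sets (weight_measure S q) = sets borel" by (simp add: weight_measure_def)
  then have sp: "space (weight_measure S q) = UNIV" using sets_eq_imp_space_eq by fastforce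
  show "borel_prob (weight_measure S q)"
    unfolding borel_prob_def using assms sets sp
    by (auto intro!: prob_spaceI simp: emeasure_weight_measure)
  show "measure (weight_measure S q) {z} = q z" if "z \<in> S" for z
  proof -
    have "(\<Sum>x\<in>S. indicator {z} x * q x) = (\<Sum>x\<in>S. if x = z then q x else 0)"
      by (intro sum.cong) (auto simp: indicator_def)
    also have "\<dots> = q z" using assms(1) that by simp
    finally show ?thesis using assms that
      by (simp add: measure_def emeasure_weight_measure)
  qed
  have "closed S" using assms(1) by (rule finite_imp_closed)
  then have "emeasure (weight_measure S q) (- S) = 0"
    using assms by (subst emeasure_weight_measure) auto
  then have "- S \<in> null_sets (weight_measure S q)"
    using \<open>closed S\<close> by (auto simp: null_sets_def sets)
  from AE_not_in[OF this] show "AE z in weight_measure S q. z \<in> S" by eventually_elim simp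
qed

lemma couplingD:
  fixes \<mu> \<nu> :: "'a::second_countable_topology measure"
  assumes "coupling \<mu> \<nu> \<pi>"
  shows "prob_space \<pi>" "sets \<pi> = sets borel" "space \<pi> = UNIV"
    "fst \<in> \<pi> \<rightarrow>\<^sub>M borel" "snd \<in> \<pi> \<rightarrow>\<^sub>M borel"
    "distr \<pi> borel fst = \<mu>" "distr \<pi> borel snd = \<nu>"
proof -
  show s: "prob_space \<pi>" "sets \<pi> = sets borel" "distr \<pi> borel fst = \<mu>" "distr \<pi> borel snd = \<nu>"
    using assms by (auto simp: coupling_def borel_prob_def)
  show "space \<pi> = UNIV" using sets_eq_imp_space_eq[OF s(2)] by simp
  have "fst \<in> (borel :: ('a \<times> 'a) measure) \<rightarrow>\<^sub>M borel" "snd \<in> (borel :: ('a \<times> 'a) measure) \<rightarrow>\<^sub>M borel"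
    by (auto intro!: borel_measurable_continuous_onI continuous_intros)
  then show "fst \<in> \<pi> \<rightarrow>\<^sub>M borel" "snd \<in> \<pi> \<rightarrow>\<^sub>M borel"
    using measurable_cong_sets[OF s(2) refl] by auto
qed

lemma coupling_AE:
  fixes \<mu> \<nu> :: "'a::{second_countable_topology, t2_space} measure"
  assumes pi: "coupling \<mu> \<nu> \<pi>" and X: "AE x in \<mu>. x \<in> X" and Y: "AE y in \<nu>. y \<in> Y"
  shows "AE z in \<pi>. z \<in> X \<times> Y"
proof -
  note c = couplingD[OF pi]
  have "AE z in \<pi>. fst z \<in> X"
    using X unfolding c(6)[symmetric] by (rule AE_distrD[OF c(4)])
  moreover have "AE z in \<pi>. snd z \<in> Y"
    using Y unfolding c(7)[symmetric] by (rule AE_distrD[OF c(5)])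
  ultimately show ?thesis by eventually_elim (auto simp: mem_Times_iff)
qed

lemma coupling_marginal_sum:
  fixes \<mu> \<nu> :: "'a::{second_countable_topology, t2_space} measure"
  assumes pi: "coupling \<mu> \<nu> \<pi>" and X: "finite X" "AE x in \<mu>. x \<in> X" and Y: "finite Y" "AE y in \<nu>. y \<in> Y"
  shows "(\<Sum>z\<in>X \<times> Y. f (fst z) * measure \<pi> {z}) = (\<Sum>x\<in>X. f x * measure \<mu> {x})"
    and "(\<Sum>z\<in>X \<times> Y. f (snd z) * measure \<pi> {z}) = (\<Sum>y\<in>Y. f y * measure \<nu> {y})"
    and "x \<in> X \<Longrightarrow> measure \<mu> {x} = (\<Sum>y\<in>Y. measure \<pi> {(x, y)})"
    and "y \<in> Y \<Longrightarrow> measure \<nu> {y} = (\<Sum>x\<in>X. measure \<pi> {(x, y)})"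
proof -
  note c = couplingD[OF pi]
  interpret prob_space \<pi> by (rule c(1))
  have sp: "AE z in \<pi>. z \<in> X \<times> Y" by (rule coupling_AE[OF pi X(2) Y(2)])
  have fin: "finite (X \<times> Y)" using X Y by simp
  note meas = measure_finite_support[OF c(1,2) fin sp]
  show mx: "measure \<mu> {x} = (\<Sum>y\<in>Y. measure \<pi> {(x, y)})" if x: "x \<in> X" for x
  proof -
    have "measure \<mu> {x} = measure \<pi> ({x} \<times> UNIV)"
      unfolding c(6)[symmetric] using c(4)
      by (subst measure_distr) (auto simp: c(3) intro!: arg_cong[of _ _ "measure \<pi>"])
    also have "\<dots> = (\<Sum>z\<in>X \<times> Y. indicator ({x} \<times> UNIV) z * measure \<pi> {z})"
      by (intro meas borel_closed closed_Times) auto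
    also have "\<dots> = (\<Sum>z\<in>{x} \<times> Y. measure \<pi> {z})"
      using fin x by (intro sum.mono_neutral_cong_right) (auto simp: indicator_def)
    also have "\<dots> = (\<Sum>y\<in>Y. measure \<pi> {(x, y)})"
      by (simp add: sum.cartesian_product')
    finally show ?thesis .
  qed
  show my: "measure \<nu> {y} = (\<Sum>x\<in>X. measure \<pi> {(x, y)})" if y: "y \<in> Y" for y
  proof -
    have "measure \<nu> {y} = measure \<pi> (UNIV \<times> {y})"
      unfolding c(7)[symmetric] using c(5)
      by (subst measure_distr) (auto simp: c(3) intro!: arg_cong[of _ _ "measure \<pi>"])
    also have "\<dots> = (\<Sum>z\<in>X \<times> Y. indicator (UNIV \<times> {y}) z * measure \<pi> {z})"
      by (intro meas borel_closed closed_Times) auto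
    also have "\<dots> = (\<Sum>z\<in>X \<times> {y}. measure \<pi> {z})"
      using fin y by (intro sum.mono_neutral_cong_right) (auto simp: indicator_def)
    also have "\<dots> = (\<Sum>x\<in>X. measure \<pi> {(x, y)})"
      by (simp add: sum.cartesian_product')
    finally show ?thesis .
  qed
  show "(\<Sum>z\<in>X \<times> Y. f (fst z) * measure \<pi> {z}) = (\<Sum>x\<in>X. f x * measure \<mu> {x})"
    by (simp add: mx sum_distrib_left sum.cartesian_product')
  show "(\<Sum>z\<in>X \<times> Y. f (snd z) * measure \<pi> {z}) = (\<Sum>y\<in>Y. f y * measure \<nu> {y})"
    unfolding sum.cartesian_product' by (subst sum.swap) (simp add: my sum_distrib_left)
qed

section \<open>Kantorovich duality between finitely supported measures\<close>

text \<open>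
  Otherwise moving a small mass \<open>\<epsilon>\<close> from every pair \<open>e\<close> of the cycle to the pair formed by the source of
  the next one and the target of \<open>e\<close> gives a coupling of strictly smaller cost. The pairs of the cycle
  being distinct, each loses \<open>\<epsilon>\<close> only once, so \<open>\<epsilon>\<close> may be the least mass that \<open>\<pi>\<close> gives to a pair it charges.
\<close>

lemma optimal_coupling_cyclic:
  fixes c :: "'a::{second_countable_topology, t2_space} \<Rightarrow> 'a \<Rightarrow> ereal"
  assumes opt: "optimal_coupling c \<mu> \<nu> \<pi>"
    and X: "finite X" "AE x in \<mu>. x \<in> X" and Y: "finite Y" "AE y in \<nu>. y \<in> Y"
    and c: "\<And>x y. c x y \<noteq> -\<infinity>"
  defines "\<Gamma> \<equiv> {z \<in> X \<times> Y. measure \<pi> {z} > 0}"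
  assumes c\<Gamma>: "\<And>x y. (x, y) \<in> \<Gamma> \<Longrightarrow> c x y \<noteq> \<infinity>"
    and es: "distinct (e # es)" "set (e # es) \<subseteq> \<Gamma>"
  shows "path_sum (shift_cost c) (e # es @ [e]) \<ge> 0"
proof (rule ccontr)
  let ?P = "e # es @ [e]"
  let ?S = "X \<times> Y"
  assume "\<not> 0 \<le> path_sum (shift_cost c) ?P"
  then have neg: "path_sum (shift_cost c) ?P < 0" by simp
  have P\<Gamma>: "set ?P \<subseteq> \<Gamma>" using es by auto
  have finS: "finite ?S" using X Y by simp
  have \<Gamma>S: "\<Gamma> \<subseteq> ?S" by (auto simp: \<Gamma>_def)
  have w: "shift_cost c a b \<noteq> -\<infinity>" if "a \<in> set ?P" "b \<in> set ?P" for a b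
    using c[of "fst b" "snd a"] c\<Gamma>[of "fst a" "snd a"] c[of "fst a" "snd a"] that P\<Gamma>
    by (cases "c (fst b) (snd a)"; cases "c (fst a) (snd a)") (auto simp: shift_cost_def)
  define cr where "cr z = real_of_ereal (c (fst z) (snd z))" for z
  define W where "W = path_sum (\<lambda>a b. real_of_ereal (shift_cost c a b)) ?P"
  have not_inf: "path_sum (shift_cost c) ?P \<noteq> \<infinity>" 
  proof
    assume "path_sum (shift_cost c) ?P = \<infinity>"
    with neg have "(\<infinity> :: ereal) < 0" by metis
    then show False by simp
  qed
  have W: "path_sum (shift_cost c) ?P = ereal W"
    unfolding W_def using w not_inf by (rule path_sum_ereal_finite)
  have W_neg: "W < 0" using W neg by simp
  have fin_step: "\<forall>(a, b)\<in>set (zip ?P (tl ?P)). shift_cost c a b \<noteq> \<infinity>" 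
    using w not_inf by (rule path_sum_ereal_finite)
  have c_step: "c (fst b) (snd a) \<noteq> \<infinity>" if "(a, b) \<in> set (zip ?P (tl ?P))" for a b
  proof -
    have "a \<in> \<Gamma>" using that P\<Gamma> by (meson set_zip_leftD subsetD)
    then show ?thesis using fin_step that c[of "fst a" "snd a"] c\<Gamma>[of "fst a" "snd a"]
      by (cases "c (fst a) (snd a)") (auto simp: shift_cost_def)
  qed
  have W_alt: "W = path_sum (\<lambda>a b. cr (fst b, snd a) - cr a) ?P"
    unfolding W_def
  proof (rule path_sum_cong)
    fix a b assume ab: "(a, b) \<in> set (zip ?P (tl ?P))"
    then have "a \<in> \<Gamma>" using P\<Gamma> by (meson set_zip_leftD subsetD)
    then show "real_of_ereal (shift_cost c a b) = cr (fst b, snd a) - cr a"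
      using c_step[OF ab] c[of "fst b" "snd a"] c[of "fst a" "snd a"] c\<Gamma>[of "fst a" "snd a"]
      by (cases "c (fst b) (snd a)"; cases "c (fst a) (snd a)") (auto simp: shift_cost_def cr_def)
  qed
  define q where "q z = measure \<pi> {z}" for z
  define \<epsilon> where "\<epsilon> = Min (q ` \<Gamma>)"
  have fin\<Gamma>: "finite \<Gamma>" using finS \<Gamma>S finite_subset by blast
  have "e \<in> \<Gamma>" using es by simp
  have \<epsilon>: "\<epsilon> > 0" unfolding \<epsilon>_def using fin\<Gamma> \<open>e \<in> \<Gamma>\<close> by (subst Min_gr_iff) (auto simp: \<Gamma>_def q_def)
  have \<epsilon>_le: "\<epsilon> \<le> q z" if "z \<in> \<Gamma>" for z unfolding \<epsilon>_def using fin\<Gamma> that by simp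
  define gain :: "'a \<times> 'a \<Rightarrow> real" where "gain z = path_sum (\<lambda>a b. of_bool (z = (fst b, snd a))) ?P" for z
  define loss :: "'a \<times> 'a \<Rightarrow> real" where "loss z = path_sum (\<lambda>a b. of_bool (z = a)) ?P" for z
  define q' where "q' z = q z + \<epsilon> * (gain z - loss z)" for z
  have loss: "loss z = of_bool (z \<in> set (e # es))" for z
  proof -
    have "loss z = sum_list (map (\<lambda>a. of_bool (z = a)) (e # es))"
      unfolding loss_def using path_sum_source[of "\<lambda>a. of_bool (z = a)" "e # es" e] by simp
    also have "\<dots> = (\<Sum>a\<in>set (e # es). of_bool (z = a))"
      using es(1) by (rule sum_list_distinct_conv_sum_set)
    also have "\<dots> = (\<Sum>a\<in>set (e # es). if z = a then 1 else 0)"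
      by (intro sum.cong) auto
    also have "\<dots> = of_bool (z \<in> set (e # es))" by (subst sum.delta') auto
    finally show ?thesis .
  qed
  have gain: "gain z \<ge> 0" for z unfolding gain_def by (intro path_sum_nonneg) simp
  have q'_nonneg: "q' z \<ge> 0" for z
  proof -
    have "\<epsilon> * loss z \<le> q z"
      using \<epsilon>_le[of z] es(2) by (cases "z \<in> set (e # es)") (auto simp: loss q_def)
    moreover have "\<epsilon> * gain z \<ge> 0" using gain \<epsilon> by simp
    ultimately show ?thesis by (simp add: q'_def algebra_simps)
  qed
  \<comment> \<open>the effect of the rerouting on an arbitrary linear functional: marginals and cost are instances\<close>
  have lin: "(\<Sum>z\<in>?S. f z * q' z) = (\<Sum>z\<in>?S. f z * q z) + \<epsilon> * path_sum (\<lambda>a b. f (fst b, snd a) - f a) ?P"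
    for f :: "'a \<times> 'a \<Rightarrow> real"
  proof -
    have aux: "(\<Sum>z\<in>?S. f z * path_sum (\<lambda>a b. of_bool (z = h a b)) ?P) = path_sum (\<lambda>a b. f (h a b)) ?P"
      if h: "\<And>a b. a \<in> \<Gamma> \<Longrightarrow> b \<in> \<Gamma> \<Longrightarrow> h a b \<in> ?S" for h
    proof -
      have "(\<Sum>z\<in>?S. f z * path_sum (\<lambda>a b. of_bool (z = h a b)) ?P) =
          path_sum (\<lambda>a b. \<Sum>z\<in>?S. f z * of_bool (z = h a b)) ?P"
        by (simp only: path_sum_cmult[symmetric] path_sum_sum)
      also have "\<dots> = path_sum (\<lambda>a b. f (h a b)) ?P"
      proof (rule path_sum_cong)
        fix a b assume ab: "(a, b) \<in> set (zip ?P (tl ?P))"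
        have "a \<in> set ?P" using ab by (rule set_zip_leftD)
        moreover have "b \<in> set ?P" using set_zip_rightD[OF ab] by simp
        ultimately have "h a b \<in> ?S" using P\<Gamma> by (intro h) auto
        have "(\<Sum>z\<in>?S. f z * of_bool (z = h a b)) = (\<Sum>z\<in>?S. if z = h a b then f z else 0)"
          by (intro sum.cong) auto
        also have "\<dots> = f (h a b)" using finS \<open>h a b \<in> ?S\<close> by (simp add: sum.delta)
        finally show "(\<Sum>z\<in>?S. f z * of_bool (z = h a b)) = f (h a b)" .
      qed
      finally show ?thesis .
    qed
    have "(\<Sum>z\<in>?S. f z * q' z) = (\<Sum>z\<in>?S. f z * q z) +
        \<epsilon> * ((\<Sum>z\<in>?S. f z * gain z) - (\<Sum>z\<in>?S. f z * loss z))"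
      by (simp add: q'_def algebra_simps sum.distrib sum_subtractf sum_distrib_left)
    also have "(\<Sum>z\<in>?S. f z * gain z) = path_sum (\<lambda>a b. f (fst b, snd a)) ?P"
      unfolding gain_def using \<Gamma>S by (intro aux) auto
    also have "(\<Sum>z\<in>?S. f z * loss z) = path_sum (\<lambda>a b. f a) ?P"
      unfolding loss_def using \<Gamma>S by (intro aux) auto
    finally show ?thesis by (simp only: path_sum_diff)
  qed
  have fst_inv: "(\<Sum>z\<in>?S. f (fst z) * q' z) = (\<Sum>z\<in>?S. f (fst z) * q z)" for f :: "'a \<Rightarrow> real"
    using lin[of "\<lambda>z. f (fst z)"] path_sum_telescope[of "\<lambda>a. f (fst a)" e "es @ [e]"] by simp
  have snd_inv: "(\<Sum>z\<in>?S. f (snd z) * q' z) = (\<Sum>z\<in>?S. f (snd z) * q z)" for f :: "'a \<Rightarrow> real"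
    using lin[of "\<lambda>z. f (snd z)"] by (simp add: path_sum_0)
  have pi: "coupling \<mu> \<nu> \<pi>" using opt by (simp add: optimal_coupling_def)
  note cp = couplingD[OF pi]
  interpret prob_space \<pi> by (rule cp(1))
  have sp: "AE z in \<pi>. z \<in> ?S" by (rule coupling_AE[OF pi X(2) Y(2)])
  have em: "emeasure \<pi> B = ennreal (\<Sum>z\<in>?S. indicator B z * q z)" if "B \<in> sets borel" for B
    using measure_finite_support[OF cp(1,2) finS sp that] by (simp add: emeasure_eq_measure q_def)
  have "(\<Sum>z\<in>?S. q z) = 1"
    using em[of UNIV] emeasure_space_1 cp(3) by (simp add: q_def sum_nonneg)
  then have tot: "(\<Sum>z\<in>?S. q' z) = 1" using fst_inv[of "\<lambda>_. 1"] by simp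
  let ?pi = "weight_measure ?S q'"
  note wm = weight_measure_props[OF finS q'_nonneg tot]
  have sets': "sets ?pi = sets borel" using wm(1) by (simp add: borel_prob_def)
  have space': "space ?pi = UNIV" using sets_eq_imp_space_eq[OF sets'] by simp
  have marg: "distr ?pi borel p = distr \<pi> borel p"
    if p: "p \<in> borel \<rightarrow>\<^sub>M borel" and inv: "\<And>f :: 'a \<Rightarrow> real. (\<Sum>z\<in>?S. f (p z) * q' z) = (\<Sum>z\<in>?S. f (p z) * q z)"
    for p :: "'a \<times> 'a \<Rightarrow> 'a"
  proof (rule measure_eqI)
    fix B assume "B \<in> sets (distr ?pi borel p)"
    then have B: "B \<in> sets borel" by simp
    have pB: "p -` B \<in> sets borel" using measurable_sets[OF p B] by simp
    have "emeasure (distr ?pi borel p) B = emeasure ?pi (p -` B)"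
      using p B measurable_cong_sets[OF sets' refl] by (subst emeasure_distr) (auto simp: space')
    also have "\<dots> = ennreal (\<Sum>z\<in>?S. indicator B (p z) * q' z)"
      using emeasure_weight_measure[OF finS pB, of q'] q'_nonneg by (simp add: indicator_vimage)
    also have "\<dots> = ennreal (\<Sum>z\<in>?S. indicator B (p z) * q z)"
      using inv[of "indicator B"] by simp
    also have "\<dots> = emeasure \<pi> (p -` B)"
      using em[OF pB] by (simp add: indicator_vimage)
    also have "\<dots> = emeasure (distr \<pi> borel p) B"
      using p B measurable_cong_sets[OF cp(2) refl] by (subst emeasure_distr) (auto simp: cp(3))
    finally show "emeasure (distr ?pi borel p) B = emeasure (distr \<pi> borel p) B" .
  qed simp
  have "distr ?pi borel fst = distr \<pi> borel fst" "distr ?pi borel snd = distr \<pi> borel snd"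
    using fst_inv snd_inv
    by (auto intro!: marg borel_measurable_continuous_onI continuous_intros)
  then have pi': "coupling \<mu> \<nu> ?pi"
    using wm(1) cp(6,7) by (simp add: coupling_def)
  have fin': "\<bar>c (fst z) (snd z)\<bar> \<noteq> \<infinity>" if z: "z \<in> ?S" "measure ?pi {z} > 0" for z
  proof (cases "q z > 0")
    case True
    then have "(fst z, snd z) \<in> \<Gamma>" using z by (simp add: \<Gamma>_def q_def)
    then show ?thesis using c\<Gamma> c[of "fst z" "snd z"] by (cases "c (fst z) (snd z)") auto
  next
    case False
    then have "q z = 0" by (simp add: q_def zero_less_measure_iff)
    have "gain z \<noteq> 0"
    proof
      assume "gain z = 0"
      then have "q' z \<le> 0" using \<open>q z = 0\<close> \<epsilon> by (simp add: q'_def loss)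
      then show False using z wm(2) by simp
    qed
    have "\<exists>(a, b)\<in>set (zip ?P (tl ?P)). z = (fst b, snd a)"
    proof (rule ccontr)
      assume "\<not> ?thesis"
      then have "gain z = path_sum (\<lambda>a b. 0) ?P"
        unfolding gain_def by (intro path_sum_cong) auto
      then show False using \<open>gain z \<noteq> 0\<close> by (simp add: path_sum_0)
    qed
    then show ?thesis using c_step c[of "fst z" "snd z"] by (cases "c (fst z) (snd z)") fastforce+
  qed
  have "ereal_integral ?pi (\<lambda>(x, y). c x y) = ereal (\<Sum>z\<in>?S. cr z * q' z)"
    using ereal_integral_finite_support[OF _ sets' finS wm(3), of "\<lambda>(x, y). c x y"] wm(1) fin'
    by (auto simp: cr_def case_prod_unfold borel_prob_def wm(2) intro!: sum.cong)
  moreover have "ereal_integral \<pi> (\<lambda>(x, y). c x y) = ereal (\<Sum>z\<in>?S. cr z * q z)"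
  proof -
    have "\<bar>c (fst z) (snd z)\<bar> \<noteq> \<infinity>" if "z \<in> ?S" "measure \<pi> {z} > 0" for z
      using c[of "fst z" "snd z"] c\<Gamma>[of "fst z" "snd z"] that
      by (cases "c (fst z) (snd z)") (auto simp: \<Gamma>_def)
    then show ?thesis
      using ereal_integral_finite_support[OF cp(1,2) finS sp, of "\<lambda>(x, y). c x y"]
      by (simp add: cr_def q_def case_prod_unfold)
  qed
  moreover have "ereal_integral \<pi> (\<lambda>(x, y). c x y) \<le> ereal_integral ?pi (\<lambda>(x, y). c x y)"
    using opt pi' by (simp add: optimal_coupling_def)
  moreover have "(\<Sum>z\<in>?S. cr z * q' z) = (\<Sum>z\<in>?S. cr z * q z) + \<epsilon> * W"
    using lin[of cr] by (simp add: W_alt)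
  moreover have "\<epsilon> * W < 0" using \<epsilon> W_neg by (simp add: mult_pos_neg)
  ultimately show False by simp
qed

text \<open>
  If there is no optimal coupling, the potential \<open>u = 0\<close> already gives a solution. Otherwise \<open>u\<close> comes
  from one optimal coupling \<open>\<pi>\<close>. For any other one, \<open>\<pi>'\<close>, the nonnegative defect
  \<open>c x y + \<psi> x - \<zeta> y\<close> has the same integral as for \<open>\<pi>\<close>, namely zero.
\<close>

theorem finite_dkp_solution:
  fixes c :: "'a::{second_countable_topology, t2_space} \<Rightarrow> 'a \<Rightarrow> ereal"
  assumes \<mu>: "borel_prob \<mu>" and X: "finite X" "AE x in \<mu>. x \<in> X" and Y: "finite Y" "AE y in \<nu>. y \<in> Y"
    and c: "\<And>x y. c x y \<noteq> -\<infinity>" and c_refl: "\<And>x. c x x \<noteq> \<infinity>"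
    and \<pi>0: "coupling \<mu> \<nu> \<pi>0" "AE (x, y) in \<pi>0. c x y \<noteq> \<infinity>"
  shows "\<exists>\<psi>. dkp_solution c \<mu> \<nu> \<psi>"
proof -
  let ?S = "X \<times> Y"
  let ?c = "\<lambda>(x, y). c x y"
  have finS: "finite ?S" using X Y by simp
  define X' where "X' = {x \<in> X. measure \<mu> {x} > 0}"
  have \<mu>': "prob_space \<mu>" "sets \<mu> = sets borel" using \<mu> by (auto simp: borel_prob_def)
  have aeX: "AE x in \<mu>. x \<in> X'"
    by (subst AE_finite_support[OF \<mu>' X]) (auto simp: X'_def)
  have X': "finite X'" "X' \<noteq> {}"
  proof -
    show "finite X'" using X by (simp add: X'_def)
    show "X' \<noteq> {}"
    proof
      assume "X' = {}"
      then have "AE x in \<mu>. False" using aeX by simp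
      then show False using prob_space.AE_False[OF \<mu>'(1)] by simp
    qed
  qed
  define cr where "cr z = real_of_ereal (c (fst z) (snd z))" for z
  have opt_fin: "c x y \<noteq> \<infinity>" if opt: "optimal_coupling c \<mu> \<nu> \<pi>" and z: "(x, y) \<in> ?S" "measure \<pi> {(x, y)} > 0" for \<pi> x y
  proof
    assume "c x y = \<infinity>"
    have pi: "coupling \<mu> \<nu> \<pi>" using opt by (simp add: optimal_coupling_def)
    have "emeasure \<pi> {(x, y)} \<noteq> 0" using z(2) by (auto simp: measure_def)
    then have "ereal_integral \<pi> ?c = \<infinity>"
      using \<open>c x y = \<infinity>\<close> couplingD(2)[OF pi] by (intro ereal_integral_eq_PInf[where z="(x, y)"]) auto
    moreover have "ereal_integral \<pi> ?c \<le> ereal_integral \<pi>0 ?c"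
      using opt \<pi>0 by (simp add: optimal_coupling_def)
    moreover have "ereal_integral \<pi>0 ?c \<noteq> \<infinity>"
    proof -
      note c0 = couplingD[OF \<pi>0(1)] and sp = coupling_AE[OF \<pi>0(1) X(2) Y(2)]
      have "\<forall>z\<in>?S. measure \<pi>0 {z} > 0 \<longrightarrow> ?c z \<noteq> \<infinity>"
        using \<pi>0(2) AE_finite_support[OF c0(1,2) finS sp, of "\<lambda>z. ?c z \<noteq> \<infinity>"] by (simp add: case_prod_unfold)
      then show ?thesis
        using c by (subst ereal_integral_finite_support[OF c0(1,2) finS sp]) (auto split: prod.splits)
    qed
    ultimately show False by simp
  qed
  show ?thesis
  proof (cases "\<exists>\<pi>. optimal_coupling c \<mu> \<nu> \<pi>")
    case False
    define u :: "'a \<Rightarrow> real" where "u x = 0" for x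
    define \<psi> where "\<psi> x = (SUP y. lower_diff (INF x\<in>X'. ereal (u x) + c x y) (c x y))" for x
    note cc = c_convex_from_finite[where c = c and u = u, OF X' c c_refl, folded \<psi>_def]
    have "AE x in \<mu>. \<bar>\<psi> x\<bar> \<noteq> \<infinity>"
    proof (rule eventually_mono[OF aeX])
      fix x assume "x \<in> X'"
      then show "\<bar>\<psi> x\<bar> \<noteq> \<infinity>" using cc(2)[of x] cc(3)[of x] by (cases "\<psi> x") auto
    qed
    then have "dkp_solution c \<mu> \<nu> \<psi>"
      using False cc(1) by (auto simp: dkp_solution_def)
    then show ?thesis by blast
  next
    case True
    then obtain \<pi> where opt: "optimal_coupling c \<mu> \<nu> \<pi>" by blast
    then have pi: "coupling \<mu> \<nu> \<pi>" by (simp add: optimal_coupling_def)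
    define \<Gamma> where "\<Gamma> = {z \<in> ?S. measure \<pi> {z} > 0}"
    have fin\<Gamma>: "finite \<Gamma>" using finS by (simp add: \<Gamma>_def)
    have c\<Gamma>: "c x y \<noteq> \<infinity>" if "(x, y) \<in> \<Gamma>" for x y using opt_fin[OF opt] that by (auto simp: \<Gamma>_def)
    have cyc: "path_sum (shift_cost c) (e # es @ [e]) \<ge> 0" if "distinct (e # es)" "set (e # es) \<subseteq> \<Gamma>" for e es
      using optimal_coupling_cyclic[OF opt X Y c, of e es] c\<Gamma> that unfolding \<Gamma>_def by blast
    obtain u :: "'a \<Rightarrow> real" where u: "\<forall>(x, y)\<in>\<Gamma>. \<forall>x'\<in>fst ` \<Gamma>. ereal (u x) + c x y \<le> ereal (u x') + c x' y"
      using rockafellar_potential[OF fin\<Gamma> c c\<Gamma> cyc] .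
    have mX: "x \<in> X' \<longleftrightarrow> (\<exists>y. (x, y) \<in> \<Gamma>)" for x
    proof
      assume "x \<in> X'"
      then have x: "x \<in> X" "(\<Sum>y\<in>Y. measure \<pi> {(x, y)}) > 0"
        using coupling_marginal_sum(3)[OF pi X Y, of x] by (auto simp: X'_def)
      then have "\<not> (\<forall>y\<in>Y. measure \<pi> {(x, y)} = 0)" using sum.neutral by fastforce
      then show "\<exists>y. (x, y) \<in> \<Gamma>" using x(1) by (auto simp: \<Gamma>_def zero_less_measure_iff)
    next
      assume "\<exists>y. (x, y) \<in> \<Gamma>"
      then obtain y where y: "x \<in> X" "y \<in> Y" "measure \<pi> {(x, y)} > 0" by (auto simp: \<Gamma>_def)
      then have "(\<Sum>y\<in>Y. measure \<pi> {(x, y)}) > 0" using Y(1) by (intro sum_pos2[of Y y]) auto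
      then show "x \<in> X'" using y(1) coupling_marginal_sum(3)[OF pi X Y, of x] by (simp add: X'_def)
    qed
    then have fst\<Gamma>: "fst ` \<Gamma> = X'" by force
    define \<psi> where "\<psi> x = (SUP y. lower_diff (INF x\<in>X'. ereal (u x) + c x y) (c x y))" for x
    define \<zeta> where "\<zeta> = c_transform c \<psi>"
    note cc = c_convex_from_finite[where c = c and u = u, OF X' c c_refl, folded \<psi>_def]
    have \<Gamma>: "\<psi> x = ereal (u x) \<and> \<zeta> y = ereal (u x) + c x y" if "(x, y) \<in> \<Gamma>" for x y
      using cc(5)[of x y] cc(4) c\<Gamma>[OF that] u that mX[of x] unfolding fst\<Gamma> \<zeta>_def by fastforce
    have \<psi>_fin: "\<bar>\<psi> x\<bar> \<noteq> \<infinity>" if "x \<in> X'" for x using \<Gamma> mX that by fastforce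
    have ae: "AE x in \<mu>. \<bar>\<psi> x\<bar> \<noteq> \<infinity>"
      using aeX by eventually_elim (rule \<psi>_fin)
    \<comment> \<open>the defect in the duality inequality\<close>
    define g where "g z = cr z + real_of_ereal (\<psi> (fst z)) - real_of_ereal (\<zeta> (snd z))" for z
    have "AE (x, y) in \<pi>'. \<zeta> y - \<psi> x = c x y" if opt': "optimal_coupling c \<mu> \<nu> \<pi>'" for \<pi>'
    proof -
      have pi': "coupling \<mu> \<nu> \<pi>'" using opt' by (simp add: optimal_coupling_def)
      note c' = couplingD[OF pi'] and sp' = coupling_AE[OF pi' X(2) Y(2)]
      note cp = couplingD[OF pi] and sp = coupling_AE[OF pi X(2) Y(2)]
      have int: "ereal_integral \<rho> ?c = ereal (\<Sum>z\<in>?S. cr z * measure \<rho> {z})"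
        if r: "optimal_coupling c \<mu> \<nu> \<rho>" for \<rho>
      proof -
        have co: "coupling \<mu> \<nu> \<rho>" using r by (simp add: optimal_coupling_def)
        have "\<bar>?c z\<bar> \<noteq> \<infinity>" if "z \<in> ?S" "measure \<rho> {z} > 0" for z
          using opt_fin[OF r, of "fst z" "snd z"] c[of "fst z" "snd z"] that by (auto simp: case_prod_unfold)
        then show ?thesis
          using ereal_integral_finite_support[OF couplingD(1,2)[OF co] finS coupling_AE[OF co X(2) Y(2)], of ?c]
          by (simp add: cr_def case_prod_unfold)
      qed
      have "ereal_integral \<pi> ?c = ereal_integral \<pi>' ?c"
        using opt opt' pi pi' by (auto simp: optimal_coupling_def intro: antisym)
      then have cost_eq: "(\<Sum>z\<in>?S. cr z * measure \<pi> {z}) = (\<Sum>z\<in>?S. cr z * measure \<pi>' {z})"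
        by (simp add: int[OF opt] int[OF opt'])
      have split: "(\<Sum>z\<in>?S. g z * measure \<rho> {z}) = (\<Sum>z\<in>?S. cr z * measure \<rho> {z}) +
          (\<Sum>x\<in>X. real_of_ereal (\<psi> x) * measure \<mu> {x}) - (\<Sum>y\<in>Y. real_of_ereal (\<zeta> y) * measure \<nu> {y})"
        if "coupling \<mu> \<nu> \<rho>" for \<rho>
        using coupling_marginal_sum(1)[OF that X Y, of "\<lambda>x. real_of_ereal (\<psi> x)"]
          coupling_marginal_sum(2)[OF that X Y, of "\<lambda>y. real_of_ereal (\<zeta> y)"]
        by (simp add: g_def algebra_simps sum.distrib sum_subtractf)
      have "(\<Sum>z\<in>?S. g z * measure \<pi> {z}) = 0"
      proof (rule sum.neutral, rule ballI)
        fix z assume z: "z \<in> ?S"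
        show "g z * measure \<pi> {z} = 0"
        proof (cases "measure \<pi> {z} > 0")
          case True
          then have "z \<in> \<Gamma>" using z by (simp add: \<Gamma>_def)
          then show ?thesis using \<Gamma>[of "fst z" "snd z"] c\<Gamma>[of "fst z" "snd z"] c[of "fst z" "snd z"]
            by (cases "c (fst z) (snd z)") (auto simp: g_def cr_def)
        qed (simp add: zero_less_measure_iff)
      qed
      then have zero: "(\<Sum>z\<in>?S. g z * measure \<pi>' {z}) = 0"
        using split[OF pi] split[OF pi'] cost_eq by simp
      have val: "(\<exists>r s t. \<psi> (fst z) = ereal r \<and> \<zeta> (snd z) = ereal s \<and> c (fst z) (snd z) = ereal t) \<and> g z \<ge> 0"
        if z: "z \<in> ?S" "measure \<pi>' {z} > 0" for z
      proof -
        obtain x y where xy: "z = (x, y)" "x \<in> X" "y \<in> Y" using z(1) by blast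
        have "(\<Sum>y\<in>Y. measure \<pi>' {(x, y)}) > 0" "(\<Sum>x\<in>X. measure \<pi>' {(x, y)}) > 0"
          using X(1) Y(1) xy z(2) by (auto intro!: sum_pos2[of Y y] sum_pos2[of X x])
        then have "measure \<mu> {x} > 0" and "measure \<nu> {y} > 0"
          using coupling_marginal_sum(3,4)[OF pi' X Y] xy by auto
        then have "x \<in> X'" "(\<Sum>x\<in>X. measure \<pi> {(x, y)}) > 0"
          using coupling_marginal_sum(4)[OF pi X Y] xy by (auto simp: X'_def)
        then have "\<not> (\<forall>x\<in>X. measure \<pi> {(x, y)} = 0)" using sum.neutral by fastforce
        then obtain x1 where x1: "(x1, y) \<in> \<Gamma>" using xy(3) by (auto simp: \<Gamma>_def zero_less_measure_iff)
        then have "\<bar>\<zeta> y\<bar> \<noteq> \<infinity>"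
          using \<Gamma>[OF x1] c\<Gamma>[OF x1] c[of x1 y] by (cases "c x1 y") auto
        then obtain s where s: "\<zeta> y = ereal s" by (cases "\<zeta> y") auto
        obtain r where r: "\<psi> x = ereal r" using \<psi>_fin[OF \<open>x \<in> X'\<close>] by (cases "\<psi> x") auto
        obtain t where t: "c x y = ereal t"
          using opt_fin[OF opt', of x y] z xy c[of x y] by (cases "c x y") auto
        have "\<zeta> y \<le> \<psi> x + c x y" unfolding \<zeta>_def c_transform_def by (intro INF_lower) simp
        then show ?thesis using r s t xy by (simp add: g_def cr_def)
      qed
      have nn: "g z * measure \<pi>' {z} \<ge> 0" if "z \<in> ?S" for z
        using val[OF that] by (cases "measure \<pi>' {z} > 0") (auto simp: zero_less_measure_iff)
      have "\<forall>z\<in>?S. g z * measure \<pi>' {z} = 0"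
        using zero nn by (subst (asm) sum_nonneg_eq_0_iff[OF finS]) auto
      then have "\<forall>z\<in>?S. measure \<pi>' {z} > 0 \<longrightarrow> \<zeta> (snd z) - \<psi> (fst z) = c (fst z) (snd z)"
        using val by (fastforce simp: g_def cr_def)
      then show ?thesis
        using AE_finite_support[OF c'(1,2) finS sp', of "\<lambda>z. \<zeta> (snd z) - \<psi> (fst z) = c (fst z) (snd z)"]
        by (simp add: case_prod_unfold)
    qed
    then have "dkp_solution c \<mu> \<nu> \<psi>"
      using cc(1) ae by (auto simp: dkp_solution_def \<zeta>_def)
    then show ?thesis by blast
  qed
qed

section \<open>Approximation by finitely supported couplings\<close>

text \<open>
  The set \<open>code n p\<close> records which of the first \<open>n\<close> base sets contain \<open>p\<close>, so the fibres of \<open>code n\<close> are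
  the cells of a finite Borel partition. A base set containing a point \<open>p\<close> of \<open>J\<close> contains its
  representative \<open>T n p\<close> too for all large \<open>n\<close>, and base sets form arbitrarily small neighbourhoods.
\<close>

lemma discretisation_maps:
  fixes J :: "'b::{second_countable_topology, t2_space} set"
  assumes "J \<noteq> {}"
  obtains T :: "nat \<Rightarrow> 'b \<Rightarrow> 'b"
  where "\<forall>n. T n \<in> borel \<rightarrow>\<^sub>M borel" "\<forall>n. finite (range (T n))" "\<forall>n p. T n p \<in> J"
    "\<forall>p\<in>J. (\<lambda>n. T n p) \<longlonglongrightarrow> p"
proof -
  obtain \<B> :: "'b set set" where B: "countable \<B>" "topological_basis \<B>"
    using ex_countable_basis by blast
  have "\<B> \<noteq> {}" 
    using B(2) topological_basisE[OF B(2) open_UNIV, of undefined] by blast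
  define U where "U = from_nat_into \<B>"
  have rangeU: "range U = \<B>" using B(1) \<open>\<B> \<noteq> {}\<close> by (simp add: U_def range_from_nat_into)
  have openU: "open (U i)" for i using B(2) rangeU topological_basis_open by blast
  define code where "code n p = {i. i < n \<and> p \<in> U i}" for n :: nat and p
  \<comment> \<open>cells that miss \<open>J\<close> are sent to an arbitrary point of \<open>J\<close>\<close>
  define h where "h n S = (if \<exists>q\<in>J. code n q = S then SOME q. q \<in> J \<and> code n q = S else (SOME q. q \<in> J))" for n S
  define T where "T n = h n \<circ> code n" for n
  have hJ: "h n S \<in> J" for n S
  proof (cases "\<exists>q\<in>J. code n q = S")
    case True
    then have "\<exists>q. q \<in> J \<and> code n q = S" by blast
    from someI_ex[OF this] show ?thesis using True by (simp add: h_def)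
  next
    case False
    have "\<exists>q. q \<in> J" using assms by blast
    from someI_ex[OF this] show ?thesis using False by (simp add: h_def)
  qed
  have code_T: "code n (T n p) = code n p" if "p \<in> J" for n p
  proof -
    have ex: "\<exists>q. q \<in> J \<and> code n q = code n p" using that by blast
    have "T n p = (SOME q. q \<in> J \<and> code n q = code n p)" using that by (auto simp: T_def h_def)
    then show ?thesis using someI_ex[OF ex] by simp
  qed
  have "T n \<in> borel \<rightarrow>\<^sub>M borel" for n
    unfolding T_def
  proof (rule measurable_comp)
    show "h n \<in> count_space (Pow {..<n}) \<rightarrow>\<^sub>M borel" by simp
    have "code n -` {S} \<in> sets borel" for S
    proof (cases "S \<subseteq> {..<n}")
      case True
      have "code n -` {S} = (\<Inter>i\<in>S. U i) \<inter> (\<Inter>i\<in>{..<n} - S. - U i)"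
        using True by (auto simp: code_def set_eq_iff)
      moreover have "finite S" using True finite_subset by blast
      then have "(\<Inter>i\<in>S. U i) \<in> sets borel" using openU by (cases "S = {}") (auto intro!: borel_open open_INT)
      moreover have "(\<Inter>i\<in>{..<n} - S. - U i) \<in> sets borel"
        using openU by (intro borel_closed closed_INT) auto
      ultimately show ?thesis by auto
    next
      case False
      then have "code n -` {S} = {}" by (auto simp: code_def)
      then show ?thesis by simp
    qed
    then show "code n \<in> borel \<rightarrow>\<^sub>M count_space (Pow {..<n})"
      by (subst measurable_count_space_eq2) (auto simp: code_def)
  qed
  moreover have "finite (range (T n))" for n
  proof (rule finite_subset)
    show "range (T n) \<subseteq> h n ` Pow {..<n}" by (auto simp: T_def code_def)
  qed simp
  moreover have "T n p \<in> J" for n p using hJ by (simp add: T_def)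
  moreover have "(\<lambda>n. T n p) \<longlonglongrightarrow> p" if p: "p \<in> J" for p
  proof (rule topological_tendstoI)
    fix W assume "open W" "p \<in> W"
    then obtain k where k: "p \<in> U k" "U k \<subseteq> W"
      using topological_basisE[OF B(2), of W p] rangeU by blast
    have "T n p \<in> W" if "n > k" for n
    proof -
      have "k \<in> code n p" using k(1) that by (simp add: code_def)
      then have "k \<in> code n (T n p)" using code_T[OF p] by simp
      then show ?thesis using k(2) by (auto simp: code_def)
    qed
    then show "eventually (\<lambda>n. T n p \<in> W) sequentially"
      unfolding eventually_sequentially by (meson Suc_le_lessD)
  qed
  ultimately show thesis using that by blast
qed

lemma weakly_converges_distr:
  fixes X :: "nat \<Rightarrow> 'b \<Rightarrow> 'a::topological_space"
  assumes "prob_space M" and meas: "\<And>n. X n \<in> M \<rightarrow>\<^sub>M borel" "Y \<in> M \<rightarrow>\<^sub>M borel"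
    and lim: "AE z in M. (\<lambda>n. X n z) \<longlonglongrightarrow> Y z"
  shows "weakly_converges (\<lambda>n. distr M borel (X n)) (distr M borel Y)"
  unfolding weakly_converges_def
proof (intro allI impI)
  interpret prob_space M by fact
  fix f :: "'a \<Rightarrow> real" assume f: "continuous_on UNIV f" "bounded (range f)"
  then have [measurable]: "f \<in> borel \<rightarrow>\<^sub>M borel" by (intro borel_measurable_continuous_onI)
  note meas[measurable]
  obtain K where K: "\<And>x. \<bar>f x\<bar> \<le> K" using f(2) by (auto simp: bounded_iff)
  have "(\<lambda>n. \<integral>z. f (X n z) \<partial>M) \<longlonglongrightarrow> (\<integral>z. f (Y z) \<partial>M)"
  proof (rule integral_dominated_convergence[where w="\<lambda>_. K"])
    show "AE z in M. (\<lambda>n. f (X n z)) \<longlonglongrightarrow> f (Y z)"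
      using lim by eventually_elim (rule continuous_on_tendsto_compose[OF f(1)], auto)
  qed (use K in auto)
  then show "(\<lambda>n. integral\<^sup>L (distr M borel (X n)) f) \<longlonglongrightarrow> integral\<^sup>L (distr M borel Y) f"
    by (simp add: integral_distr meas)
qed

theorem corollary2p9:
  fixes A :: "('m::{second_countable_topology, t2_space}, 'e::euclidean_space) chart set"
    and h :: "'m \<Rightarrow> 'e \<Rightarrow> 'e \<Rightarrow> real"
    and F :: "'m \<Rightarrow> 'e \<Rightarrow> real"
    and C :: "('m \<times> 'e) set"
    and B :: "('n::{second_countable_topology, t2_space}, 'f::real_normed_vector) chart set"
    and \<Phi> :: "'m \<Rightarrow> real \<times> 'n"
    and \<tau> :: "'m \<Rightarrow> real"
    and \<mu>0 \<mu>1 :: "'m measure"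
  assumes "lorentz_finsler_manifold A h F C"
    and "globally_hyperbolic A C"
    and "splitting A h F C B \<Phi>"
    and "\<tau> = fst \<circ> \<Phi>"
    and "(\<mu>0, \<mu>1) \<in> causal_pairs A C \<tau>"
  shows "\<exists>\<mu>0n \<mu>1n :: nat \<Rightarrow> 'm measure.
    (\<forall>n. (\<mu>0n n, \<mu>1n n) \<in> causal_pairs A C \<tau>) \<and>
    weakly_converges \<mu>0n \<mu>0 \<and> weakly_converges \<mu>1n \<mu>1 \<and>
    (\<forall>n. \<exists>\<psi>. dkp_solution (lorentz_cost A F C) (\<mu>0n n) (\<mu>1n n) \<psi>)"
proof -
  have A: "smooth_manifold A" and R: "riemannian_metric A h" and F: "lorentz_finsler_function A F"
    and C: "causal_structure A F C"
    using assms(1) by (auto simp: lorentz_finsler_manifold_def complete_riemannian_metric_def)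
  let ?c = "lorentz_cost A F C" and ?J = "J_plus A C"
  have c_MInf: "?c x y \<noteq> -\<infinity>" for x y
    using lorentz_cost_lower_bound[OF A R assms(3), where x = x and y = y] by auto
  have c_J: "?c x y \<noteq> \<infinity>" if "(x, y) \<in> ?J" for x y
    using lorentz_cost_J_plus[OF A F C that] by auto
  have c_refl: "?c x x \<noteq> \<infinity>" for x
    using c_J J_plus_refl[OF F C] by blast
  have "continuous_on UNIV \<Phi>"
    using assms(3) by (simp add: splitting_def diffeomorphism_def smooth_map_def)
  then have \<tau>[measurable]: "\<tau> \<in> borel \<rightarrow>\<^sub>M borel"
    unfolding assms(4) o_def by (intro borel_measurable_continuous_onI continuous_on_fst)
  obtain \<pi> where pi: "coupling \<mu>0 \<mu>1 \<pi>" "emeasure \<pi> ?J = 1"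
    using assms(5) by (auto simp: causal_pairs_def)
  note cp = couplingD[OF pi(1)]
  interpret prob_space \<pi> by (rule cp(1))
  have J: "?J \<in> sets \<pi>"
  proof (rule ccontr)
    assume "?J \<notin> sets \<pi>"
    then show False using pi(2) by (simp add: emeasure_notin_sets)
  qed
  have aeJ: "AE z in \<pi>. z \<in> ?J"
    using pi(2) J by (simp add: emeasure_eq_measure AE_in_set_eq_1)
  have "?J \<noteq> {}" using J_plus_refl[OF F C] by blast
  then obtain T where T: "\<forall>n. T n \<in> borel \<rightarrow>\<^sub>M borel" "\<forall>n. finite (range (T n))" "\<forall>n p. T n p \<in> ?J"
    "\<forall>p\<in>?J. (\<lambda>n. T n p) \<longlonglongrightarrow> p"
    by (rule discretisation_maps)
  have Tm: "T n \<in> \<pi> \<rightarrow>\<^sub>M borel" for n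
    using T(1) measurable_cong_sets[OF cp(2) refl] by auto
  have fstm: "(fst :: 'm \<times> 'm \<Rightarrow> 'm) \<in> borel \<rightarrow>\<^sub>M borel" and sndm: "(snd :: 'm \<times> 'm \<Rightarrow> 'm) \<in> borel \<rightarrow>\<^sub>M borel"
    by (auto intro!: borel_measurable_continuous_onI continuous_intros)
  have m0: "fst \<circ> T n \<in> \<pi> \<rightarrow>\<^sub>M borel" and m1: "snd \<circ> T n \<in> \<pi> \<rightarrow>\<^sub>M borel" for n
    using measurable_comp[OF Tm fstm] measurable_comp[OF Tm sndm] .
  define \<nu>0 where "\<nu>0 n = distr \<pi> borel (fst \<circ> T n)" for n
  define \<nu>1 where "\<nu>1 n = distr \<pi> borel (snd \<circ> T n)" for n
  define \<pi>n where "\<pi>n n = distr \<pi> borel (T n)" for n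
  have prob: "borel_prob (\<nu>0 n)" "borel_prob (\<nu>1 n)" "borel_prob (\<pi>n n)" for n
    unfolding borel_prob_def \<nu>0_def \<nu>1_def \<pi>n_def using m0 m1 Tm by (auto intro: prob_space_distr)
  have coup: "coupling (\<nu>0 n) (\<nu>1 n) (\<pi>n n)" for n
    unfolding coupling_def using prob(3)[of n] distr_distr[OF fstm Tm] distr_distr[OF sndm Tm]
    by (auto simp: \<nu>0_def \<nu>1_def \<pi>n_def)
  have Jb: "?J \<in> sets borel" using J cp(2) by simp
  have aen: "AE z in \<pi>n n. z \<in> ?J" for n
    unfolding \<pi>n_def using T(3) Jb by (subst AE_distr_iff[OF Tm]) auto
  have fin: "finite (range (fst \<circ> T n))" "finite (range (snd \<circ> T n))" for n
    unfolding image_comp[symmetric] using T(2)[rule_format, of n] by (simp_all only: finite_imageI)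
  have supp: "AE x in \<nu>0 n. x \<in> range (fst \<circ> T n)" "AE x in \<nu>1 n. x \<in> range (snd \<circ> T n)" for n
    unfolding \<nu>0_def \<nu>1_def using fin
    by (auto simp: AE_distr_iff[OF m0] AE_distr_iff[OF m1] finite_imp_closed)
  have int: "integrable \<rho> \<tau>" if r: "borel_prob \<rho>" "finite S" "AE x in \<rho>. x \<in> S" for \<rho> S
  proof -
    interpret r: prob_space \<rho> using r by (simp add: borel_prob_def)
    have m: "\<tau> \<in> \<rho> \<rightarrow>\<^sub>M borel" using r(1) \<tau> measurable_cong_sets[of \<rho> borel borel borel] by (auto simp: borel_prob_def)
    show ?thesis
    proof (rule r.integrable_const_bound[OF _ m])
      show "AE x in \<rho>. norm (\<tau> x) \<le> Max ((\<lambda>x. norm (\<tau> x)) ` S)"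
        using r(3) by eventually_elim (use r(2) in auto)
    qed
  qed
  have causal: "(\<nu>0 n, \<nu>1 n) \<in> causal_pairs A C \<tau>" for n
  proof -
    interpret n: prob_space "\<pi>n n" using prob(3) by (simp add: borel_prob_def)
    have "?J \<in> sets (\<pi>n n)" using Jb by (simp add: \<pi>n_def)
    then have "emeasure (\<pi>n n) ?J = 1"
      using aen[of n] by (simp add: n.emeasure_eq_measure n.AE_in_set_eq_1)
    then show ?thesis
      unfolding causal_pairs_def using prob int[OF prob(1) fin(1) supp(1)] int[OF prob(2) fin(2) supp(2)] coup
      by blast
  qed
  have dkp: "\<exists>\<psi>. dkp_solution ?c (\<nu>0 n) (\<nu>1 n) \<psi>" for n
  proof (rule finite_dkp_solution[OF prob(1) fin(1) supp(1) fin(2) supp(2) c_MInf c_refl coup])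
    show "AE (x, y) in \<pi>n n. ?c x y \<noteq> \<infinity>"
      using aen[of n] by eventually_elim (use c_J in auto)
  qed
  have w0: "weakly_converges \<nu>0 \<mu>0"
  proof -
    have "weakly_converges (\<lambda>n. distr \<pi> borel (fst \<circ> T n)) (distr \<pi> borel fst)"
    proof (rule weakly_converges_distr[OF cp(1) m0 cp(4)])
      show "AE z in \<pi>. (\<lambda>n. (fst \<circ> T n) z) \<longlonglongrightarrow> fst z"
        using aeJ by eventually_elim (use T(4) in \<open>auto intro: tendsto_fst\<close>)
    qed
    then show ?thesis by (simp add: cp(6) \<nu>0_def[abs_def])
  qed
  have w1: "weakly_converges \<nu>1 \<mu>1"
  proof -
    have "weakly_converges (\<lambda>n. distr \<pi> borel (snd \<circ> T n)) (distr \<pi> borel snd)"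
    proof (rule weakly_converges_distr[OF cp(1) m1 cp(5)])
      show "AE z in \<pi>. (\<lambda>n. (snd \<circ> T n) z) \<longlonglongrightarrow> snd z"
        using aeJ by eventually_elim (use T(4) in \<open>auto intro: tendsto_snd\<close>)
    qed
    then show ?thesis by (simp add: cp(7) \<nu>1_def[abs_def])
  qed
  show ?thesis using causal w0 w1 dkp by blast
qed

end
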